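(* Let $(\mathcal{C},\mathcal{M})$ be an AECat with the amalgamation property and let $\mathop{\perp\!\!\!\perp}$ be a simple independence relation. Then for every model $M$ and all subobjects $A,B,C\le M$ with $C\in\mathrm{base}(\mathop{\perp\!\!\!\perp})$ we have $A\mathop{\perp\!\!\!\perp}_C^MB \iff A\mathop{\perp\!\!\!\perp}^{\mathrm{isi\text{-}d},M}_CB\iff A\mathop{\perp\!\!\!\perp}^{\mathrm{isi\text{-}f},M}_CB$.
   Context: All cardinals are regular. An AECat is a pair $(\mathcal{C},\mathcal{M})$ of accessible categories with $\mathcal{M}$ a full subcategory of $\mathcal{C}$, such that $\mathcal{M}$ has directed colimits and the inclusion preserves them, and every arrow of $\mathcal{C}$ is a monomorphism. Objects of $\mathcal{M}$ are models. AP: every span $N_1\leftarrow M\to N_2$ of models completes to a commutative square into a model. An extension of a model $M$ is an arrow $M\to N$ with $N$ a model; given it and $a:A\to M$ we also write $a$ for $A\to M\to N$, and subobjects of $M$ are regarded as subobjects of $N$. $((a_i)_{i\in I};M)$ means $M$ is a model and each $a_i$ an arrow into $M$. $\mathrm{gtp}((a_i)_i;M)=\mathrm{gtp}((a_i')_i;M')$ means $\mathrm{dom}(a_i)=\mathrm{dom}(a_i')$ and there are extensions $f:M\to N$, $f':M'\to N$ with $fa_i=f'a_i'$ for all $i$. Lascar strong Galois types: $((a_i)_i/(b_j)_j;M)\sim((a_i')_i/(b_j)_j;M)$ if there are an extension $M\to N$ and $m_0:M_0\to N$, $M_0$ a model, with each $b_j$ factoring through $m_0$ and $\mathrm{gtp}((a_i)_i,m_0;N)=\mathrm{gtp}((a_i')_i,m_0;N)$;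 the transitive closure is written $\mathrm{Lgtp}((a_i)_i/(b_j)_j;M)=\mathrm{Lgtp}((a_i')_i/(b_j)_j;M)$. A base class is a collection $\mathcal{B}$ of objects of $\mathcal{C}$ containing all models; $C\in\mathcal{B}$ for a subobject means its domain is in $\mathcal{B}$. An independence relation is a relation on triples of subobjects of a model $M$, written $A\mathop{\perp\!\!\!\perp}_C^MB$ (arrows may replace the subobjects they represent; $M\le M$). $\mathrm{base}(\mathop{\perp\!\!\!\perp})=\mathcal{B}$ means $A\mathop{\perp\!\!\!\perp}_C^MB$ implies $C\in\mathcal{B}$. Properties: Invariance: $a\mathop{\perp\!\!\!\perp}_c^Mb$ and $\mathrm{gtp}(a,b,c;M)=\mathrm{gtp}(a',b',c';M')$ imply $a'\mathop{\perp\!\!\!\perp}_{c'}^{M'}b'$. Monotonicity: $A\mathop{\perp\!\!\!\perp}_C^MB$, $A'\le A$ imply $A'\mathop{\perp\!\!\!\perp}_C^MB$. Transitivity: $A\mathop{\perp\!\!\!\perp}_B^MC$, $A\mathop{\perp\!\!\!\perp}_C^MD$, $B\le C$ imply $A\mathop{\perp\!\!\!\perp}_B^MD$. Symmetry. Existence: $A\mathop{\perp\!\!\!\perp}_C^MC$ for $C\in\mathrm{base}(\mathop{\perp\!\!\!\perp})$. Extension: if $a\mathop{\perp\!\!\!\perp}_c^Mb$ and $b$ factors through $(b';M)$, there are an extension $M\to N$ and $(a';N)$ with $\mathrm{gtp}(a',b,c;N)=\mathrm{gtp}(a,b,c;M)$ and $a'\mathop{\perp\!\!\!\perp}_c^Nb'$.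 Union: if $(B_i)_{i\in I}$ is directed with a cocone into a model $M$ and $B=\mathrm{colim}_iB_i$ exists, then $A\mathop{\perp\!\!\!\perp}_C^MB_i$ for all $i$ implies $A\mathop{\perp\!\!\!\perp}_C^MB$. Base-Monotonicity: $A\mathop{\perp\!\!\!\perp}_C^MB$ and $C\le C'\le B$ with $C'\in\mathrm{base}(\mathop{\perp\!\!\!\perp})$ imply $A\mathop{\perp\!\!\!\perp}_{C'}^MB$. Club Local Character: let $\mathrm{Sub}^\kappa_{\mathcal{M}}(M)$ be the poset of subobjects of $M$ in $\mathcal{M}$ with $\kappa$-presentable domain; a nonempty $\mathcal{F}$ in it is club if every element is below some element of $\mathcal{F}$ and joins $\mathrm{colim}_{i<\theta}M_i$ of chains in $\mathcal{F}$ of length $\theta<\kappa$ lie in $\mathcal{F}$; the property: for every $\lambda$ there is $\Upsilon(\lambda)$ such that for all $\kappa\ge\Upsilon(\lambda)$, whenever $A,M\le N$, $A$ $\lambda$-presentable and $M$ a model, there is a club $\mathcal{F}\subseteq\mathrm{Sub}^\kappa_{\mathcal{M}}(M)$ with $A\mathop{\perp\!\!\!\perp}_{M_0}^NM$ for all $M_0\in\mathcal{F}$. Independence Theorem: if $a\mathop{\perp\!\!\!\perp}_c^Mb$, $a'\mathop{\perp\!\!\!\perp}_c^Mb'$, $b\mathop{\perp\!\!\!\perp}_c^Mb'$ and $\mathrm{Lgtp}(a/c;M)=\mathrm{Lgtp}(a'/c;M)$, there are an extension $M\to N$ and $(a^*;N)$ with $\mathrm{Lgtp}(a^*,b/c;N)=\mathrm{Lgtp}(a,b/c;N)$,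 $\mathrm{Lgtp}(a^*,b'/c;N)=\mathrm{Lgtp}(a',b'/c;N)$, $a^*\mathop{\perp\!\!\!\perp}_c^NM$. A simple independence relation satisfies all of the listed properties. Sequences: a chain of initial segments for $((b_i)_{i<\lambda};N)$ (same domains) is a continuous chain of models $(M_i)_{i<\lambda}$ with cocone $m_i:M_i\to N$ such that $b_i$ factors through $m_{i+1}$; $c$ embeds in it if $c$ factors through $m_0$; it is an isi-sequence over $c$ if $c$ embeds and $\mathrm{gtp}(b_i,m_i;N)=\mathrm{gtp}(b_j,m_i;N)$ for $i\le j$. Dividing: for a sequence $(b_i)_{i\in I}$ in an extension $N$ of $M$ with $\mathrm{gtp}(b_i,c;N)=\mathrm{gtp}(b,c;M)$, $\mathrm{gtp}(a,b,c;M)$ is consistent for it if there are an extension $N\to N'$ and $(a';N')$ with $\mathrm{gtp}(a',b_i,c;N')=\mathrm{gtp}(a,b,c;M)$ for all $i\in I$. $\mathrm{gtp}(a,b,c;M)$ isi-divides over $c$ if there is $\mu$ such that for every $\lambda\ge\mu$ there are an isi-sequence $(b_i)_{i<\lambda}$ over $c$ in an extension $N$ of $M$ with $\mathrm{gtp}(b_i,c;N)=\mathrm{gtp}(b,c;M)$ and $\kappa<\lambda$ such that for every $I\subseteq\lambda$ with $|I|=\kappa$ it is not consistent for $(b_i)_{i\in I}$. It isi-forks over $c$ if there are an extension $M\to N$ and $((a_j)_{j\in J},(d_j)_{j\in J};N)$ with each $\mathrm{gtp}(a_j,d_j,c;N)$ isi-dividing over $c$ such that for every extension $N\to N'$ and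 $(a';N')$ with $\mathrm{gtp}(a',b,c;N')=\mathrm{gtp}(a,b,c;N)$ some $j$ has $\mathrm{gtp}(a',d_j,c;N')=\mathrm{gtp}(a_j,d_j,c;N)$. $A\mathop{\perp\!\!\!\perp}^{\mathrm{isi\text{-}d},M}_CB$ (resp. $\mathop{\perp\!\!\!\perp}^{\mathrm{isi\text{-}f}}$) means $\mathrm{gtp}(a,b,c;M)$ does not isi-divide (resp. isi-fork) over $c$ for representatives $a,b,c$ of $A,B,C$ (independent of the choice). *)

theory Defs
  imports Main
begin

unbundle cardinal_syntax

section \<open>Universe and cardinals\<close>

text \<open>
  HOL has no proper classes. ``Set'' versus ``class'' is expressed by a strongly inaccessible
  cardinal \<open>\<Omega>\<close> (a Grothendieck universe): a set is small when its cardinality is below \<open>\<Omega>\<close>, and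
  ``cardinal'' means regular infinite cardinal below \<open>\<Omega>\<close>. A cardinal is an initial well-order on
  elements of the type \<open>'u\<close> underlying \<open>\<Omega>\<close>; every small cardinal, and every small poset, has a copy
  there. The element set \<open>Field \<nu>\<close> with the order \<open>\<nu>\<close> is the set of ordinals below \<open>\<nu>\<close>.
\<close>

definition inaccessible :: "'u rel \<Rightarrow> bool" where
  "inaccessible \<Omega> \<longleftrightarrow>
     Card_order \<Omega> \<and> natLeq <o \<Omega> \<and> regularCard \<Omega> \<and>
     (\<forall>A \<subseteq> Field \<Omega>. |A| <o \<Omega> \<longrightarrow> |Pow A| <o \<Omega>)"

definition small :: "'u rel \<Rightarrow> 'b set \<Rightarrow> bool" where
  "small \<Omega> X \<longleftrightarrow> |X| <o \<Omega>"

definition regular_cardinal :: "'u rel \<Rightarrow> 'u rel \<Rightarrow> bool" where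
  "regular_cardinal \<Omega> \<kappa> \<longleftrightarrow> Cinfinite \<kappa> \<and> regularCard \<kappa> \<and> \<kappa> <o \<Omega>"

text \<open>For posets (always reflexive on their field) the carrier is \<open>Field P\<close>.\<close>

definition directed :: "'k rel \<Rightarrow> 'i rel \<Rightarrow> bool" where
  "directed \<kappa> P \<longleftrightarrow>
     Partial_order P \<and>
     (\<forall>S \<subseteq> Field P. |S| <o \<kappa> \<longrightarrow> (\<exists>u \<in> Field P. \<forall>i \<in> S. (i, u) \<in> P))"

section \<open>Categories, directed colimits, accessibility\<close>

record ('o, 'a) cat =
  Obj :: "'o set"
  Arr :: "'a set"
  Dom :: "'a \<Rightarrow> 'o" (\<open>Dom\<index>\<close>)
  Cod :: "'a \<Rightarrow> 'o" (\<open>Cod\<index>\<close>)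
  Id :: "'o \<Rightarrow> 'a"
  Comp :: "'a \<Rightarrow> 'a \<Rightarrow> 'a" (infixr \<open>\<cdot>\<index>\<close> 70)

definition Hom :: "('o, 'a) cat \<Rightarrow> 'o \<Rightarrow> 'o \<Rightarrow> 'a set" where
  "Hom C X Y = {f \<in> Arr C. Dom\<^bsub>C\<^esub> f = X \<and> Cod\<^bsub>C\<^esub> f = Y}"

definition category :: "('o, 'a) cat \<Rightarrow> bool" where
  "category C \<longleftrightarrow>
     (\<forall>f \<in> Arr C. Dom\<^bsub>C\<^esub> f \<in> Obj C \<and> Cod\<^bsub>C\<^esub> f \<in> Obj C) \<and>
     (\<forall>X \<in> Obj C. Id C X \<in> Hom C X X) \<and>
     (\<forall>X Y Z f g. f \<in> Hom C X Y \<longrightarrow> g \<in> Hom C Y Z \<longrightarrow> g \<cdot>\<^bsub>C\<^esub> f \<in> Hom C X Z) \<and>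
     (\<forall>X Y f. f \<in> Hom C X Y \<longrightarrow> Id C Y \<cdot>\<^bsub>C\<^esub> f = f \<and> f \<cdot>\<^bsub>C\<^esub> Id C X = f) \<and>
     (\<forall>W X Y Z f g h. f \<in> Hom C W X \<longrightarrow> g \<in> Hom C X Y \<longrightarrow> h \<in> Hom C Y Z \<longrightarrow>
        (h \<cdot>\<^bsub>C\<^esub> g) \<cdot>\<^bsub>C\<^esub> f = h \<cdot>\<^bsub>C\<^esub> (g \<cdot>\<^bsub>C\<^esub> f))"

definition locally_small :: "'u rel \<Rightarrow> ('o, 'a) cat \<Rightarrow> bool" where
  "locally_small \<Omega> C \<longleftrightarrow> (\<forall>X \<in> Obj C. \<forall>Y \<in> Obj C. small \<Omega> (Hom C X Y))"

definition full_subcat :: "('o, 'a) cat \<Rightarrow> 'o set \<Rightarrow> ('o, 'a) cat" where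
  "full_subcat C S = C\<lparr>Obj := S, Arr := {f \<in> Arr C. Dom\<^bsub>C\<^esub> f \<in> S \<and> Cod\<^bsub>C\<^esub> f \<in> S}\<rparr>"

definition monic :: "('o, 'a) cat \<Rightarrow> 'a \<Rightarrow> bool" where
  "monic C f \<longleftrightarrow>
     (\<forall>W. \<forall>g \<in> Hom C W (Dom\<^bsub>C\<^esub> f). \<forall>h \<in> Hom C W (Dom\<^bsub>C\<^esub> f). f \<cdot>\<^bsub>C\<^esub> g = f \<cdot>\<^bsub>C\<^esub> h \<longrightarrow> g = h)"

text \<open>A diagram on the poset \<open>P\<close>: objects \<open>D i\<close> and transition arrows \<open>T i j : D i \<rightarrow> D j\<close> for
  \<open>i \<le> j\<close>.\<close>

definition diagram ::
  "('o, 'a) cat \<Rightarrow> 'i rel \<Rightarrow> ('i \<Rightarrow> 'o) \<Rightarrow> ('i \<Rightarrow> 'i \<Rightarrow> 'a) \<Rightarrow> bool" where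
  "diagram C P D T \<longleftrightarrow>
     (\<forall>i \<in> Field P. D i \<in> Obj C \<and> T i i = Id C (D i)) \<and>
     (\<forall>i j. (i, j) \<in> P \<longrightarrow> T i j \<in> Hom C (D i) (D j)) \<and>
     (\<forall>i j k. (i, j) \<in> P \<longrightarrow> (j, k) \<in> P \<longrightarrow> T j k \<cdot>\<^bsub>C\<^esub> T i j = T i k)"

definition cocone ::
  "('o, 'a) cat \<Rightarrow> 'i rel \<Rightarrow> ('i \<Rightarrow> 'o) \<Rightarrow> ('i \<Rightarrow> 'i \<Rightarrow> 'a) \<Rightarrow> 'o \<Rightarrow> ('i \<Rightarrow> 'a) \<Rightarrow> bool" where
  "cocone C P D T X k \<longleftrightarrow>
     X \<in> Obj C \<and> (\<forall>i \<in> Field P. k i \<in> Hom C (D i) X) \<and>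
     (\<forall>i j. (i, j) \<in> P \<longrightarrow> k j \<cdot>\<^bsub>C\<^esub> T i j = k i)"

definition colimit ::
  "('o, 'a) cat \<Rightarrow> 'i rel \<Rightarrow> ('i \<Rightarrow> 'o) \<Rightarrow> ('i \<Rightarrow> 'i \<Rightarrow> 'a) \<Rightarrow> 'o \<Rightarrow> ('i \<Rightarrow> 'a) \<Rightarrow> bool" where
  "colimit C P D T X k \<longleftrightarrow>
     cocone C P D T X k \<and>
     (\<forall>Y d. cocone C P D T Y d \<longrightarrow>
        (\<exists>!h. h \<in> Hom C X Y \<and> (\<forall>i \<in> Field P. h \<cdot>\<^bsub>C\<^esub> k i = d i)))"

definition has_directed_colimits :: "'u rel \<Rightarrow> 'k rel \<Rightarrow> ('o, 'a) cat \<Rightarrow> bool" where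
  "has_directed_colimits \<Omega> \<kappa> C \<longleftrightarrow>
     (\<forall>(P :: 'u rel) D T. directed \<kappa> P \<and> small \<Omega> (Field P) \<and> diagram C P D T \<longrightarrow>
        (\<exists>X k. colimit C P D T X k))"

text \<open>\<open>A\<close> is \<open>\<kappa>\<close>-presentable when \<open>Hom(A, -)\<close> preserves \<open>\<kappa>\<close>-directed colimits; the two conjuncts
  say that the canonical map from \<open>colim Hom(A, D i)\<close> to \<open>Hom(A, X)\<close> is onto and one-to-one.\<close>

definition presentable :: "'u rel \<Rightarrow> 'u rel \<Rightarrow> ('o, 'a) cat \<Rightarrow> 'o \<Rightarrow> bool" where
  "presentable \<Omega> \<kappa> C A \<longleftrightarrow>
     A \<in> Obj C \<and>
     (\<forall>(P :: 'u rel) D T X k.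
        directed \<kappa> P \<and> small \<Omega> (Field P) \<and> diagram C P D T \<and> colimit C P D T X k \<longrightarrow>
        (\<forall>f \<in> Hom C A X. \<exists>i \<in> Field P. \<exists>g \<in> Hom C A (D i). k i \<cdot>\<^bsub>C\<^esub> g = f) \<and>
        (\<forall>i \<in> Field P. \<forall>j \<in> Field P. \<forall>g \<in> Hom C A (D i). \<forall>h \<in> Hom C A (D j).
           k i \<cdot>\<^bsub>C\<^esub> g = k j \<cdot>\<^bsub>C\<^esub> h \<longrightarrow>
           (\<exists>l. (i, l) \<in> P \<and> (j, l) \<in> P \<and> T i l \<cdot>\<^bsub>C\<^esub> g = T j l \<cdot>\<^bsub>C\<^esub> h)))"

definition accessible_at :: "'u rel \<Rightarrow> 'u rel \<Rightarrow> ('o, 'a) cat \<Rightarrow> bool" where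
  "accessible_at \<Omega> \<kappa> C \<longleftrightarrow>
     has_directed_colimits \<Omega> \<kappa> C \<and>
     (\<exists>S \<subseteq> Obj C. small \<Omega> S \<and> (\<forall>A \<in> S. presentable \<Omega> \<kappa> C A) \<and>
        (\<forall>X \<in> Obj C. \<exists>(P :: 'u rel) D T k.
           directed \<kappa> P \<and> small \<Omega> (Field P) \<and> diagram C P D T \<and>
           (\<forall>i \<in> Field P. D i \<in> S) \<and> colimit C P D T X k))"

definition accessible :: "'u rel \<Rightarrow> ('o, 'a) cat \<Rightarrow> bool" where
  "accessible \<Omega> C \<longleftrightarrow>
     category C \<and> locally_small \<Omega> C \<and> (\<exists>\<kappa>. regular_cardinal \<Omega> \<kappa> \<and> accessible_at \<Omega> \<kappa> C)"

section \<open>Subobjects\<close>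

definition factors_through :: "('o, 'a) cat \<Rightarrow> 'a \<Rightarrow> 'a \<Rightarrow> bool" where
  "factors_through C a b \<longleftrightarrow>
     a \<in> Arr C \<and> b \<in> Arr C \<and> Cod\<^bsub>C\<^esub> a = Cod\<^bsub>C\<^esub> b \<and>
     (\<exists>h \<in> Hom C (Dom\<^bsub>C\<^esub> a) (Dom\<^bsub>C\<^esub> b). b \<cdot>\<^bsub>C\<^esub> h = a)"

text \<open>The subobject represented by a monomorphism \<open>a\<close>, as an equivalence class of arrows.\<close>

definition subobj :: "('o, 'a) cat \<Rightarrow> 'a \<Rightarrow> 'a set" where
  "subobj C a = {b. factors_through C a b \<and> factors_through C b a}"

definition Sub :: "('o, 'a) cat \<Rightarrow> 'o \<Rightarrow> 'a set set" where
  "Sub C M = {subobj C a | a. a \<in> Arr C \<and> Cod\<^bsub>C\<^esub> a = M}"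

definition sub_le :: "('o, 'a) cat \<Rightarrow> 'a set \<Rightarrow> 'a set \<Rightarrow> bool" where
  "sub_le C A B \<longleftrightarrow> (\<exists>a \<in> A. \<exists>b \<in> B. factors_through C a b)"

text \<open>Membership of a subobject in a class of objects, up to the choice of representative.\<close>

definition dom_in :: "('o, 'a) cat \<Rightarrow> 'o set \<Rightarrow> 'a set \<Rightarrow> bool" where
  "dom_in C \<B> A \<longleftrightarrow> (\<exists>a \<in> A. Dom\<^bsub>C\<^esub> a \<in> \<B>)"

section \<open>Successor and limit elements of a well-order\<close>

definition is_least :: "'i rel \<Rightarrow> 'i \<Rightarrow> bool" where
  "is_least r z \<longleftrightarrow> z \<in> Field r \<and> (\<forall>i \<in> Field r. (z, i) \<in> r)"

definition is_succ :: "'i rel \<Rightarrow> 'i \<Rightarrow> 'i \<Rightarrow> bool" where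
  "is_succ r i j \<longleftrightarrow> i \<in> underS r j \<and> (\<forall>k. i \<in> underS r k \<longrightarrow> (j, k) \<in> r)"

definition is_limit :: "'i rel \<Rightarrow> 'i \<Rightarrow> bool" where
  "is_limit r l \<longleftrightarrow> l \<in> Field r \<and> \<not> is_least r l \<and> \<not> (\<exists>i. is_succ r i l)"

section \<open>AECats\<close>

locale AECat =
  fixes \<Omega> :: "'u rel" and C :: "('o, 'a) cat" (structure) and Mod :: "'o set"
  assumes accessible_C: "accessible \<Omega> C"
    and Mod_sub: "Mod \<subseteq> Obj C"
    and accessible_Mod: "accessible \<Omega> (full_subcat C Mod)"
    and directed_colimits_Mod: "has_directed_colimits \<Omega> natLeq (full_subcat C Mod)"
    and inclusion_preserves:
      "\<And>(P :: 'u rel) D T X k. directed natLeq P \<Longrightarrow> small \<Omega> (Field P) \<Longrightarrow>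
         diagram (full_subcat C Mod) P D T \<Longrightarrow> colimit (full_subcat C Mod) P D T X k \<Longrightarrow>
         colimit C P D T X k"
    and all_monic: "\<And>f. f \<in> Arr C \<Longrightarrow> monic C f"
begin

definition extension :: "'o \<Rightarrow> 'a \<Rightarrow> 'o \<Rightarrow> bool" where
  "extension M f N \<longleftrightarrow> M \<in> Mod \<and> N \<in> Mod \<and> f \<in> Hom C M N"

definition arrow_into :: "'a \<Rightarrow> 'o \<Rightarrow> bool" where
  "arrow_into a M \<longleftrightarrow> a \<in> Arr C \<and> Cod a = M"

definition amalgamation :: bool where
  "amalgamation \<longleftrightarrow>
     (\<forall>M N1 N2 f1 f2. extension M f1 N1 \<and> extension M f2 N2 \<longrightarrow>
        (\<exists>N g1 g2. extension N1 g1 N \<and> extension N2 g2 N \<and> g1 \<cdot> f1 = g2 \<cdot> f2))"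

subsection \<open>Galois types\<close>

text \<open>\<open>gtp_eq as M as' M'\<close> is \<open>gtp(as; M) = gtp(as'; M')\<close>. Tuples are lists, since only finite
  families occur below.\<close>

definition gtp_eq :: "'a list \<Rightarrow> 'o \<Rightarrow> 'a list \<Rightarrow> 'o \<Rightarrow> bool" where
  "gtp_eq as M as' M' \<longleftrightarrow>
     M \<in> Mod \<and> M' \<in> Mod \<and>
     (\<forall>a \<in> set as. arrow_into a M) \<and> (\<forall>a \<in> set as'. arrow_into a M') \<and>
     map (\<lambda>a. Dom a) as = map (\<lambda>a. Dom a) as' \<and>
     (\<exists>N f f'. extension M f N \<and> extension M' f' N \<and>
        map (\<lambda>a. f \<cdot> a) as = map (\<lambda>a. f' \<cdot> a) as')"

definition lascar_step :: "'o \<Rightarrow> 'a list \<Rightarrow> 'a list \<Rightarrow> 'a list \<Rightarrow> bool" where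
  "lascar_step M bs as as' \<longleftrightarrow>
     (\<forall>a \<in> set as \<union> set as' \<union> set bs. arrow_into a M) \<and>
     (\<exists>N f m0. extension M f N \<and> arrow_into m0 N \<and> Dom m0 \<in> Mod \<and>
        (\<forall>b \<in> set bs. factors_through C (f \<cdot> b) m0) \<and>
        gtp_eq (map (\<lambda>a. f \<cdot> a) as @ [m0]) N (map (\<lambda>a. f \<cdot> a) as' @ [m0]) N)"

definition Lgtp_eq :: "'a list \<Rightarrow> 'a list \<Rightarrow> 'a list \<Rightarrow> 'o \<Rightarrow> bool" where
  "Lgtp_eq as as' bs M \<longleftrightarrow> (lascar_step M bs)\<^sup>+\<^sup>+ as as'"

subsection \<open>Independence relations\<close>

text \<open>The argument order of an independence relation \<open>ind\<close> follows the notation with \<open>C\<close> as a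
  subscript: \<open>ind M A C B\<close> says that \<open>A\<close> is independent from \<open>B\<close> over \<open>C\<close> in \<open>M\<close>. Here
  \<open>A\<close>, \<open>C\<close>, \<open>B\<close> are subobjects, i.e. classes of arrows, and \<open>indep\<close> is its version for
  representatives. Since the ambient category is called \<open>C\<close>, the base subobject is named \<open>K\<close>.\<close>

definition base_class :: "'o set \<Rightarrow> bool" where
  "base_class \<B> \<longleftrightarrow> Mod \<subseteq> \<B> \<and> \<B> \<subseteq> Obj C"

definition independence_relation ::
  "'o set \<Rightarrow> ('o \<Rightarrow> 'a set \<Rightarrow> 'a set \<Rightarrow> 'a set \<Rightarrow> bool) \<Rightarrow> bool" where
  "independence_relation \<B> ind \<longleftrightarrow>
     base_class \<B> \<and>
     (\<forall>M A K B. ind M A K B \<longrightarrow>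
        M \<in> Mod \<and> A \<in> Sub C M \<and> K \<in> Sub C M \<and> B \<in> Sub C M \<and> dom_in C \<B> K)"

definition indep ::
  "('o \<Rightarrow> 'a set \<Rightarrow> 'a set \<Rightarrow> 'a set \<Rightarrow> bool) \<Rightarrow> 'o \<Rightarrow> 'a \<Rightarrow> 'a \<Rightarrow> 'a \<Rightarrow> bool" where
  "indep ind M a c b \<longleftrightarrow>
     arrow_into a M \<and> arrow_into c M \<and> arrow_into b M \<and>
     ind M (subobj C a) (subobj C c) (subobj C b)"

definition Invariance :: "('o \<Rightarrow> 'a set \<Rightarrow> 'a set \<Rightarrow> 'a set \<Rightarrow> bool) \<Rightarrow> bool" where
  "Invariance ind \<longleftrightarrow>
     (\<forall>M M' a b c a' b' c'. indep ind M a c b \<and> gtp_eq [a, b, c] M [a', b', c'] M' \<longrightarrow>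
        indep ind M' a' c' b')"

definition Monotonicity :: "('o \<Rightarrow> 'a set \<Rightarrow> 'a set \<Rightarrow> 'a set \<Rightarrow> bool) \<Rightarrow> bool" where
  "Monotonicity ind \<longleftrightarrow>
     (\<forall>M A A' K B. ind M A K B \<and> A' \<in> Sub C M \<and> sub_le C A' A \<longrightarrow> ind M A' K B)"

definition Transitivity :: "('o \<Rightarrow> 'a set \<Rightarrow> 'a set \<Rightarrow> 'a set \<Rightarrow> bool) \<Rightarrow> bool" where
  "Transitivity ind \<longleftrightarrow>
     (\<forall>M A B K D. ind M A B K \<and> ind M A K D \<and> sub_le C B K \<longrightarrow> ind M A B D)"

definition Symmetry :: "('o \<Rightarrow> 'a set \<Rightarrow> 'a set \<Rightarrow> 'a set \<Rightarrow> bool) \<Rightarrow> bool" where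
  "Symmetry ind \<longleftrightarrow> (\<forall>M A K B. ind M A K B \<longrightarrow> ind M B K A)"

definition Existence ::
  "'o set \<Rightarrow> ('o \<Rightarrow> 'a set \<Rightarrow> 'a set \<Rightarrow> 'a set \<Rightarrow> bool) \<Rightarrow> bool" where
  "Existence \<B> ind \<longleftrightarrow>
     (\<forall>M \<in> Mod. \<forall>A \<in> Sub C M. \<forall>K \<in> Sub C M. dom_in C \<B> K \<longrightarrow> ind M A K K)"

definition Extension :: "('o \<Rightarrow> 'a set \<Rightarrow> 'a set \<Rightarrow> 'a set \<Rightarrow> bool) \<Rightarrow> bool" where
  "Extension ind \<longleftrightarrow>
     (\<forall>M a b c b'. indep ind M a c b \<and> arrow_into b' M \<and> factors_through C b b' \<longrightarrow>
        (\<exists>N f a'. extension M f N \<and> arrow_into a' N \<and>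
           gtp_eq [a', f \<cdot> b, f \<cdot> c] N [a, b, c] M \<and>
           indep ind N a' (f \<cdot> c) (f \<cdot> b')))"

definition Union_property :: "('o \<Rightarrow> 'a set \<Rightarrow> 'a set \<Rightarrow> 'a set \<Rightarrow> bool) \<Rightarrow> bool" where
  "Union_property ind \<longleftrightarrow>
     (\<forall>(P :: 'u rel) D T M bs B k b A K.
        directed natLeq P \<and> small \<Omega> (Field P) \<and> diagram C P D T \<and>
        M \<in> Mod \<and> cocone C P D T M bs \<and> colimit C P D T B k \<and>
        b \<in> Hom C B M \<and> (\<forall>i \<in> Field P. b \<cdot> k i = bs i) \<and>
        (\<forall>i \<in> Field P. ind M A K (subobj C (bs i))) \<longrightarrow>
        ind M A K (subobj C b))"

definition Base_Monotonicity ::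
  "'o set \<Rightarrow> ('o \<Rightarrow> 'a set \<Rightarrow> 'a set \<Rightarrow> 'a set \<Rightarrow> bool) \<Rightarrow> bool" where
  "Base_Monotonicity \<B> ind \<longleftrightarrow>
     (\<forall>M A K K' B. ind M A K B \<and> K' \<in> Sub C M \<and> sub_le C K K' \<and> sub_le C K' B \<and>
        dom_in C \<B> K' \<longrightarrow> ind M A K' B)"

text \<open>Presentability is always computed in the ambient category \<open>C\<close>.\<close>

definition SubMod :: "'u rel \<Rightarrow> 'o \<Rightarrow> 'a set set" where
  "SubMod \<kappa> M = {S \<in> Sub C M. \<exists>m \<in> S. Dom m \<in> Mod \<and> presentable \<Omega> \<kappa> C (Dom m)}"

text \<open>A chain is a diagram of models indexed by a nonempty well-order \<open>\<theta>\<close> of length less than \<open>\<kappa>\<close>;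
  its join is the arrow \<open>u\<close> out of the colimit.\<close>

definition club :: "'u rel \<Rightarrow> 'o \<Rightarrow> 'a set set \<Rightarrow> bool" where
  "club \<kappa> M F \<longleftrightarrow>
     F \<subseteq> SubMod \<kappa> M \<and> F \<noteq> {} \<and>
     (\<forall>S \<in> SubMod \<kappa> M. \<exists>S' \<in> F. sub_le C S S') \<and>
     (\<forall>(\<theta> :: 'u rel) D T m X k u.
        Well_order \<theta> \<and> Field \<theta> \<noteq> {} \<and> \<theta> <o \<kappa> \<and>
        diagram (full_subcat C Mod) \<theta> D T \<and> cocone C \<theta> D T M m \<and>
        (\<forall>i \<in> Field \<theta>. subobj C (m i) \<in> F) \<and>
        colimit (full_subcat C Mod) \<theta> D T X k \<and>
        u \<in> Hom C X M \<and> (\<forall>i \<in> Field \<theta>. u \<cdot> k i = m i) \<longrightarrow>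
        subobj C u \<in> F)"

definition Club_Local_Character ::
  "('o \<Rightarrow> 'a set \<Rightarrow> 'a set \<Rightarrow> 'a set \<Rightarrow> bool) \<Rightarrow> bool" where
  "Club_Local_Character ind \<longleftrightarrow>
     (\<forall>\<nu>. regular_cardinal \<Omega> \<nu> \<longrightarrow>
       (\<exists>\<Upsilon>. regular_cardinal \<Omega> \<Upsilon> \<and>
         (\<forall>\<kappa>. regular_cardinal \<Omega> \<kappa> \<and> \<Upsilon> \<le>o \<kappa> \<longrightarrow>
           (\<forall>N a M m. arrow_into a N \<and> presentable \<Omega> \<nu> C (Dom a) \<and> extension M m N \<longrightarrow>
             (\<exists>F. club \<kappa> M F \<and>
               (\<forall>S \<in> F. \<forall>m0 \<in> S. indep ind N a (m \<cdot> m0) m))))))"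

definition Independence_Theorem ::
  "('o \<Rightarrow> 'a set \<Rightarrow> 'a set \<Rightarrow> 'a set \<Rightarrow> bool) \<Rightarrow> bool" where
  "Independence_Theorem ind \<longleftrightarrow>
     (\<forall>M a a' b b' c.
        indep ind M a c b \<and> indep ind M a' c b' \<and> indep ind M b c b' \<and>
        Lgtp_eq [a] [a'] [c] M \<longrightarrow>
        (\<exists>N f s. extension M f N \<and> arrow_into s N \<and>
           Lgtp_eq [s, f \<cdot> b] [f \<cdot> a, f \<cdot> b] [f \<cdot> c] N \<and>
           Lgtp_eq [s, f \<cdot> b'] [f \<cdot> a', f \<cdot> b'] [f \<cdot> c] N \<and>
           indep ind N s (f \<cdot> c) f))"

definition simple_independence_relation ::
  "'o set \<Rightarrow> ('o \<Rightarrow> 'a set \<Rightarrow> 'a set \<Rightarrow> 'a set \<Rightarrow> bool) \<Rightarrow> bool" where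
  "simple_independence_relation \<B> ind \<longleftrightarrow>
     independence_relation \<B> ind \<and> Invariance ind \<and> Monotonicity ind \<and> Transitivity ind \<and>
     Symmetry ind \<and> Existence \<B> ind \<and> Extension ind \<and> Union_property ind \<and>
     Base_Monotonicity \<B> ind \<and> Club_Local_Character ind \<and> Independence_Theorem ind"

subsection \<open>Isi-sequences, isi-dividing and isi-forking\<close>

text \<open>Continuity: at a limit \<open>l\<close>, the arrows \<open>T i l\<close> exhibit \<open>Ms l\<close> as the colimit of the chain
  strictly below \<open>l\<close>.\<close>

definition chain_of_initial_segments ::
  "'u rel \<Rightarrow> ('u \<Rightarrow> 'a) \<Rightarrow> 'o \<Rightarrow> ('u \<Rightarrow> 'o) \<Rightarrow> ('u \<Rightarrow> 'u \<Rightarrow> 'a) \<Rightarrow> ('u \<Rightarrow> 'a) \<Rightarrow> bool" where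
  "chain_of_initial_segments \<nu> bs N Ms T m \<longleftrightarrow>
     N \<in> Mod \<and>
     (\<forall>i \<in> Field \<nu>. arrow_into (bs i) N) \<and>
     (\<forall>i \<in> Field \<nu>. \<forall>j \<in> Field \<nu>. Dom (bs i) = Dom (bs j)) \<and>
     diagram (full_subcat C Mod) \<nu> Ms T \<and>
     (\<forall>l. is_limit \<nu> l \<longrightarrow>
        colimit (full_subcat C Mod) (Restr \<nu> (underS \<nu> l)) Ms T (Ms l) (\<lambda>i. T i l)) \<and>
     cocone C \<nu> Ms T N m \<and>
     (\<forall>i j. is_succ \<nu> i j \<longrightarrow> factors_through C (bs i) (m j))"

definition isi_sequence :: "'u rel \<Rightarrow> ('u \<Rightarrow> 'a) \<Rightarrow> 'a \<Rightarrow> 'o \<Rightarrow> bool" where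
  "isi_sequence \<nu> bs c N \<longleftrightarrow>
     (\<exists>Ms T m. chain_of_initial_segments \<nu> bs N Ms T m \<and>
        (\<forall>z. is_least \<nu> z \<longrightarrow> factors_through C c (m z)) \<and>
        (\<forall>i j. (i, j) \<in> \<nu> \<longrightarrow> gtp_eq [bs i, m i] N [bs j, m i] N))"

text \<open>\<open>consistent a b c M I bs f N\<close>: \<open>gtp(a, b, c; M)\<close> is consistent for the sequence
  \<open>(bs i)\<^sub>i\<^sub>\<in>\<^sub>I\<close> in the extension \<open>f : M \<rightarrow> N\<close>.\<close>

definition consistent ::
  "'a \<Rightarrow> 'a \<Rightarrow> 'a \<Rightarrow> 'o \<Rightarrow> 'u set \<Rightarrow> ('u \<Rightarrow> 'a) \<Rightarrow> 'a \<Rightarrow> 'o \<Rightarrow> bool" where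
  "consistent a b c M I bs f N \<longleftrightarrow>
     (\<exists>N' g a'. extension N g N' \<and> arrow_into a' N' \<and>
        (\<forall>i \<in> I. gtp_eq [a', g \<cdot> bs i, g \<cdot> (f \<cdot> c)] N' [a, b, c] M))"

definition isi_divides :: "'a \<Rightarrow> 'a \<Rightarrow> 'a \<Rightarrow> 'o \<Rightarrow> bool" where
  "isi_divides a b c M \<longleftrightarrow>
     (\<exists>\<mu>. regular_cardinal \<Omega> \<mu> \<and>
       (\<forall>\<nu>. regular_cardinal \<Omega> \<nu> \<and> \<mu> \<le>o \<nu> \<longrightarrow>
         (\<exists>N f bs \<kappa>. extension M f N \<and> isi_sequence \<nu> bs (f \<cdot> c) N \<and>
           (\<forall>i \<in> Field \<nu>. gtp_eq [bs i, f \<cdot> c] N [b, c] M) \<and>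
           regular_cardinal \<Omega> \<kappa> \<and> \<kappa> <o \<nu> \<and>
           (\<forall>I \<subseteq> Field \<nu>. |I| =o \<kappa> \<longrightarrow> \<not> consistent a b c M I bs f N))))"

definition isi_forks :: "'a \<Rightarrow> 'a \<Rightarrow> 'a \<Rightarrow> 'o \<Rightarrow> bool" where
  "isi_forks a b c M \<longleftrightarrow>
     (\<exists>N f (J :: 'u set) as ds. extension M f N \<and> small \<Omega> J \<and>
        (\<forall>j \<in> J. arrow_into (as j) N \<and> arrow_into (ds j) N \<and>
           isi_divides (as j) (ds j) (f \<cdot> c) N) \<and>
        (\<forall>N' g a'. extension N g N' \<and> arrow_into a' N' \<and>
           gtp_eq [a', g \<cdot> (f \<cdot> b), g \<cdot> (f \<cdot> c)] N' [f \<cdot> a, f \<cdot> b, f \<cdot> c] N \<longrightarrow>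
           (\<exists>j \<in> J. gtp_eq [a', g \<cdot> ds j, g \<cdot> (f \<cdot> c)] N' [as j, ds j, f \<cdot> c] N)))"

definition isi_d_independent :: "'o \<Rightarrow> 'a set \<Rightarrow> 'a set \<Rightarrow> 'a set \<Rightarrow> bool" where
  "isi_d_independent M A K B \<longleftrightarrow> (\<forall>a \<in> A. \<forall>b \<in> B. \<forall>c \<in> K. \<not> isi_divides a b c M)"

definition isi_f_independent :: "'o \<Rightarrow> 'a set \<Rightarrow> 'a set \<Rightarrow> 'a set \<Rightarrow> bool" where
  "isi_f_independent M A K B \<longleftrightarrow> (\<forall>a \<in> A. \<forall>b \<in> B. \<forall>c \<in> K. \<not> isi_forks a b c M)"

end

end

theory Submission
  imports Defs
begin

text \<open>
  Isi-sequences are long, so local character can be applied at a point \<open>\<delta>\<close> of large cofinality of the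
  index set: any arrow is independent from \<open>M\<^sub>\<delta>\<close> over some earlier model \<open>M\<^sub>j\<close> of the chain, because a
  presentable submodel of the colimit \<open>M\<^sub>\<delta>\<close> already lies in some \<open>M\<^sub>j\<close>.

  Independence implies non-dividing: applied to \<open>b\<^sub>\<delta>\<close> this makes the \<open>b\<^sub>i\<close>, \<open>j \<le> i < \<delta>\<close>, an independent
  sequence over \<open>M\<^sub>j\<close> (they realise the type of \<open>b\<^sub>\<delta>\<close> over \<open>M\<^sub>i\<close>), and the independence theorem over the
  model \<open>M\<^sub>j\<close> amalgamates the copies of the type of \<open>a\<close>. Since Galois types need not be continuous, the
  limit steps are handled by keeping the realisation of \<open>a\<close> fixed and moving the models \<open>M\<^sub>i\<close> into a
  growing chain \<open>N\<^sub>i\<close> instead.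

  Non-dividing implies independence: extension yields arbitrarily long isi-sequences with \<open>b\<^sub>i\<close>
  independent from \<open>M\<^sub>i\<close> over \<open>c\<close>. If \<open>a'\<close> realises the type of \<open>a\<close> over many \<open>b\<^sub>i\<close>, then local
  character makes \<open>a'\<close> independent from some \<open>b\<^sub>i\<close> over \<open>M\<^sub>i\<close>, and transitivity finishes.

  Forking: if \<open>a\<close> is independent from \<open>b\<close>, extension makes it independent from a whole model, and hence
  from all the dividing parameters \<open>d\<^sub>j\<close> in it.
\<close>

section \<open>Cardinals\<close>

text \<open>Galois types can be fed to the independence theorem because, over a model, equal Galois
  types are Lascar equal in a single step. This forces a model as base: the realisation of
  \<open>a\<close> is made independent from a whole model, so that Base-Monotonicity can raise
  \<open>c\<close> to a member of the chain. The order of choices follows the quantifiers of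
  dividing. The bound \<Upsilon> of local character depends only on the domain of an arrow, so it is
  available before the sequence. Against dividing, the number \<open>\<kappa>'\<close> of
  inconsistent copies is known only once the length \<nu> is, so \<delta> is taken for the larger of
  \<Upsilon> and \<open>\<kappa>'\<close>. From non-dividing, every \<open>\<kappa> < \<nu>\<close>
  is available, and \<Upsilon> is used. An equality of types is a pair of embeddings into a common
  model. Instead of replacing a realisation over an old model, the model carrying it is embedded so
  that it lands on the new realisation. Both transfinite constructions do this: types over a fixed
  base are then preserved automatically, and only independence must be carried through limits, by
  Union.\<close>

lemma regular_cardinalD:
  assumes "regular_cardinal \<Omega> \<kappa>"
  shows "Card_order \<kappa>" "Well_order \<kappa>" "infinite (Field \<kappa>)" "regularCard \<kappa>" "\<kappa> <o \<Omega>"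
    "stable \<kappa>"
  using assms regularCard_stable[of \<kappa>]
  by (auto simp: regular_cardinal_def cinfinite_def card_order_on_def)

lemma regular_cardinal_small: "regular_cardinal \<Omega> \<kappa> \<Longrightarrow> small \<Omega> (Field \<kappa>)"
  unfolding small_def by (rule ordLess_Field) (auto dest: regular_cardinalD)

lemma finite_less_regular:
  assumes "regular_cardinal \<Omega> \<kappa>" "finite A"
  shows "|A| <o \<kappa>"
proof (rule ccontr)
  assume "\<not> |A| <o \<kappa>"
  then have "\<kappa> \<le>o |A|"
    using not_ordLeq_iff_ordLess regular_cardinalD(2)[OF assms(1)] card_of_Well_order by blast
  then have "|Field \<kappa>| \<le>o |A|" using card_of_mono2[of \<kappa> "|A|"] by (simp add: Field_card_of)
  then show False
    using card_of_ordLeq_finite assms(2) regular_cardinalD(3)[OF assms(1)] by blast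
qed

text \<open>The successor of the cardinality of \<open>X\<close> is regular, and it stays below
  \<Omega> because it is at most the power set of a copy of \<open>X\<close> inside
  \<open>Field \<Omega>\<close>. It lives on another type, so it is transported to a subset
  \<open>B\<close> of \<open>Field \<Omega>\<close>.\<close>

lemma regular_cardinal_above_set:
  fixes \<Omega> :: "'u rel" and X :: "'b set"
  assumes "inaccessible \<Omega>" "small \<Omega> X" "infinite X"
  obtains \<nu> where "regular_cardinal \<Omega> \<nu>" "|X| <o \<nu>"
proof -
  have co: "Card_order \<Omega>" using assms(1) by (simp add: inaccessible_def)
  have XO: "|X| <o \<Omega>" using assms(2) by (simp add: small_def)
  have "|X| \<le>o \<Omega>" using XO ordLess_imp_ordLeq by blast
  then obtain A where A: "A \<subseteq> Field \<Omega>" "|X| =o |A|"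
    using internalize_card_of_ordLeq by blast
  have "|A| <o \<Omega>" using A(2) XO ordIso_ordLess_trans ordIso_symmetric by blast
  then have PO: "|Pow A| <o \<Omega>" using assms(1) A(1) by (simp add: inaccessible_def)
  let ?s = "cardSuc |X|"
  have CX: "Cinfinite |X|"
    using assms(3) by (simp add: cinfinite_def Field_card_of card_of_card_order_on)
  have "|X| <o |Pow A|" using A(2) card_of_Pow ordIso_ordLess_trans by blast
  then have "?s \<le>o |Pow A|" by (simp add: cardSuc_least card_of_Card_order)
  then have sO: "?s <o \<Omega>" using PO ordLeq_ordLess_trans by blast
  have sc: "Card_order ?s" by (simp add: cardSuc_Card_order card_of_Card_order)
  have iso: "|Field ?s| =o ?s" using sc card_of_Field_ordIso by blast
  have "|Field ?s| \<le>o \<Omega>" using iso sO ordIso_ordLess_trans ordLess_imp_ordLeq by blast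
  from internalize_card_of_ordLeq[THEN iffD1, OF this]
  obtain B where B: "B \<subseteq> Field \<Omega>" "|Field ?s| =o |B|" by (elim exE conjE) auto
  have sB: "?s =o |B|" using iso B(2) ordIso_symmetric ordIso_transitive by blast
  have Cs: "Cinfinite ?s" using CX by (rule Cinfinite_cardSuc)
  have "regularCard |B|"
    using regularCard_ordIso[OF sB Cs] regularCard_cardSuc[OF CX] by blast
  moreover have "Cinfinite |B|" using Cinfinite_cong[OF sB Cs] .
  moreover have "|B| <o \<Omega>" using sB sO ordIso_ordLess_trans ordIso_symmetric by blast
  ultimately have "regular_cardinal \<Omega> |B|" by (simp add: regular_cardinal_def)
  moreover have "|X| <o |B|"
    using cardSuc_greater[OF card_of_Card_order, of X] sB ordLess_ordIso_trans by blast
  ultimately show thesis by (rule that)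
qed

text \<open>The last conclusion lets a strict upper bound on both cardinals pass to their
  maximum.\<close>

lemma regular_cardinal_max:
  assumes "regular_cardinal \<Omega> \<kappa>" "regular_cardinal \<Omega> \<mu>"
  obtains \<nu> where "regular_cardinal \<Omega> \<nu>" "\<kappa> \<le>o \<nu>" "\<mu> \<le>o \<nu>" "\<nu> = \<kappa> \<or> \<nu> = \<mu>"
proof -
  have "\<kappa> \<le>o \<mu> \<or> \<mu> \<le>o \<kappa>"
    using assms by (meson ordLeq_total regular_cardinalD(2))
  then show thesis
    using that assms ordLeq_reflexive regular_cardinalD(2) by metis
qed

lemma regular_cardinal_above:
  assumes "inaccessible \<Omega>" "regular_cardinal \<Omega> \<kappa>" "regular_cardinal \<Omega> \<mu>"
  obtains \<nu> where "regular_cardinal \<Omega> \<nu>" "\<kappa> <o \<nu>" "\<mu> <o \<nu>"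
proof -
  obtain \<rho> where \<rho>: "regular_cardinal \<Omega> \<rho>" "\<kappa> \<le>o \<rho>" "\<mu> \<le>o \<rho>"
    using regular_cardinal_max[OF assms(2,3)] by blast
  obtain \<nu> where \<nu>: "regular_cardinal \<Omega> \<nu>" "|Field \<rho>| <o \<nu>"
    using regular_cardinal_above_set[OF assms(1) regular_cardinal_small[OF \<rho>(1)]]
      regular_cardinalD(3)[OF \<rho>(1)] by blast
  have "\<rho> <o \<nu>"
    using \<nu>(2) card_of_Field_ordIso[OF regular_cardinalD(1)[OF \<rho>(1)]]
      ordIso_ordLess_trans ordIso_symmetric by blast
  then show thesis using that \<nu>(1) \<rho>(2,3) ordLeq_ordLess_trans by blast
qed

text \<open>A finite \<open>X\<close> has no infinite successor cardinal; the successor is therefore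
  taken only if \<open>\<kappa> \<le>o |X|\<close>, which forces \<open>X\<close> to be infinite,
  and otherwise \<kappa> itself is large enough.\<close>

lemma regular_cardinal_above_small:
  assumes "inaccessible \<Omega>" "regular_cardinal \<Omega> \<kappa>" "small \<Omega> X"
  obtains \<nu> where "regular_cardinal \<Omega> \<nu>" "\<kappa> \<le>o \<nu>" "|X| <o \<nu>"
proof (cases "\<kappa> \<le>o |X|")
  case True
  then have "|Field \<kappa>| \<le>o |X|"
    using card_of_mono2[OF True] by (simp add: Field_card_of)
  then have "infinite X"
    using card_of_ordLeq_infinite regular_cardinalD(3)[OF assms(2)] by blast
  then obtain \<nu> where "regular_cardinal \<Omega> \<nu>" "|X| <o \<nu>"
    using regular_cardinal_above_set[OF assms(1,3)] by blast
  then show thesis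
    using that True ordLeq_ordLess_trans ordLess_imp_ordLeq by blast
next
  case False
  then have "|X| <o \<kappa>"
    using not_ordLeq_iff_ordLess regular_cardinalD(2)[OF assms(2)] card_of_Well_order by blast
  then show thesis
    using that assms(2) ordLeq_reflexive regular_cardinalD(2) by blast
qed

lemma small_subset: "small \<Omega> B \<Longrightarrow> A \<subseteq> B \<Longrightarrow> small \<Omega> A"
  unfolding small_def using card_of_mono1 ordLeq_ordLess_trans by blast

lemma ex_subset_of_card:
  fixes \<kappa> :: "'k rel" and A :: "'b set"
  assumes "Card_order \<kappa>" "\<kappa> \<le>o |A|"
  obtains B where "B \<subseteq> A" "|B| =o \<kappa>"
proof -
  have "|Field \<kappa>| \<le>o |A|"
    using ordIso_ordLeq_trans[OF card_of_Field_ordIso[OF assms(1)] assms(2)] .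
  from internalize_card_of_ordLeq2[THEN iffD1, OF this]
  obtain B where B: "B \<subseteq> A" "|Field \<kappa>| =o |B|" by blast
  have "|B| =o \<kappa>"
    using ordIso_transitive[OF ordIso_symmetric[OF B(2)] card_of_Field_ordIso[OF assms(1)]] .
  then show thesis using that B(1) by blast
qed

lemma ex_subset_of_cardinal:
  assumes "regular_cardinal \<Omega> \<kappa>" "regular_cardinal \<Omega> \<nu>" "\<kappa> <o \<nu>"
  obtains I where "I \<subseteq> Field \<nu>" "|I| =o \<kappa>"
proof -
  have "\<kappa> \<le>o |Field \<nu>|"
    using ordLeq_ordIso_trans[OF ordLess_imp_ordLeq[OF assms(3)]
        ordIso_symmetric[OF card_of_Field_ordIso[OF regular_cardinalD(1)[OF assms(2)]]]] .
  then show thesis by (rule ex_subset_of_card[OF regular_cardinalD(1)[OF assms(1)]]) (rule that)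
qed

section \<open>Well-orders\<close>

lemma Field_Restr_subset:
  assumes "Refl r" "A \<subseteq> Field r"
  shows "Field (Restr r A) = A"
  using assms by (auto simp: Field_def refl_on_def)

lemma directed_antimono:
  assumes "directed \<nu> P" "\<kappa> \<le>o \<nu>"
  shows "directed \<kappa> P"
  using assms unfolding directed_def by (meson ordLess_ordLeq_trans)

lemma underS_subset_Field: "underS r a \<subseteq> Field r"
  by (auto simp: underS_def Field_def)

lemma Well_orderD:
  assumes "Well_order r"
  shows "Refl r" "trans r" "antisym r" "Total r" "wf (r - Relation.Id)" "Partial_order r"
  using assms by (auto simp: well_order_on_def linear_order_on_def partial_order_on_def
      preorder_on_def)

lemma wo_cases:
  assumes "Well_order r" "i \<in> Field r" "j \<in> Field r"
  shows "(i, j) \<in> r \<or> j \<in> underS r i"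
  using wo_rel.TOTALS[of r] assms by (auto simp: wo_rel_def underS_def)

lemma wo_least_exists:
  assumes "Well_order r" "A \<subseteq> Field r" "A \<noteq> {}"
  obtains a where "a \<in> A" "\<And>b. b \<in> A \<Longrightarrow> (a, b) \<in> r"
proof -
  have "wo_rel r" using assms(1) by (simp add: wo_rel_def)
  from wo_rel.Well_order_isMinim_exists[OF this assms(2,3)]
  obtain a where "a \<in> A \<and> (\<forall>b\<in>A. (a, b) \<in> r)"
    unfolding wo_rel.isMinim_def[OF \<open>wo_rel r\<close>] by blast
  then show thesis using that by blast
qed

lemma wo_trans: "Well_order r \<Longrightarrow> (a, b) \<in> r \<Longrightarrow> (b, c) \<in> r \<Longrightarrow> (a, c) \<in> r"
  using Well_orderD(2) by (blast dest: transD)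

lemma wo_antisym: "Well_order r \<Longrightarrow> (a, b) \<in> r \<Longrightarrow> (b, a) \<in> r \<Longrightarrow> a = b"
  using Well_orderD(3) by (blast dest: antisymD)

lemma wo_refl: "Well_order r \<Longrightarrow> a \<in> Field r \<Longrightarrow> (a, a) \<in> r"
  using Well_orderD(1) by (blast dest: refl_onD)

lemma underS_trans: "Well_order r \<Longrightarrow> (a, b) \<in> r \<Longrightarrow> b \<in> underS r c \<Longrightarrow> a \<in> underS r c"
  using wo_trans wo_antisym by (fastforce simp: underS_def)

lemma is_least_underS:
  assumes "Well_order r" "is_least r z"
  shows "underS r z = {}"
proof -
  have False if "x \<noteq> z" "(x, z) \<in> r" for x
    using assms that wo_antisym[OF assms(1), of x z] FieldI1[OF that(2)] by (simp add: is_least_def)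
  then show ?thesis by (auto simp: underS_def)
qed

text \<open>The least point \<open>\<delta>\<close> below which \<open>I\<close> has \<open>\<kappa>\<close> elements has cofinality \<open>\<kappa>\<close>, and \<open>I\<close> is cofinal
  in it.\<close>

lemma ex_directed_initial_segment:
  assumes \<kappa>: "regular_cardinal \<Omega> \<kappa>" and \<nu>: "regular_cardinal \<Omega> \<nu>" and less: "\<kappa> <o \<nu>"
    and I: "I \<subseteq> Field \<nu>" "|I| =o \<kappa>"
  obtains \<delta> where "is_limit \<nu> \<delta>" "directed \<kappa> (Restr \<nu> (underS \<nu> \<delta>))"
    "\<forall>j \<in> underS \<nu> \<delta>. \<kappa> \<le>o |{i \<in> I \<inter> underS \<nu> \<delta>. (j, i) \<in> \<nu>}|"
proof -
  note wo = regular_cardinalD(2)[OF \<nu>] and wok = regular_cardinalD(2)[OF \<kappa>]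
  have inf: "infinite (Field \<kappa>)" using regular_cardinalD(3)[OF \<kappa>] .
  have Un_small: "|A \<union> B| <o \<kappa>" if "|A| <o \<kappa>" "|B| <o \<kappa>" for A B :: "'a set"
    using card_of_Un_ordLess_infinite_Field[OF inf regular_cardinalD(1)[OF \<kappa>] that] .
  \<comment> \<open>A set of size \<kappa> below the regular cardinal \<nu> is not cofinal in it, so
    a single point \<open>d\<close> lies above all of \<open>I\<close>.\<close>
  have "\<exists>d. d \<in> Field \<nu> \<and> \<kappa> \<le>o |I \<inter> underS \<nu> d|"
  proof -
    have "\<not> |I| =o \<nu>"
      using I(2) less not_ordLess_ordIso ordIso_symmetric ordIso_transitive by blast
    then have "\<not> cofinal I \<nu>"
      using regular_cardinalD(4)[OF \<nu>] I(1) by (auto simp: regularCard_def)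
    then obtain a where a: "a \<in> Field \<nu>" "\<forall>b\<in>I. \<not> (a \<noteq> b \<and> (a, b) \<in> \<nu>)"
      by (auto simp: cofinal_def)
    obtain d where d: "d \<in> Field \<nu>" "a \<noteq> d" "(a, d) \<in> \<nu>"
      using infinite_Card_order_limit[OF regular_cardinalD(1,3)[OF \<nu>] a(1)] by blast
    have "I \<subseteq> underS \<nu> d"
    proof
      fix b assume b: "b \<in> I"
      then have "(b, a) \<in> \<nu>"
      proof (cases "a = b")
        case True
        then show ?thesis using wo_refl[OF wo a(1)] by simp
      next
        case False
        then have "(a, b) \<notin> \<nu>" using a(2) b by blast
        then show ?thesis using wo_cases[OF wo a(1), of b] b I(1) by (auto simp: underS_def)
      qed
      then show "b \<in> underS \<nu> d"
        using d by (intro underS_trans[OF wo, of b a d]) (auto simp: underS_def)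
    qed
    then have "I \<inter> underS \<nu> d = I" by blast
    then show ?thesis using d I(2) ordIso_symmetric ordIso_iff_ordLeq by metis
  qed
  then have ne: "{d \<in> Field \<nu>. \<kappa> \<le>o |I \<inter> underS \<nu> d|} \<noteq> {}" by blast
  obtain \<delta> where \<delta>': "\<delta> \<in> {d \<in> Field \<nu>. \<kappa> \<le>o |I \<inter> underS \<nu> d|}"
    and min': "\<And>d. d \<in> {d \<in> Field \<nu>. \<kappa> \<le>o |I \<inter> underS \<nu> d|} \<Longrightarrow> (\<delta>, d) \<in> \<nu>"
    by (rule wo_least_exists[OF wo _ ne]) auto
  have \<delta>: "\<delta> \<in> Field \<nu>" "\<kappa> \<le>o |I \<inter> underS \<nu> \<delta>|"
    and min: "\<And>d. d \<in> Field \<nu> \<Longrightarrow> \<kappa> \<le>o |I \<inter> underS \<nu> d| \<Longrightarrow> (\<delta>, d) \<in> \<nu>"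
    using \<delta>' min' by auto
  \<comment> \<open>By minimality of \<delta>, fewer than \<kappa> elements of \<open>I\<close> lie
    strictly below an earlier \<open>j\<close>, and \<open>j\<close> itself adds at most
    one.\<close>
  have below: "|I \<inter> under \<nu> j| <o \<kappa>" if j: "j \<in> underS \<nu> \<delta>" for j
  proof -
    have "\<not> \<kappa> \<le>o |I \<inter> underS \<nu> j|"
      using min[of j] j wo_antisym[OF wo] by (auto simp: underS_def Field_def)
    then have "|I \<inter> underS \<nu> j| <o \<kappa>"
      using wok card_of_Well_order not_ordLeq_iff_ordLess by blast
    then have "|{j} \<union> (I \<inter> underS \<nu> j)| <o \<kappa>" using finite_less_regular[OF \<kappa>, of "{j}"] Un_small by blast
    moreover have "|I \<inter> under \<nu> j| \<le>o |{j} \<union> (I \<inter> underS \<nu> j)|"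
      by (rule card_of_mono1) (auto simp: under_def underS_def)
    ultimately show ?thesis using ordLeq_ordLess_trans by blast
  qed
  have tail: "\<kappa> \<le>o |{i \<in> I \<inter> underS \<nu> \<delta>. (j, i) \<in> \<nu>}|" if j: "j \<in> underS \<nu> \<delta>" for j
  proof (rule ccontr)
    assume "\<not> ?thesis"
    then have *: "|{i \<in> I \<inter> underS \<nu> \<delta>. (j, i) \<in> \<nu>}| <o \<kappa>"
      using wok card_of_Well_order not_ordLeq_iff_ordLess by blast
    have "j \<in> Field \<nu>" using j by (auto simp: underS_def Field_def)
    then have "I \<inter> underS \<nu> \<delta> \<subseteq> (I \<inter> under \<nu> j) \<union> {i \<in> I \<inter> underS \<nu> \<delta>. (j, i) \<in> \<nu>}"
      using wo_cases[OF wo, of j] I(1) by (auto simp: under_def underS_def)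
    then have "|I \<inter> underS \<nu> \<delta>| <o \<kappa>"
      using Un_small[OF below[OF j] *] card_of_mono1 ordLeq_ordLess_trans by blast
    then show False using \<delta>(2) not_ordLess_ordLeq by blast
  qed
  have "directed \<kappa> (Restr \<nu> (underS \<nu> \<delta>))"
    unfolding directed_def
  proof (intro conjI allI impI)
    have F: "Field (Restr \<nu> (underS \<nu> \<delta>)) = underS \<nu> \<delta>"
      using Field_Restr_subset[OF Well_orderD(1)[OF wo] underS_subset_Field] .
    show "Partial_order (Restr \<nu> (underS \<nu> \<delta>))"
      using Well_order_Restr[OF wo] Well_orderD(6) by blast
    fix S assume S: "S \<subseteq> Field (Restr \<nu> (underS \<nu> \<delta>))" "|S| <o \<kappa>"
    then have SS: "S \<subseteq> underS \<nu> \<delta>" using F by simp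
    \<comment> \<open>Upper bounds come from counting: fewer than \<kappa> sets of size below
      \<kappa> do not exhaust the part of \<open>I\<close> below \<delta>, and an element of
      \<open>I\<close> outside all of them lies above every \<open>s\<close>.\<close>
    have *: "|\<Union>s\<in>S. I \<inter> under \<nu> s| <o \<kappa>"
      by (rule stable_UNION[OF regular_cardinalD(6)[OF \<kappa>] S(2)]) (use below SS in auto)
    have "\<not> I \<inter> underS \<nu> \<delta> \<subseteq> (\<Union>s\<in>S. I \<inter> under \<nu> s)"
    proof
      assume "I \<inter> underS \<nu> \<delta> \<subseteq> (\<Union>s\<in>S. I \<inter> under \<nu> s)"
      then have "\<kappa> \<le>o |\<Union>s\<in>S. I \<inter> under \<nu> s|"
        using ordLeq_transitive[OF \<delta>(2) card_of_mono1] by blast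
      then show False using * not_ordLess_ordLeq by blast
    qed
    then obtain x where x: "x \<in> I" "x \<in> underS \<nu> \<delta>" "\<forall>s\<in>S. x \<notin> under \<nu> s" by blast
    have "(s, x) \<in> \<nu>" if "s \<in> S" for s
      using wo_cases[OF wo, of s x] that SS x underS_subset_Field[of \<nu> \<delta>] wo_refl[OF wo]
      by (auto simp: under_def underS_def)
    then show "\<exists>u\<in>Field (Restr \<nu> (underS \<nu> \<delta>)). \<forall>i\<in>S. (i, u) \<in> Restr \<nu> (underS \<nu> \<delta>)"
      using x SS F by auto
  qed
  moreover have "is_limit \<nu> \<delta>" unfolding is_limit_def
  proof (intro conjI notI)
    show "\<delta> \<in> Field \<nu>" by (fact \<delta>(1))
    assume "is_least \<nu> \<delta>"
    then have "underS \<nu> \<delta> = {}"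
      by (rule is_least_underS[OF wo])
    then have "|I \<inter> underS \<nu> \<delta>| <o \<kappa>" using finite_less_regular[OF \<kappa>, of "I \<inter> underS \<nu> \<delta>"] by simp
    then show False using \<delta>(2) not_ordLess_ordLeq by blast
  next
    assume "\<exists>i. is_succ \<nu> i \<delta>"
    then obtain i where i: "is_succ \<nu> i \<delta>" by blast
    then have i\<delta>: "i \<in> underS \<nu> \<delta>" by (simp add: is_succ_def)
    \<comment> \<open>A predecessor \<open>i\<close> of \<delta> would leave at most
      \<open>i\<close> in the tail from \<open>i\<close>, while every tail has at least \<kappa>
      elements.\<close>
    have "{i' \<in> I \<inter> underS \<nu> \<delta>. (i, i') \<in> \<nu>} \<subseteq> {i}"
    proof
      fix x assume x: "x \<in> {i' \<in> I \<inter> underS \<nu> \<delta>. (i, i') \<in> \<nu>}"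
      show "x \<in> {i}"
      proof (rule ccontr)
        assume "x \<notin> {i}"
        then have "(\<delta>, x) \<in> \<nu>" using i x by (auto simp: is_succ_def underS_def)
        then show False using x wo_antisym[OF wo] by (auto simp: underS_def)
      qed
    qed
    then have "finite {i' \<in> I \<inter> underS \<nu> \<delta>. (i, i') \<in> \<nu>}" by (rule finite_subset) simp
    then have "|{i' \<in> I \<inter> underS \<nu> \<delta>. (i, i') \<in> \<nu>}| <o \<kappa>" by (rule finite_less_regular[OF \<kappa>])
    then show False using tail[OF i\<delta>] not_ordLess_ordLeq by blast
  qed
  ultimately show thesis using that tail by blast
qed

section \<open>Successors, limits and strict initial segments\<close>

lemma is_succD:
  assumes "is_succ r i k"
  shows "i \<in> underS r k" "(i, k) \<in> r" "i \<noteq> k" "i \<in> Field r" "k \<in> Field r"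
    "\<And>j. i \<in> underS r j \<Longrightarrow> (k, j) \<in> r"
  using assms by (auto simp: is_succ_def underS_def Field_def)

lemma is_succ_underS:
  assumes "Well_order r" "is_succ r i k"
  shows "j \<in> underS r k \<longleftrightarrow> (j, i) \<in> r"
proof
  assume j: "j \<in> underS r k"
  then have "j \<in> Field r" using underS_subset_Field by fast
  moreover have "i \<notin> underS r j"
    using is_succD(6)[OF assms(2)] j wo_antisym[OF assms(1)] by (auto simp: underS_def)
  ultimately show "(j, i) \<in> r"
    using wo_cases[OF assms(1)] is_succD(4)[OF assms(2)] by blast
next
  assume "(j, i) \<in> r"
  then show "j \<in> underS r k" using underS_trans[OF assms(1)] is_succD(1)[OF assms(2)] by blast
qed

lemma wo_zero_succ_limit:
  assumes "x \<in> Field r"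
  obtains "is_least r x" | i where "is_succ r i x" | "is_limit r x"
  using assms by (auto simp: is_limit_def)

lemma Field_Restr_underS: "Well_order r \<Longrightarrow> Field (Restr r (underS r l)) = underS r l"
  by (rule Field_Restr_subset[OF Well_orderD(1) underS_subset_Field])

lemma ex_is_succ:
  assumes wo: "Well_order r" and i: "i \<in> underS r l"
  obtains k where "is_succ r i k" "(k, l) \<in> r"
proof -
  have sub: "{k. i \<in> underS r k} \<subseteq> Field r" by (auto simp: underS_def Field_def)
  have "{k. i \<in> underS r k} \<noteq> {}" using i by blast
  from wo_least_exists[OF wo sub this] obtain k where
    "k \<in> {k. i \<in> underS r k}" "\<And>b. b \<in> {k. i \<in> underS r k} \<Longrightarrow> (k, b) \<in> r" by blast
  then show thesis using that i by (auto simp: is_succ_def)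
qed

lemma is_least_limit_underS:
  assumes "Well_order r" "is_least r z" "is_limit r l"
  shows "z \<in> underS r l"
  using assms by (auto simp: is_least_def is_limit_def underS_def)

section \<open>Chains by transfinite recursion\<close>

text \<open>\<open>St i\<close> are the stages admissible at \<open>i\<close> and \<open>Mor i j\<close> the arrows between them, as in a diagram.\<close>

definition chain_system where
  "chain_system r St Mor ide cmp X T \<longleftrightarrow>
     (\<forall>i \<in> Field r. St i (X i) \<and> T i i = ide (X i)) \<and>
     (\<forall>i j. (i, j) \<in> r \<longrightarrow> Mor i j (X i) (X j) (T i j)) \<and>
     (\<forall>i j k. (i, j) \<in> r \<longrightarrow> (j, k) \<in> r \<longrightarrow> cmp (T j k) (T i j) = T i k)"

text \<open>A stage is recorded together with its incoming arrows: the recursion value at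
  \<open>x\<close> is a stage and a cocone on the chain below \<open>x\<close>. \<open>R\<close> and
  \<open>L\<close> are side conditions on successor and limit steps; \<open>L_cong\<close> says that
  \<open>L l\<close> reads only the part of the chain below \<open>l\<close>, which is all that
  exists when the stage at \<open>l\<close> is chosen. The composition laws are assumed under
  \<open>Mor\<close> alone, so an instance must build the typing facts it needs into
  \<open>Mor\<close>.\<close>

lemma transfinite_chain:
  fixes r :: "'i rel" and St :: "'i \<Rightarrow> 's \<Rightarrow> bool" and Mor :: "'i \<Rightarrow> 'i \<Rightarrow> 's \<Rightarrow> 's \<Rightarrow> 'm \<Rightarrow> bool"
  assumes wo: "Well_order r"
    and ide: "\<And>i s. i \<in> Field r \<Longrightarrow> St i s \<Longrightarrow> Mor i i s s (ide s)"
    and cmp: "\<And>i j k s t u f g. (i, j) \<in> r \<Longrightarrow> (j, k) \<in> r \<Longrightarrow> Mor i j s t f \<Longrightarrow> Mor j k t u g \<Longrightarrow>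
      Mor i k s u (cmp g f)"
    and assoc: "\<And>i j k l s t u v f g h. Mor i j s t f \<Longrightarrow> Mor j k t u g \<Longrightarrow> Mor k l u v h \<Longrightarrow>
      cmp (cmp h g) f = cmp h (cmp g f)"
    and ide_left: "\<And>i j s t f. Mor i j s t f \<Longrightarrow> cmp (ide t) f = f"
    and ide_right: "\<And>i j s t f. Mor i j s t f \<Longrightarrow> cmp f (ide s) = f"
    and L_cong: "\<And>l X T X' T' s \<kappa> \<kappa>'. L l X T s \<kappa> \<Longrightarrow> (\<And>i. i \<in> underS r l \<Longrightarrow> X i = X' i) \<Longrightarrow>
      (\<And>i j. (i, j) \<in> r \<Longrightarrow> j \<in> underS r l \<Longrightarrow> T i j = T' i j) \<Longrightarrow>
      (\<And>i. i \<in> underS r l \<Longrightarrow> \<kappa> i = \<kappa>' i) \<Longrightarrow> L l X' T' s \<kappa>'"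
    and least: "\<And>z. is_least r z \<Longrightarrow> \<exists>s. St z s"
    and succ: "\<And>i k s. is_succ r i k \<Longrightarrow> St i s \<Longrightarrow> \<exists>t f. St k t \<and> Mor i k s t f \<and> R i k s t f"
    and limit: "\<And>l X T. is_limit r l \<Longrightarrow>
      chain_system (Restr r (underS r l)) St Mor ide cmp X T \<Longrightarrow>
      \<exists>s \<kappa>. St l s \<and> (\<forall>i\<in>underS r l. Mor i l (X i) s (\<kappa> i)) \<and>
        (\<forall>i j. (i, j) \<in> r \<longrightarrow> j \<in> underS r l \<longrightarrow> cmp (\<kappa> j) (T i j) = \<kappa> i) \<and> L l X T s \<kappa>"
  obtains X T where "chain_system r St Mor ide cmp X T"
    "\<forall>i k. is_succ r i k \<longrightarrow> R i k (X i) (X k) (T i k)"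
    "\<forall>l. is_limit r l \<longrightarrow> L l X T (X l) (\<lambda>i. T i l)"
proof -
  define X :: "('i \<Rightarrow> 's \<times> ('i \<Rightarrow> 'm)) \<Rightarrow> 'i \<Rightarrow> 's" where "X f i = fst (f i)" for f i
  \<comment> \<open>Only arrows from strictly earlier points are stored, so the diagonal is filled
    with the identity.\<close>
  define T where "T f i j = (if i = j then ide (X f j) else snd (f j) i)"
    for f :: "'i \<Rightarrow> 's \<times> ('i \<Rightarrow> 'm)" and i j
  define Q where "Q f x s \<kappa> \<longleftrightarrow>
       St x s \<and> (\<forall>i\<in>underS r x. Mor i x (X f i) s (\<kappa> i)) \<and>
       (\<forall>i j. (i, j) \<in> r \<longrightarrow> j \<in> underS r x \<longrightarrow> cmp (\<kappa> j) (T f i j) = \<kappa> i) \<and>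
       (\<forall>i. is_succ r i x \<longrightarrow> R i x (X f i) s (\<kappa> i)) \<and>
       (is_limit r x \<longrightarrow> L x (X f) (T f) s \<kappa>)" for f x s \<kappa>
  \<comment> \<open>The recursion runs over the whole type, so outside \<open>Field r\<close> every
    value is accepted.\<close>
  define P where "P f x p \<longleftrightarrow> (x \<in> Field r \<longrightarrow> Q f x (fst p) (snd p))"
    for f :: "'i \<Rightarrow> 's \<times> ('i \<Rightarrow> 'm)" and x and p :: "'s \<times> ('i \<Rightarrow> 'm)"
  have Qcong: "Q g x s \<kappa>" if "Q f x s \<kappa>" and eq: "\<And>z. z \<in> underS r x \<Longrightarrow> f z = g z" for f g x s \<kappa>
  proof -
    have X: "X f i = X g i" if "i \<in> underS r x" for i using eq that by (simp add: X_def)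
    have T: "T f i j = T g i j" if "j \<in> underS r x" for i j
      using eq that by (simp add: X_def T_def)
    have "L x (X g) (T g) s \<kappa>" if "is_limit r x"
      by (rule L_cong[where X="X f" and T="T f" and \<kappa>=\<kappa>]) (use \<open>Q f x s \<kappa>\<close> that X T Q_def in auto)
    then show ?thesis
      using \<open>Q f x s \<kappa>\<close> X T is_succD(1)[of r _ x] unfolding Q_def by simp
  qed
  have Pcong: "P f x p = P g x p" if eq: "\<And>z. (z, x) \<in> r - Relation.Id \<Longrightarrow> f z = g z" for f g x p
  proof -
    have "f z = g z" if "z \<in> underS r x" for z using eq that by (auto simp: underS_def)
    then show ?thesis using Qcong[of f x "fst p" "snd p" g] Qcong[of g x "fst p" "snd p" f]
      unfolding P_def by metis
  qed
  \<comment> \<open>Applied twice: to the points below \<open>x\<close>, giving the hypothesis of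
    the recursion step, and to all of \<open>Field r\<close>, giving the result.\<close>
  have sys: "chain_system (Restr r A) St Mor ide cmp (X f) (T f)"
    if A: "A \<subseteq> Field r" and P: "\<And>y. y \<in> A \<Longrightarrow> P f y (f y)" for A f
  proof -
    have Q: "Q f y (X f y) (snd (f y))" if "y \<in> A" for y
      using P[OF that] A that by (auto simp: P_def X_def)
    have F: "Field (Restr r A) = A"
      using Field_Restr_subset[OF Well_orderD(1)[OF wo] A] .
    have St: "St i (X f i)" if "i \<in> A" for i using Q[OF that] by (simp add: Q_def)
    have M: "Mor i j (X f i) (X f j) (T f i j)" if "i \<in> A" "j \<in> A" "(i, j) \<in> r" for i j
      using Q[OF that(2)] that ide St A unfolding Q_def
      by (cases "i = j") (auto simp: T_def underS_def)
    have C: "cmp (T f j k) (T f i j) = T f i k"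
      if "i \<in> A" "j \<in> A" "k \<in> A" "(i, j) \<in> r" "(j, k) \<in> r" for i j k
    proof (cases "j = k")
      case True
      then show ?thesis using ide_left[OF M[of i j]] that by (simp add: T_def)
    next
      case False
      then have "j \<in> underS r k" using that by (simp add: underS_def)
      moreover from this have "i \<noteq> k" using that wo_antisym[OF wo] by (auto simp: underS_def)
      ultimately show ?thesis
        using Q[OF that(3)] that False unfolding Q_def by (auto simp: T_def)
    qed
    show ?thesis unfolding chain_system_def F
      using St M C by (auto simp: T_def)
  qed
  have "\<exists>f. \<forall>x. P f x (f x)"
  proof (rule dependent_wf_choice[OF Well_orderD(5)[OF wo]])
    show "P f x p = P g x p" if "\<And>z. (z, x) \<in> r - Relation.Id \<Longrightarrow> f z = g z" for f g x p
      using Pcong that .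
    fix x f assume IH: "\<And>y. (y, x) \<in> r - Relation.Id \<Longrightarrow> P f y (f y)"
    show "\<exists>p. P f x p"
    proof (cases "x \<in> Field r")
      case False
      then show ?thesis by (simp add: P_def)
    next
      case x: True
      have below: "chain_system (Restr r (underS r x)) St Mor ide cmp (X f) (T f)"
        by (rule sys) (use IH in \<open>auto simp: underS_def Field_def\<close>)
      have "\<exists>s \<kappa>. Q f x s \<kappa>"
        using x
      proof (cases rule: wo_zero_succ_limit)
        case 1
        then have "underS r x = {}"
          using wo_antisym[OF wo] by (auto simp: is_least_def underS_def Field_def)
        then show ?thesis
          using least[OF 1] 1 is_succD(1)[of r _ x] by (auto simp: Q_def is_limit_def)
      next
        case (2 i)
        note F = Field_Restr_underS[OF wo, of x]
        note iu = is_succ_underS[OF wo 2]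
        have ii: "i \<in> underS r x" by (rule is_succD(1)[OF 2])
        have "St i (X f i)" using below ii F unfolding chain_system_def by blast
        then obtain t \<phi> where t: "St x t" "Mor i x (X f i) t \<phi>" "R i x (X f i) t \<phi>"
          using succ[OF 2] by blast
        \<comment> \<open>Everything below the successor \<open>x\<close> of \<open>i\<close> is at
          most \<open>i\<close>, so the cocone is determined by its arrow \<phi> at
          \<open>i\<close>.\<close>
        define \<kappa> where "\<kappa> j = cmp \<phi> (T f j i)" for j
        have M: "Mor j k (X f j) (X f k) (T f j k)" if "(j, k) \<in> r" "k \<in> underS r x" for j k
          using below that underS_trans[OF wo that] unfolding chain_system_def by blast
        have "\<kappa> i = \<phi>" using ide_right[OF t(2)] by (simp add: \<kappa>_def T_def)
        moreover have "Mor j x (X f j) t (\<kappa> j)" if "j \<in> underS r x" for j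
          unfolding \<kappa>_def using cmp[OF _ is_succD(2)[OF 2] M t(2)] that iu ii by blast
        moreover have "cmp (\<kappa> k) (T f j k) = \<kappa> j" if "(j, k) \<in> r" "k \<in> underS r x" for j k
        proof -
          have ki: "(k, i) \<in> r" using that iu by blast
          have "cmp (T f k i) (T f j k) = T f j i"
            using below ki that ii underS_trans[OF wo that] unfolding chain_system_def by blast
          then show ?thesis
            unfolding \<kappa>_def using assoc[OF M[OF that] M[OF ki ii] t(2)] by simp
        qed
        moreover have "j = i" if "is_succ r j x" for j
          using is_succ_underS[OF wo that] iu ii is_succD(1)[OF that] wo_antisym[OF wo] by blast
        moreover have "\<not> is_limit r x" using 2 by (auto simp: is_limit_def)
        ultimately show ?thesis using t unfolding Q_def by blast
      next
        case 3
        then obtain s \<kappa> where "St x s \<and> (\<forall>i\<in>underS r x. Mor i x (X f i) s (\<kappa> i)) \<and>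
          (\<forall>i j. (i, j) \<in> r \<longrightarrow> j \<in> underS r x \<longrightarrow> cmp (\<kappa> j) (T f i j) = \<kappa> i) \<and>
          L x (X f) (T f) s \<kappa>"
          using limit[OF 3 below] by blast
        moreover have "\<not> is_succ r i x" for i using 3 by (auto simp: is_limit_def)
        ultimately show ?thesis unfolding Q_def by blast
      qed
      then show ?thesis by (auto simp: P_def)
    qed
  qed
  then obtain f where f: "\<And>x. P f x (f x)" by blast
  have "chain_system (Restr r (Field r)) St Mor ide cmp (X f) (T f)"
    by (rule sys) (use f in auto)
  moreover have "Restr r (Field r) = r" by (auto simp: Field_def)
  ultimately have "chain_system r St Mor ide cmp (X f) (T f)" by simp
  moreover have "R i k (X f i) (X f k) (T f i k)" if "is_succ r i k" for i k
    using f[of k] that is_succD[OF that] unfolding P_def Q_def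
    by (simp add: T_def X_def)
  moreover have "L l (X f) (T f) (X f l) (\<lambda>i. T f i l)" if l: "is_limit r l" for l
  proof -
    have "L l (X f) (T f) (X f l) (snd (f l))"
      using f[of l] l unfolding P_def Q_def X_def is_limit_def by blast
    then show ?thesis by (rule L_cong) (auto simp: T_def underS_def)
  qed
  ultimately show thesis using that by simp
qed

section \<open>Colimits\<close>

lemma Hom_iff: "f \<in> Hom K X Y \<longleftrightarrow> f \<in> Arr K \<and> Dom\<^bsub>K\<^esub> f = X \<and> Cod\<^bsub>K\<^esub> f = Y"
  by (simp add: Hom_def)

lemma categoryD:
  assumes "category K"
  shows "f \<in> Arr K \<Longrightarrow> Dom\<^bsub>K\<^esub> f \<in> Obj K" "f \<in> Arr K \<Longrightarrow> Cod\<^bsub>K\<^esub> f \<in> Obj K"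
    "X \<in> Obj K \<Longrightarrow> Id K X \<in> Hom K X X"
    "f \<in> Hom K X Y \<Longrightarrow> g \<in> Hom K Y Z \<Longrightarrow> g \<cdot>\<^bsub>K\<^esub> f \<in> Hom K X Z"
    "f \<in> Hom K X Y \<Longrightarrow> Id K Y \<cdot>\<^bsub>K\<^esub> f = f" "f \<in> Hom K X Y \<Longrightarrow> f \<cdot>\<^bsub>K\<^esub> Id K X = f"
    "f \<in> Hom K W X \<Longrightarrow> g \<in> Hom K X Y \<Longrightarrow> h \<in> Hom K Y Z \<Longrightarrow>
      (h \<cdot>\<^bsub>K\<^esub> g) \<cdot>\<^bsub>K\<^esub> f = h \<cdot>\<^bsub>K\<^esub> (g \<cdot>\<^bsub>K\<^esub> f)"
  using assms unfolding category_def by blast+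

lemma cocone_comp:
  assumes "category K" "diagram K P D T" "cocone K P D T X k" "h \<in> Hom K X Y"
  shows "cocone K P D T Y (\<lambda>i. h \<cdot>\<^bsub>K\<^esub> k i)"
  unfolding cocone_def
proof (intro conjI ballI allI impI)
  show "Y \<in> Obj K" using assms(1,4) categoryD(2) by (auto simp: Hom_iff)
  show "h \<cdot>\<^bsub>K\<^esub> k i \<in> Hom K (D i) Y" if "i \<in> Field P" for i
    using assms that categoryD(4) unfolding cocone_def by metis
  show "(h \<cdot>\<^bsub>K\<^esub> k j) \<cdot>\<^bsub>K\<^esub> T i j = h \<cdot>\<^bsub>K\<^esub> k i" if ij: "(i, j) \<in> P" for i j
  proof -
    have "j \<in> Field P" using ij by (auto simp: Field_def)
    then have "k j \<in> Hom K (D j) X" using assms(3) by (simp add: cocone_def)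
    moreover have "T i j \<in> Hom K (D i) (D j)" using assms(2) ij by (simp add: diagram_def)
    ultimately show ?thesis
      using categoryD(7)[OF assms(1) _ _ assms(4)] assms(3) ij by (simp add: cocone_def)
  qed
qed

lemma colimit_eqI:
  assumes "category K" "diagram K P D T" "colimit K P D T X k"
    and h: "h \<in> Hom K X Y" "h' \<in> Hom K X Y"
    and eq: "\<And>i. i \<in> Field P \<Longrightarrow> h \<cdot>\<^bsub>K\<^esub> k i = h' \<cdot>\<^bsub>K\<^esub> k i"
  shows "h = h'"
proof -
  have "cocone K P D T Y (\<lambda>i. h \<cdot>\<^bsub>K\<^esub> k i)"
    using cocone_comp assms(1-3) h(1) colimit_def by metis
  then have "\<exists>!g. g \<in> Hom K X Y \<and> (\<forall>i \<in> Field P. g \<cdot>\<^bsub>K\<^esub> k i = h \<cdot>\<^bsub>K\<^esub> k i)"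
    using assms(3) unfolding colimit_def by blast
  then show ?thesis using h eq by metis
qed

lemma colimit_factor:
  assumes "colimit K P D T X k" "cocone K P D T Y d"
  obtains h where "h \<in> Hom K X Y" "\<And>i. i \<in> Field P \<Longrightarrow> h \<cdot>\<^bsub>K\<^esub> k i = d i"
  using assms unfolding colimit_def by blast

lemma colimit_cocone: "colimit K P D T X k \<Longrightarrow> cocone K P D T X k"
  by (simp add: colimit_def)

lemma cocone_cong:
  assumes "cocone K P D T X k"
    and "\<And>i. i \<in> Field P \<Longrightarrow> D i = D' i" "\<And>i j. (i, j) \<in> P \<Longrightarrow> T i j = T' i j"
    "\<And>i. i \<in> Field P \<Longrightarrow> k i = k' i"
  shows "cocone K P D' T' X k'"
  unfolding cocone_def
proof (intro conjI ballI allI impI)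
  show "X \<in> Obj K" using assms(1) by (simp add: cocone_def)
  show "k' i \<in> Hom K (D' i) X" if "i \<in> Field P" for i
    using assms(1,2,4) that by (simp add: cocone_def)
  show "k' j \<cdot>\<^bsub>K\<^esub> T' i j = k' i" if "(i, j) \<in> P" for i j
    using assms(1) assms(3)[OF that] assms(4)[OF FieldI1[OF that]] assms(4)[OF FieldI2[OF that]] that
    unfolding cocone_def by metis
qed

lemma colimit_cong:
  assumes "colimit K P D T X k"
    and eq: "\<And>i. i \<in> Field P \<Longrightarrow> D i = D' i" "\<And>i j. (i, j) \<in> P \<Longrightarrow> T i j = T' i j"
    "\<And>i. i \<in> Field P \<Longrightarrow> k i = k' i"
  shows "colimit K P D' T' X k'"
  unfolding colimit_def
proof (intro conjI allI impI)
  show "cocone K P D' T' X k'" using cocone_cong[OF colimit_cocone[OF assms(1)] eq] by blast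
  fix Y d assume "cocone K P D' T' Y d"
  then have "cocone K P D T Y d" by (rule cocone_cong) (simp_all add: eq)
  then have "\<exists>!h. h \<in> Hom K X Y \<and> (\<forall>i \<in> Field P. h \<cdot>\<^bsub>K\<^esub> k i = d i)"
    using assms(1) by (simp add: colimit_def)
  then show "\<exists>!h. h \<in> Hom K X Y \<and> (\<forall>i \<in> Field P. h \<cdot>\<^bsub>K\<^esub> k' i = d i)"
    using eq(3) by simp
qed

text \<open>A cocone on the tail from \<open>j\<close> extends to all of \<open>r\<close> by
  composing with \<open>T i j\<close> at the points \<open>i\<close> before \<open>j\<close>, and an
  arrow out of \<open>X\<close> is determined on the tail.\<close>

lemma colimit_tail:
  assumes K: "category K" and wo: "Well_order r" and D: "diagram K r D T"
    and col: "colimit K r D T X k" and j: "j \<in> Field r"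
  defines "q \<equiv> Restr r {i. (j, i) \<in> r}"
  shows "colimit K q D T X k"
proof -
  have Fq: "Field q = {i. (j, i) \<in> r}"
    unfolding q_def by (rule Field_Restr_subset[OF Well_orderD(1)[OF wo]]) (auto simp: Field_def)
  have qr: "q \<subseteq> r" by (auto simp: q_def)
  have FF: "Field q \<subseteq> Field r" using qr by (auto simp: Field_def)
  have coc: "cocone K q D T X k"
    using colimit_cocone[OF col] FF qr unfolding cocone_def by blast
  show ?thesis unfolding colimit_def
  proof (intro conjI allI impI)
    show "cocone K q D T X k" by (fact coc)
    fix Y d assume d: "cocone K q D T Y d"
    define d' where "d' i = (if (j, i) \<in> r then d i else d j \<cdot>\<^bsub>K\<^esub> T i j)" for i
    have jj: "(j, j) \<in> r" using wo_refl[OF wo j] .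
    have dH: "d i \<in> Hom K (D i) Y" if "(j, i) \<in> r" for i
      using d that Fq by (simp add: cocone_def)
    have TH: "T i i' \<in> Hom K (D i) (D i')" if "(i, i') \<in> r" for i i'
      using D that by (simp add: diagram_def)
    have TT: "T i' i'' \<cdot>\<^bsub>K\<^esub> T i i' = T i i''" if "(i, i') \<in> r" "(i', i'') \<in> r" for i i' i''
      using D that by (simp add: diagram_def)
    have dT: "d i' \<cdot>\<^bsub>K\<^esub> T i i' = d i" if "(j, i) \<in> r" "(i, i') \<in> r" for i i'
      using d that wo_trans[OF wo that] by (simp add: cocone_def q_def)
    have below: "(i, j) \<in> r" if "i \<in> Field r" "(j, i) \<notin> r" for i
      using wo_cases[OF wo j that(1)] that(2) by (auto simp: underS_def)
    have "cocone K r D T Y d'" unfolding cocone_def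
    proof (intro conjI ballI allI impI)
      show "Y \<in> Obj K" using d by (simp add: cocone_def)
      show "d' i \<in> Hom K (D i) Y" if "i \<in> Field r" for i
        using dH[of i] categoryD(4)[OF K TH[OF below[OF that]] dH[OF jj]] unfolding d'_def by auto
      show "d' i' \<cdot>\<^bsub>K\<^esub> T i i' = d' i" if ii: "(i, i') \<in> r" for i i'
      proof -
        have F: "i \<in> Field r" "i' \<in> Field r" using ii by (auto simp: Field_def)
        consider "(j, i) \<in> r" | "(j, i) \<notin> r" "(j, i') \<in> r" | "(j, i) \<notin> r" "(j, i') \<notin> r" by blast
        then show ?thesis
        proof cases
          case 1
          then show ?thesis using dT ii wo_trans[OF wo 1 ii] by (simp add: d'_def)
        next
          case 2
          note b = below[OF F(1) 2(1)]
          have "d' i' \<cdot>\<^bsub>K\<^esub> T i i' = d i' \<cdot>\<^bsub>K\<^esub> (T j i' \<cdot>\<^bsub>K\<^esub> T i j)"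
            using 2 TT[OF b 2(2)] by (simp add: d'_def)
          also have "\<dots> = (d i' \<cdot>\<^bsub>K\<^esub> T j i') \<cdot>\<^bsub>K\<^esub> T i j"
            using categoryD(7)[OF K TH[OF b] TH[OF 2(2)] dH[OF 2(2)]] by simp
          also have "\<dots> = d' i" using dT[OF jj 2(2)] 2 by (simp add: d'_def)
          finally show ?thesis .
        next
          case 3
          note b = below[OF F(2) 3(2)]
          have "d' i' \<cdot>\<^bsub>K\<^esub> T i i' = d j \<cdot>\<^bsub>K\<^esub> (T i' j \<cdot>\<^bsub>K\<^esub> T i i')"
            using categoryD(7)[OF K TH[OF ii] TH[OF b] dH[OF jj]] 3 by (simp add: d'_def)
          then show ?thesis using TT[OF ii b] 3 by (simp add: d'_def)
        qed
      qed
    qed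
    then obtain h where h: "h \<in> Hom K X Y" "\<And>i. i \<in> Field r \<Longrightarrow> h \<cdot>\<^bsub>K\<^esub> k i = d' i"
      using colimit_factor[OF col] by blast
    show "\<exists>!h. h \<in> Hom K X Y \<and> (\<forall>i \<in> Field q. h \<cdot>\<^bsub>K\<^esub> k i = d i)"
    proof (intro ex1I conjI)
      show "h \<in> Hom K X Y" by (fact h(1))
      show *: "\<forall>i \<in> Field q. h \<cdot>\<^bsub>K\<^esub> k i = d i"
        using h(2) Fq FF by (auto simp: d'_def)
      fix g assume g: "g \<in> Hom K X Y \<and> (\<forall>i \<in> Field q. g \<cdot>\<^bsub>K\<^esub> k i = d i)"
      show "g = h"
      proof (rule colimit_eqI[OF K D col])
        show "g \<in> Hom K X Y" "h \<in> Hom K X Y" using g h(1) by auto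
        fix i assume i: "i \<in> Field r"
        show "g \<cdot>\<^bsub>K\<^esub> k i = h \<cdot>\<^bsub>K\<^esub> k i"
        proof (cases "(j, i) \<in> r")
          case True
          then show ?thesis using g * Fq by auto
        next
          case False
          note b = below[OF i False]
          have kj: "k j \<in> Hom K (D j) X" "k j \<cdot>\<^bsub>K\<^esub> T i j = k i"
            using colimit_cocone[OF col] j b by (auto simp: cocone_def)
          have "g \<cdot>\<^bsub>K\<^esub> k j = h \<cdot>\<^bsub>K\<^esub> k j" using g * Fq jj by auto
          then show ?thesis
            using categoryD(7)[OF K TH[OF b] kj(1), of g Y] categoryD(7)[OF K TH[OF b] kj(1), of h Y]
              g h(1) kj(2) by simp
        qed
      qed
    qed
  qed
qed

lemma directedD:
  "directed \<kappa> P \<Longrightarrow> S \<subseteq> Field P \<Longrightarrow> |S| <o \<kappa> \<Longrightarrow> \<exists>u\<in>Field P. \<forall>i\<in>S. (i, u) \<in> P"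
  by (simp add: directed_def)

lemma directed_wo:
  assumes wo: "Well_order r" and ne: "Field r \<noteq> {}"
  shows "directed natLeq r"
  unfolding directed_def
proof (intro conjI allI impI)
  show "Partial_order r" using Well_orderD(6)[OF wo] .
  fix S assume S: "S \<subseteq> Field r" "|S| <o natLeq"
  have "finite S" using S(2) by (simp add: finite_iff_ordLess_natLeq)
  then show "\<exists>u\<in>Field r. \<forall>i\<in>S. (i, u) \<in> r"
    using S(1)
  proof (induction S)
    case empty
    then show ?case using ne by blast
  next
    case (insert x S)
    then obtain u where u: "u \<in> Field r" "\<forall>i\<in>S. (i, u) \<in> r" by blast
    have x: "x \<in> Field r" using insert by blast
    show ?case
    proof (cases "(x, u) \<in> r")
      case True
      then show ?thesis using u by blast
    next
      case False
      then have "(u, x) \<in> r" using wo_cases[OF wo x u(1)] by (auto simp: underS_def)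
      then show ?thesis using u x wo_trans[OF wo] wo_refl[OF wo x] by blast
    qed
  qed
qed

context AECat
begin

lemma category_C: "category C"
  using accessible_C by (simp add: accessible_def)

lemma comp_simps [simp]:
  assumes "f \<in> Arr C" "g \<in> Arr C" "Cod f = Dom g"
  shows "g \<cdot> f \<in> Arr C" "Dom (g \<cdot> f) = Dom f" "Cod (g \<cdot> f) = Cod g"
  using categoryD(4)[OF category_C, of f "Dom f" "Dom g" g "Cod g"] assms by (auto simp: Hom_iff)

lemma comp_assoc:
  assumes "f \<in> Arr C" "g \<in> Arr C" "h \<in> Arr C" "Cod f = Dom g" "Cod g = Dom h"
  shows "(h \<cdot> g) \<cdot> f = h \<cdot> (g \<cdot> f)"
  using categoryD(7)[OF category_C, of f "Dom f" "Dom g" g "Dom h" h "Cod h"] assms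
  by (auto simp: Hom_iff)

lemma Id_simps [simp]:
  assumes "X \<in> Obj C"
  shows "Id C X \<in> Arr C" "Dom (Id C X) = X" "Cod (Id C X) = X"
  using categoryD(3)[OF category_C assms] by (auto simp: Hom_iff)

lemma Id_comp [simp]: "f \<in> Arr C \<Longrightarrow> Cod f = X \<Longrightarrow> Id C X \<cdot> f = f"
  and comp_Id [simp]: "f \<in> Arr C \<Longrightarrow> Dom f = X \<Longrightarrow> f \<cdot> Id C X = f"
  using categoryD(5,6)[OF category_C, of f "Dom f" "Cod f"] by (auto simp: Hom_iff)

lemma Arr_Obj: "f \<in> Arr C \<Longrightarrow> Dom f \<in> Obj C" "f \<in> Arr C \<Longrightarrow> Cod f \<in> Obj C"
  using categoryD(1,2)[OF category_C] by auto

lemma Mod_Obj: "M \<in> Mod \<Longrightarrow> M \<in> Obj C"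
  using Mod_sub by blast

lemma comp_cancel:
  assumes "f \<cdot> g = f \<cdot> h" "f \<in> Arr C" "g \<in> Arr C" "h \<in> Arr C" "Cod g = Dom f" "Cod h = Dom f"
  shows "g = h"
proof -
  have "Dom g = Dom h" using assms comp_simps(2) by metis
  then show ?thesis
    using all_monic[OF assms(2)] assms unfolding monic_def by (auto simp: Hom_iff)
qed

subsection \<open>Presentability\<close>

text \<open>\<open>X\<close> is a small colimit of \<kappa>-presentable pieces, and \<nu> is taken
  at least \<kappa> and above the number of pieces. In a \<nu>-directed diagram the factorisations
  of all pieces can be moved to one index \<open>u\<close>. They are compatible there because
  \<open>e u\<close> is monic, and the same cancellation gives essential uniqueness.\<close>

lemma ex_presentable:
  assumes inacc: "inaccessible \<Omega>" and X: "X \<in> Obj C"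
  obtains \<nu> where "regular_cardinal \<Omega> \<nu>" "presentable \<Omega> \<nu> C X"
proof -
  obtain \<kappa> where \<kappa>: "regular_cardinal \<Omega> \<kappa>" "accessible_at \<Omega> \<kappa> C"
    using accessible_C by (auto simp: accessible_def)
  obtain P :: "'u rel" and D T k where P: "small \<Omega> (Field P)" and D: "diagram C P D T"
    and pres: "\<And>p. p \<in> Field P \<Longrightarrow> presentable \<Omega> \<kappa> C (D p)" and col: "colimit C P D T X k"
    using \<kappa>(2) X unfolding accessible_at_def by blast
  obtain \<nu> where \<nu>: "regular_cardinal \<Omega> \<nu>" "\<kappa> \<le>o \<nu>" "|Field P| <o \<nu>"
    using regular_cardinal_above_small[OF inacc \<kappa>(1) P] by blast
  have kH: "k p \<in> Hom C (D p) X" if "p \<in> Field P" for p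
    using colimit_cocone[OF col] that by (simp add: cocone_def)
  have "presentable \<Omega> \<nu> C X"
    unfolding presentable_def
  proof (rule conjI[OF X], intro allI impI, (erule conjE)+, intro conjI ballI impI)
    fix Q :: "'u rel" and E S Y e
    assume Q: "directed \<nu> Q" "small \<Omega> (Field Q)" and E: "diagram C Q E S"
      and colE: "colimit C Q E S Y e"
    have Q\<kappa>: "directed \<kappa> Q" using directed_antimono[OF Q(1) \<nu>(2)] .
    have eH: "e q \<in> Hom C (E q) Y" if "q \<in> Field Q" for q
      using colimit_cocone[OF colE] that by (simp add: cocone_def)
    have eS: "e q' \<cdot> S q q' = e q" if "(q, q') \<in> Q" for q q'
      using colimit_cocone[OF colE] that by (simp add: cocone_def)
    have SH: "S q q' \<in> Hom C (E q) (E q')" if "(q, q') \<in> Q" for q q'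
      using E that by (simp add: diagram_def)
    show "\<exists>i\<in>Field Q. \<exists>g\<in>Hom C X (E i). e i \<cdot> g = f" if f: "f \<in> Hom C X Y" for f
    proof -
      have "\<exists>q g. q \<in> Field Q \<and> g \<in> Hom C (D p) (E q) \<and> e q \<cdot> g = f \<cdot> k p"
        if p: "p \<in> Field P" for p
      proof -
        have "f \<cdot> k p \<in> Hom C (D p) Y" using f kH[OF p] by (auto simp: Hom_iff)
        then show ?thesis
          using pres[OF p] Q\<kappa> Q(2) E colE unfolding presentable_def by blast
      qed
      then obtain q g where qg: "\<And>p. p \<in> Field P \<Longrightarrow>
          q p \<in> Field Q \<and> g p \<in> Hom C (D p) (E (q p)) \<and> e (q p) \<cdot> g p = f \<cdot> k p"
        by metis
      have "|q ` Field P| <o \<nu>" using card_of_image \<nu>(3) ordLeq_ordLess_trans by blast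
      moreover have "q ` Field P \<subseteq> Field Q" using qg by blast
      ultimately have "\<exists>u\<in>Field Q. \<forall>i\<in>q ` Field P. (i, u) \<in> Q"
        using directedD[OF Q(1)] by blast
      then obtain u where u: "u \<in> Field Q" "\<And>p. p \<in> Field P \<Longrightarrow> (q p, u) \<in> Q" by auto
      define h where "h p = S (q p) u \<cdot> g p" for p
      have hH: "h p \<in> Hom C (D p) (E u)" if "p \<in> Field P" for p
        using qg[OF that] SH[OF u(2)[OF that]] unfolding h_def by (auto simp: Hom_iff)
      have eh: "e u \<cdot> h p = f \<cdot> k p" if "p \<in> Field P" for p
      proof -
        have "e u \<cdot> h p = (e u \<cdot> S (q p) u) \<cdot> g p"
          using comp_assoc[of "g p" "S (q p) u" "e u"] qg[OF that] SH[OF u(2)[OF that]] eH[OF u(1)]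
          by (auto simp: Hom_iff h_def)
        then show ?thesis using eS[OF u(2)[OF that]] qg[OF that] by simp
      qed
      have "cocone C P D T (E u) h" unfolding cocone_def
      proof (intro conjI ballI allI impI)
        show "E u \<in> Obj C" using E u(1) by (simp add: diagram_def)
        show "h p \<in> Hom C (D p) (E u)" if "p \<in> Field P" for p using hH that .
        show "h p' \<cdot> T p p' = h p" if pp: "(p, p') \<in> P" for p p'
        proof -
          have F: "p \<in> Field P" "p' \<in> Field P" using pp by (auto simp: Field_def)
          have TH: "T p p' \<in> Hom C (D p) (D p')" using D pp by (simp add: diagram_def)
          have "e u \<cdot> (h p' \<cdot> T p p') = (e u \<cdot> h p') \<cdot> T p p'"
            using comp_assoc[of "T p p'" "h p'" "e u"] TH hH[OF F(2)] eH[OF u(1)]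
            by (auto simp: Hom_iff)
          also have "\<dots> = f \<cdot> (k p' \<cdot> T p p')"
            using comp_assoc[of "T p p'" "k p'" f] TH kH[OF F(2)] f eh[OF F(2)]
            by (auto simp: Hom_iff)
          also have "\<dots> = e u \<cdot> h p"
            using colimit_cocone[OF col] pp eh[OF F(1)] by (simp add: cocone_def)
          finally show ?thesis
            by (rule comp_cancel) (use TH hH[OF F(2)] hH[OF F(1)] eH[OF u(1)] in \<open>auto simp: Hom_iff\<close>)
        qed
      qed
      then obtain g' where g': "g' \<in> Hom C X (E u)" "\<And>p. p \<in> Field P \<Longrightarrow> g' \<cdot> k p = h p"
        using colimit_factor[OF col] by blast
      have "e u \<cdot> g' = f"
      proof (rule colimit_eqI[OF category_C D col])
        show "e u \<cdot> g' \<in> Hom C X Y" using g'(1) eH[OF u(1)] by (auto simp: Hom_iff)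
        show "f \<in> Hom C X Y" by (fact f)
        show "(e u \<cdot> g') \<cdot> k p = f \<cdot> k p" if "p \<in> Field P" for p
          using comp_assoc[of "k p" g' "e u"] kH[OF that] g'(1) eH[OF u(1)] g'(2)[OF that] eh[OF that]
          by (auto simp: Hom_iff)
      qed
      then show ?thesis using u(1) g'(1) by blast
    qed
    show "\<exists>l. (i, l) \<in> Q \<and> (j, l) \<in> Q \<and> S i l \<cdot> g = S j l \<cdot> h"
      if ij: "i \<in> Field Q" "j \<in> Field Q" and g: "g \<in> Hom C X (E i)" and h: "h \<in> Hom C X (E j)"
        and eq: "e i \<cdot> g = e j \<cdot> h" for i j g h
    proof -
      have "|{i, j}| <o \<nu>" by (rule finite_less_regular[OF \<nu>(1)]) simp
      then have "\<exists>u\<in>Field Q. \<forall>x\<in>{i, j}. (x, u) \<in> Q"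
        using directedD[OF Q(1), of "{i, j}"] ij by blast
      then obtain l where l: "l \<in> Field Q" "(i, l) \<in> Q" "(j, l) \<in> Q" by auto
      note H = SH[OF l(2)] SH[OF l(3)] g h eH[OF l(1)]
      have "e l \<cdot> (S i l \<cdot> g) = (e l \<cdot> S i l) \<cdot> g"
        using comp_assoc[of g "S i l" "e l"] H by (auto simp: Hom_iff)
      also have "\<dots> = (e l \<cdot> S j l) \<cdot> h" using eS[OF l(2)] eS[OF l(3)] eq by simp
      also have "\<dots> = e l \<cdot> (S j l \<cdot> h)"
        using comp_assoc[of h "S j l" "e l"] H by (auto simp: Hom_iff)
      finally have "S i l \<cdot> g = S j l \<cdot> h"
        by (rule comp_cancel) (use H in \<open>auto simp: Hom_iff\<close>)
      then show ?thesis using l by blast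
    qed
  qed
  then show thesis using that \<nu>(1) by blast
qed

subsection \<open>Chains of models\<close>

lemma category_Mod: "category (full_subcat C Mod)"
  using accessible_Mod by (simp add: accessible_def)

lemma Hom_full: "f \<in> Hom (full_subcat C Mod) X Y \<longleftrightarrow> f \<in> Hom C X Y \<and> X \<in> Mod \<and> Y \<in> Mod"
  by (auto simp: Hom_iff full_subcat_def)

lemma full_simps [simp]:
  "Comp (full_subcat C Mod) = Comp C" "Obj (full_subcat C Mod) = Mod"
  "Id (full_subcat C Mod) = Id C"
  by (auto simp: full_subcat_def)

lemma diagram_Mod:
  "diagram (full_subcat C Mod) P D T \<longleftrightarrow> diagram C P D T \<and> (\<forall>i \<in> Field P. D i \<in> Mod)"
proof -
  have "i \<in> Field P" "j \<in> Field P" if "(i, j) \<in> P" for i j using that by (auto simp: Field_def)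
  then show ?thesis unfolding diagram_def using Mod_Obj by (auto simp: Hom_full)
qed

lemma colimit_Mod_C:
  fixes r :: "'u rel"
  assumes "Well_order r" "Field r \<noteq> {}" "small \<Omega> (Field r)"
    "diagram (full_subcat C Mod) r D T" "colimit (full_subcat C Mod) r D T X k"
  shows "colimit C r D T X k"
  using inclusion_preserves[OF directed_wo[OF assms(1,2)] assms(3-5)] .

text \<open>Both readings of the colimit are needed: among models it expresses continuity of a
  chain, and in the ambient category it serves Union and factorisations.\<close>

lemma ex_chain_colimit:
  fixes r :: "'u rel"
  assumes "Well_order r" "Field r \<noteq> {}" "small \<Omega> (Field r)" "diagram (full_subcat C Mod) r D T"
  obtains X k where "colimit (full_subcat C Mod) r D T X k" "colimit C r D T X k" "X \<in> Mod"
proof -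
  obtain X k where X: "colimit (full_subcat C Mod) r D T X k"
    using directed_colimits_Mod directed_wo[OF assms(1,2)] assms(3,4)
    unfolding has_directed_colimits_def by blast
  moreover have "X \<in> Mod" using colimit_cocone[OF X] by (simp add: cocone_def)
  ultimately show thesis using that colimit_Mod_C[OF assms X] by blast
qed

end

section \<open>Galois types\<close>

context AECat
begin

lemma extensionD:
  assumes "extension M f N"
  shows "M \<in> Mod" "N \<in> Mod" "f \<in> Arr C" "Dom f = M" "Cod f = N"
  using assms by (auto simp: extension_def Hom_iff)

lemma extension_comp: "extension M f N \<Longrightarrow> extension N g N' \<Longrightarrow> extension M (g \<cdot> f) N'"
  by (auto simp: extension_def Hom_iff)

lemma extension_Id: "M \<in> Mod \<Longrightarrow> extension M (Id C M) M"
  by (auto simp: extension_def Hom_iff Mod_Obj)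

lemma arrow_intoD:
  assumes "arrow_into a M" shows "a \<in> Arr C" "Cod a = M"
  using assms by (auto simp: arrow_into_def)

lemma arrow_into_comp:
  assumes "arrow_into a M" "extension M f N"
  shows "arrow_into (f \<cdot> a) N" "Dom (f \<cdot> a) = Dom a"
  using assms by (auto simp: arrow_into_def extension_def Hom_iff)

lemma arrow_into_pre:
  assumes "arrow_into a M" "h \<in> Arr C" "Cod h = Dom a"
  shows "arrow_into (a \<cdot> h) M" "Dom (a \<cdot> h) = Dom h"
  using assms by (auto simp: arrow_into_def)

lemma extension_arrow_into: "extension M f N \<Longrightarrow> arrow_into f N"
  by (auto simp: arrow_into_def extension_def Hom_iff)

lemma ext_assoc:
  assumes "arrow_into a M" "extension M f N" "extension N g N'"
  shows "(g \<cdot> f) \<cdot> a = g \<cdot> (f \<cdot> a)"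
  using assms by (intro comp_assoc) (auto simp: arrow_into_def extension_def Hom_iff)

lemma pre_assoc:
  assumes "arrow_into a M" "extension M f N" "h \<in> Arr C" "Cod h = Dom a"
  shows "(f \<cdot> a) \<cdot> h = f \<cdot> (a \<cdot> h)"
  using assms by (intro comp_assoc) (auto simp: arrow_into_def extension_def Hom_iff)

text \<open>Equality of domains follows from \<open>f \<cdot> a = f' \<cdot> a'\<close>, so the
  definition reduces to one relation between corresponding entries.\<close>

lemma gtp_eq_iff:
  "gtp_eq as M as' M' \<longleftrightarrow>
     (\<exists>N f f'. extension M f N \<and> extension M' f' N \<and>
        list_all2 (\<lambda>a a'. arrow_into a M \<and> arrow_into a' M' \<and> f \<cdot> a = f' \<cdot> a') as as')"
proof
  assume "gtp_eq as M as' M'"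
  then obtain N f f' where *: "extension M f N" "extension M' f' N"
    "map (\<lambda>a. f \<cdot> a) as = map (\<lambda>a. f' \<cdot> a) as'" "\<forall>a \<in> set as. arrow_into a M"
    "\<forall>a \<in> set as'. arrow_into a M'"
    unfolding gtp_eq_def by blast
  have len: "length as = length as'" using *(3) by (metis length_map)
  have "f \<cdot> (as ! i) = f' \<cdot> (as' ! i)" if "i < length as" for i
    using arg_cong[OF *(3), of "\<lambda>l. l ! i"] that len by simp
  then have "list_all2 (\<lambda>a a'. arrow_into a M \<and> arrow_into a' M' \<and> f \<cdot> a = f' \<cdot> a') as as'"
    using *(4,5) len by (simp add: list_all2_conv_all_nth)
  then show "\<exists>N f f'. extension M f N \<and> extension M' f' N \<and>
      list_all2 (\<lambda>a a'. arrow_into a M \<and> arrow_into a' M' \<and> f \<cdot> a = f' \<cdot> a') as as'"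
    using * by blast
next
  assume "\<exists>N f f'. extension M f N \<and> extension M' f' N \<and>
      list_all2 (\<lambda>a a'. arrow_into a M \<and> arrow_into a' M' \<and> f \<cdot> a = f' \<cdot> a') as as'"
  then obtain N f f' where *: "extension M f N" "extension M' f' N"
    "length as = length as'"
    "\<And>i. i < length as \<Longrightarrow>
      arrow_into (as ! i) M \<and> arrow_into (as' ! i) M' \<and> f \<cdot> (as ! i) = f' \<cdot> (as' ! i)"
    by (auto simp: list_all2_conv_all_nth)
  have "\<forall>a \<in> set as. arrow_into a M" "\<forall>a \<in> set as'. arrow_into a M'"
    using *(3,4) by (auto simp: in_set_conv_nth)
  moreover have "map (\<lambda>a. f \<cdot> a) as = map (\<lambda>a. f' \<cdot> a) as'"
    by (rule nth_equalityI) (use *(3,4) in auto)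
  moreover have "Dom (as ! i) = Dom (as' ! i)" if "i < length as" for i
    using *(4)[OF that] arrow_into_comp(2)[OF _ *(1)] arrow_into_comp(2)[OF _ *(2)] by metis
  then have "map (\<lambda>a. Dom a) as = map (\<lambda>a. Dom a) as'"
    by (intro nth_equalityI) (use *(3) in auto)
  ultimately show "gtp_eq as M as' M'"
    using *(1,2) extensionD(1) unfolding gtp_eq_def by blast
qed

lemma gtp_eqE:
  assumes "gtp_eq as M as' M'"
  obtains N f f' where "extension M f N" "extension M' f' N"
    "list_all2 (\<lambda>a a'. arrow_into a M \<and> arrow_into a' M' \<and> f \<cdot> a = f' \<cdot> a') as as'"
  using assms unfolding gtp_eq_iff by blast

lemma gtp_eqI:
  assumes "extension M f N" "extension M' f' N"
    "list_all2 (\<lambda>a a'. arrow_into a M \<and> arrow_into a' M' \<and> f \<cdot> a = f' \<cdot> a') as as'"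
  shows "gtp_eq as M as' M'"
  using assms unfolding gtp_eq_iff by blast

lemma gtp_eq_sym: "gtp_eq as M as' M' \<Longrightarrow> gtp_eq as' M' as M"
proof (elim gtp_eqE)
  fix N f f' assume *: "extension M f N" "extension M' f' N"
    "list_all2 (\<lambda>a a'. arrow_into a M \<and> arrow_into a' M' \<and> f \<cdot> a = f' \<cdot> a') as as'"
  have "list_all2 (\<lambda>a a'. arrow_into a M' \<and> arrow_into a' M \<and> f' \<cdot> a = f \<cdot> a') as' as"
    using *(3) by (auto simp: list_all2_conv_all_nth)
  with *(2,1) show ?thesis by (rule gtp_eqI)
qed

lemma gtp_eq_ext:
  assumes f: "extension M f N" and as: "list_all (\<lambda>a. arrow_into a M) as"
  shows "gtp_eq as M (map (\<lambda>a. f \<cdot> a) as) N"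
proof (rule gtp_eqI[OF f extension_Id[OF extensionD(2)[OF f]]])
  have "Id C N \<cdot> (f \<cdot> a) = f \<cdot> a" if "arrow_into a M" for a
    using arrow_into_comp(1)[OF that f] by (simp add: arrow_into_def)
  then show "list_all2 (\<lambda>a a'. arrow_into a M \<and> arrow_into a' N \<and> f \<cdot> a = Id C N \<cdot> a')
      as (map (\<lambda>a. f \<cdot> a) as)"
    using as arrow_into_comp(1)[OF _ f] by (auto simp: list_all2_conv_all_nth list_all_length)
qed

text \<open>The two witnessing models are amalgamated over the middle model
  \<open>M'\<close>.\<close>

lemma gtp_eq_trans:
  assumes AP: amalgamation and "gtp_eq as M as' M'" "gtp_eq as' M' as'' M''"
  shows "gtp_eq as M as'' M''"
proof -
  obtain N1 f1 f1' where 1: "extension M f1 N1" "extension M' f1' N1"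
    "list_all2 (\<lambda>a a'. arrow_into a M \<and> arrow_into a' M' \<and> f1 \<cdot> a = f1' \<cdot> a') as as'"
    using assms(2) by (rule gtp_eqE)
  obtain N2 f2 f2' where 2: "extension M' f2 N2" "extension M'' f2' N2"
    "list_all2 (\<lambda>a a'. arrow_into a M' \<and> arrow_into a' M'' \<and> f2 \<cdot> a = f2' \<cdot> a') as' as''"
    using assms(3) by (rule gtp_eqE)
  obtain N g1 g2 where g: "extension N1 g1 N" "extension N2 g2 N" "g1 \<cdot> f1' = g2 \<cdot> f2"
    using AP 1(2) 2(1) unfolding amalgamation_def by blast
  show ?thesis
  proof (rule gtp_eqI[OF extension_comp[OF 1(1) g(1)] extension_comp[OF 2(2) g(2)]])
    show "list_all2 (\<lambda>a a'. arrow_into a M \<and> arrow_into a' M'' \<and> (g1 \<cdot> f1) \<cdot> a = (g2 \<cdot> f2') \<cdot> a') as as''"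
    proof (rule list_all2_trans[OF _ 1(3) 2(3)])
      fix a b c
      assume ab: "arrow_into a M \<and> arrow_into b M' \<and> f1 \<cdot> a = f1' \<cdot> b"
        and bc: "arrow_into b M' \<and> arrow_into c M'' \<and> f2 \<cdot> b = f2' \<cdot> c"
      have "(g1 \<cdot> f1) \<cdot> a = (g1 \<cdot> f1') \<cdot> b"
        using ab ext_assoc[OF _ 1(1) g(1)] ext_assoc[OF _ 1(2) g(1)] by simp
      also have "\<dots> = (g2 \<cdot> f2') \<cdot> c"
        using bc g(3) ext_assoc[OF _ 2(1) g(2)] ext_assoc[OF _ 2(2) g(2)] by simp
      finally show "arrow_into a M \<and> arrow_into c M'' \<and> (g1 \<cdot> f1) \<cdot> a = (g2 \<cdot> f2') \<cdot> c"
        using ab bc by blast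
    qed
  qed
qed

text \<open>Comparing sets of pairs covers deletion, reordering and repetition of entries at
  once.\<close>

lemma gtp_eq_subset:
  assumes "gtp_eq as M as' M'" "length bs = length bs'" "set (zip bs bs') \<subseteq> set (zip as as')"
  shows "gtp_eq bs M bs' M'"
proof -
  obtain N f f' where *: "extension M f N" "extension M' f' N"
    "list_all2 (\<lambda>a a'. arrow_into a M \<and> arrow_into a' M' \<and> f \<cdot> a = f' \<cdot> a') as as'"
    using assms(1) by (rule gtp_eqE)
  have "list_all2 (\<lambda>a a'. arrow_into a M \<and> arrow_into a' M' \<and> f \<cdot> a = f' \<cdot> a') bs bs'"
    using *(3) assms(2,3) by (auto simp: list_all2_iff)
  then show ?thesis using gtp_eqI *(1,2) by blast
qed

lemma gtp_eq_permute3: "gtp_eq [a, b, c] M [a', b', c'] M' \<Longrightarrow> gtp_eq [c, a, b] M [c', a', b'] M'"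
  "gtp_eq [a, b, c] M [a', b', c'] M' \<Longrightarrow> gtp_eq [c, b, a] M [c', b', a'] M'"
  "gtp_eq [a, b] M [a', b'] M' \<Longrightarrow> gtp_eq [b, a] M [b', a'] M'"
  by (auto elim!: gtp_eq_subset)

text \<open>Embeddings that agree on \<open>a\<close> agree on whatever factors through
  \<open>a\<close>. This is how an earlier model of a chain, or the base \<open>c\<close> inside a
  model, is added to a type.\<close>

lemma gtp_eq_comp:
  assumes "gtp_eq (a # as) M (a' # as') M'" "h \<in> Arr C" "Cod h = Dom a"
  shows "gtp_eq (a \<cdot> h # a # as) M (a' \<cdot> h # a' # as') M'"
proof -
  obtain N f f' where *: "extension M f N" "extension M' f' N"
    "list_all2 (\<lambda>a a'. arrow_into a M \<and> arrow_into a' M' \<and> f \<cdot> a = f' \<cdot> a') (a # as) (a' # as')"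
    using assms(1) by (rule gtp_eqE)
  then have a: "arrow_into a M" "arrow_into a' M'" "f \<cdot> a = f' \<cdot> a'" by auto
  have D: "Dom a = Dom a'"
    using a(3) arrow_into_comp(2)[OF a(1) *(1)] arrow_into_comp(2)[OF a(2) *(2)] by simp
  have "f \<cdot> (a \<cdot> h) = f' \<cdot> (a' \<cdot> h)"
    using pre_assoc[OF a(1) *(1) assms(2)] pre_assoc[OF a(2) *(2) assms(2)] assms(3) a(3) D by simp
  moreover have "arrow_into (a \<cdot> h) M" "arrow_into (a' \<cdot> h) M'"
    using arrow_into_pre(1) a assms(2,3) D by auto
  ultimately show ?thesis using *(3) by (intro gtp_eqI[OF *(1,2)]) auto
qed

lemma gtp_eqD:
  assumes "gtp_eq as M as' M'"
  shows "M \<in> Mod" "M' \<in> Mod" "\<And>a. a \<in> set as \<Longrightarrow> arrow_into a M"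
    "\<And>a. a \<in> set as' \<Longrightarrow> arrow_into a M'" "map (\<lambda>a. Dom a) as = map (\<lambda>a. Dom a) as'"
  using assms unfolding gtp_eq_def by blast+

section \<open>Factoring through an arrow, and subobjects\<close>

lemma factors_throughI:
  "b \<in> Arr C \<Longrightarrow> h \<in> Arr C \<Longrightarrow> Cod h = Dom b \<Longrightarrow> factors_through C (b \<cdot> h) b"
  by (auto simp: factors_through_def Hom_iff)

lemma factors_throughE:
  assumes "factors_through C a b"
  obtains h where "h \<in> Arr C" "Dom h = Dom a" "Cod h = Dom b" "a = b \<cdot> h" "a \<in> Arr C" "b \<in> Arr C"
    "Cod a = Cod b"
  using assms by (auto simp: factors_through_def Hom_iff)

lemma factors_through_refl: "a \<in> Arr C \<Longrightarrow> factors_through C a a"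
  using factors_throughI[of a "Id C (Dom a)"] Arr_Obj(1)[of a] by simp

lemma factors_through_trans:
  assumes "factors_through C a b" "factors_through C b c"
  shows "factors_through C a c"
proof -
  obtain h where h: "h \<in> Arr C" "Dom h = Dom a" "Cod h = Dom b" "a = b \<cdot> h" "a \<in> Arr C" "b \<in> Arr C"
    "Cod a = Cod b" using assms(1) by (rule factors_throughE)
  obtain g where g: "g \<in> Arr C" "Dom g = Dom b" "Cod g = Dom c" "b = c \<cdot> g" "b \<in> Arr C" "c \<in> Arr C"
    "Cod b = Cod c" using assms(2) by (rule factors_throughE)
  have D: "Dom a = Dom h" "Cod h = Dom g" "Cod g = Dom c" using h(2,3) g(2,3) by simp_all
  have "a = c \<cdot> (g \<cdot> h)"
    using comp_assoc[OF h(1) g(1,6) D(2,3)] h(4) g(4) by metis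
  moreover have "factors_through C (c \<cdot> (g \<cdot> h)) c"
    by (rule factors_throughI) (use h(1) g(1,6) D in simp_all)
  ultimately show ?thesis by metis
qed

lemma factors_through_ext:
  assumes "factors_through C a b" "arrow_into b M" "extension M f N"
  shows "factors_through C (f \<cdot> a) (f \<cdot> b)"
proof -
  obtain h where h: "h \<in> Arr C" "Dom h = Dom a" "Cod h = Dom b" "a = b \<cdot> h" "a \<in> Arr C" "b \<in> Arr C"
    using assms(1) by (rule factors_throughE)
  have "factors_through C ((f \<cdot> b) \<cdot> h) (f \<cdot> b)"
    by (rule factors_throughI) (use arrow_into_comp[OF assms(2,3)] h(1,3) in \<open>auto simp: arrow_into_def\<close>)
  then show ?thesis using pre_assoc[OF assms(2,3) h(1,3)] h(4) by metis
qed

lemma subobj_eq: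
  assumes "a \<in> subobj C b"
  shows "subobj C a = subobj C b" "factors_through C a b" "factors_through C b a"
  using assms factors_through_trans by (auto simp: subobj_def)

lemma subobj_refl: "a \<in> Arr C \<Longrightarrow> a \<in> subobj C a"
  using factors_through_refl by (simp add: subobj_def)

lemma subobj_Sub: "arrow_into a M \<Longrightarrow> subobj C a \<in> Sub C M"
  by (auto simp: Sub_def arrow_into_def)

lemma Sub_rep:
  assumes "A \<in> Sub C M" "a \<in> A"
  shows "arrow_into a M" "A = subobj C a"
proof -
  obtain b where b: "A = subobj C b" "b \<in> Arr C" "Cod b = M" using assms(1) by (auto simp: Sub_def)
  show "A = subobj C a" using subobj_eq(1)[of a b] assms(2) b(1) by simp
  show "arrow_into a M" using subobj_eq(2)[of a b] assms(2) b by (auto simp: arrow_into_def factors_through_def)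
qed

lemma sub_le_subobj: "factors_through C a b \<Longrightarrow> sub_le C (subobj C a) (subobj C b)"
  using subobj_refl unfolding sub_le_def factors_through_def by blast

text \<open>In one Lascar step the two embeddings \<open>g1\<close> and \<open>g2\<close> agree on
  the model \<open>m0\<close>, hence on every \<open>b\<close> factoring through it; transitivity of
  Galois types handles the chain of steps.\<close>

lemma Lgtp_eq_gtp_eq:
  assumes AP: amalgamation and L: "Lgtp_eq as as' bs M"
  shows "gtp_eq (as @ bs) M (as' @ bs) M"
proof -
  have step: "gtp_eq (xs @ bs) M (ys @ bs) M" if st: "lascar_step M bs xs ys" for xs ys
  proof -
    obtain N f m0 where arr: "\<forall>a \<in> set xs \<union> set ys \<union> set bs. arrow_into a M"
      and N: "extension M f N" "arrow_into m0 N" "\<forall>b \<in> set bs. factors_through C (f \<cdot> b) m0"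
      and g: "gtp_eq (map (\<lambda>a. f \<cdot> a) xs @ [m0]) N (map (\<lambda>a. f \<cdot> a) ys @ [m0]) N"
      using st unfolding lascar_step_def by blast
    obtain N2 g1 g2 where g2: "extension N g1 N2" "extension N g2 N2"
      "list_all2 (\<lambda>a a'. arrow_into a N \<and> arrow_into a' N \<and> g1 \<cdot> a = g2 \<cdot> a')
         (map (\<lambda>a. f \<cdot> a) xs @ [m0]) (map (\<lambda>a. f \<cdot> a) ys @ [m0])"
      using g by (rule gtp_eqE)
    have len: "length xs = length ys" using list_all2_lengthD[OF g2(3)] by simp
    have xy: "list_all2 (\<lambda>a a'. g1 \<cdot> (f \<cdot> a) = g2 \<cdot> (f \<cdot> a')) xs ys" and m0: "g1 \<cdot> m0 = g2 \<cdot> m0"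
      using g2(3) len
      by (auto simp: list_all2_append list_all2_map1 list_all2_map2 elim: list_all2_mono)
    have b: "(g1 \<cdot> f) \<cdot> b = (g2 \<cdot> f) \<cdot> b" if b: "b \<in> set bs" for b
    proof -
      obtain h where h: "h \<in> Arr C" "Cod h = Dom m0" "f \<cdot> b = m0 \<cdot> h"
        using N(3) b by (meson factors_throughE)
      have "(g1 \<cdot> f) \<cdot> b = (g1 \<cdot> m0) \<cdot> h"
        using ext_assoc[OF _ N(1) g2(1), of b] arr b h pre_assoc[OF N(2) g2(1) h(1,2)] by simp
      also have "\<dots> = (g2 \<cdot> f) \<cdot> b"
        using ext_assoc[OF _ N(1) g2(2), of b] arr b h pre_assoc[OF N(2) g2(2) h(1,2)] m0 by simp
      finally show ?thesis .
    qed
    show ?thesis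
    proof (rule gtp_eqI[OF extension_comp[OF N(1) g2(1)] extension_comp[OF N(1) g2(2)]])
      show "list_all2 (\<lambda>a a'. arrow_into a M \<and> arrow_into a' M \<and> (g1 \<cdot> f) \<cdot> a = (g2 \<cdot> f) \<cdot> a')
         (xs @ bs) (ys @ bs)"
      proof (rule list_all2_appendI)
        show "list_all2 (\<lambda>a a'. arrow_into a M \<and> arrow_into a' M \<and> (g1 \<cdot> f) \<cdot> a = (g2 \<cdot> f) \<cdot> a') xs ys"
          using xy arr ext_assoc[OF _ N(1) g2(1)] ext_assoc[OF _ N(1) g2(2)]
          by (auto simp: list_all2_conv_all_nth)
        show "list_all2 (\<lambda>a a'. arrow_into a M \<and> arrow_into a' M \<and> (g1 \<cdot> f) \<cdot> a = (g2 \<cdot> f) \<cdot> a') bs bs"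
          using b arr by (auto simp: list_all2_same)
      qed
    qed
  qed
  show ?thesis using L unfolding Lgtp_eq_def
    by (induction rule: tranclp_induct) (use step gtp_eq_trans[OF AP] in blast)+
qed

text \<open>If the base \<open>c\<close> is itself a model, it can serve as \<open>m0\<close>, with
  the identity as the extension.\<close>

lemma gtp_eq_Lgtp_eq:
  assumes g: "gtp_eq (as @ [c]) M (as' @ [c]) M" and c: "Dom c \<in> Mod"
  shows "Lgtp_eq as as' [c] M"
proof -
  have M: "M \<in> Mod" using gtp_eqD(1)[OF g] .
  have arr: "\<forall>a \<in> set as \<union> set as' \<union> {c}. arrow_into a M"
    using gtp_eqD(3,4)[OF g] by auto
  have I: "map (\<lambda>a. Id C M \<cdot> a) as = as" "map (\<lambda>a. Id C M \<cdot> a) as' = as'" "Id C M \<cdot> c = c"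
    using arr by (auto simp: arrow_into_def intro!: map_idI)
  have "lascar_step M [c] as as'"
    unfolding lascar_step_def
    by (intro conjI exI[of _ M] exI[of _ "Id C M"] exI[of _ c])
      (use arr g c M extension_Id factors_through_refl in \<open>auto simp: I arrow_into_def\<close>)
  then show ?thesis unfolding Lgtp_eq_def by blast
qed

end

section \<open>Simple independence relations\<close>

locale simple_AECat = AECat \<Omega> C Mod
  for \<Omega> :: "'u rel" and C :: "('o, 'a) cat" (structure) and Mod :: "'o set" +
  fixes \<B> :: "'o set" and ind :: "'o \<Rightarrow> 'a set \<Rightarrow> 'a set \<Rightarrow> 'a set \<Rightarrow> bool"
  assumes inacc: "inaccessible \<Omega>" and AP: amalgamation
    and simple: "simple_independence_relation \<B> ind"
begin

lemmas gtp_trans = gtp_eq_trans[OF AP]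

lemma simple_props:
  "independence_relation \<B> ind" "Invariance ind" "Monotonicity ind" "Transitivity ind"
  "Symmetry ind" "Existence \<B> ind" "Extension ind" "Union_property ind"
  "Base_Monotonicity \<B> ind" "Club_Local_Character ind" "Independence_Theorem ind"
  using simple by (auto simp: simple_independence_relation_def)

lemma Mod_base: "Mod \<subseteq> \<B>"
  using simple_props(1) by (simp add: independence_relation_def base_class_def)

lemma amalgamate:
  assumes "extension M f1 N1" "extension M f2 N2"
  obtains N g1 g2 where "extension N1 g1 N" "extension N2 g2 N" "g1 \<cdot> f1 = g2 \<cdot> f2"
  using AP assms unfolding amalgamation_def by blast

section \<open>Calculus of independence for representing arrows\<close>

lemma indepD:
  assumes "indep ind M a c b"
  shows "arrow_into a M" "arrow_into c M" "arrow_into b M" "M \<in> Mod"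
    "ind M (subobj C a) (subobj C c) (subobj C b)"
  using assms simple_props(1) unfolding indep_def independence_relation_def by blast+

lemma indepI: "arrow_into a M \<Longrightarrow> arrow_into c M \<Longrightarrow> arrow_into b M \<Longrightarrow>
    ind M (subobj C a) (subobj C c) (subobj C b) \<Longrightarrow> indep ind M a c b"
  by (simp add: indep_def)

lemma indep_gtp:
  "indep ind M a c b \<Longrightarrow> gtp_eq [a, b, c] M [a', b', c'] M' \<Longrightarrow> indep ind M' a' c' b'"
  using simple_props(2) unfolding Invariance_def by blast

lemma indep_ext:
  assumes "indep ind M a c b" "extension M f N"
  shows "indep ind N (f \<cdot> a) (f \<cdot> c) (f \<cdot> b)"
  using indep_gtp[OF assms(1)] gtp_eq_ext[OF assms(2), of "[a, b, c]"] indepD[OF assms(1)] by auto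

lemma indep_sym: "indep ind M a c b \<Longrightarrow> indep ind M b c a"
  using simple_props(5) unfolding indep_def Symmetry_def by blast

lemma factors_through_arrow_into: "factors_through C a b \<Longrightarrow> arrow_into b M \<Longrightarrow> arrow_into a M"
  by (auto simp: factors_through_def arrow_into_def)

lemma indep_mono_left:
  assumes "indep ind M a c b" "factors_through C a' a"
  shows "indep ind M a' c b"
proof (rule indepI)
  show a': "arrow_into a' M" using factors_through_arrow_into[OF assms(2)] indepD(1)[OF assms(1)] .
  show "ind M (subobj C a') (subobj C c) (subobj C b)"
    using simple_props(3) indepD(5)[OF assms(1)] subobj_Sub[OF a'] sub_le_subobj[OF assms(2)]
    unfolding Monotonicity_def by blast
qed (use indepD[OF assms(1)] in auto)

lemma indep_mono_right:
  "indep ind M a c b \<Longrightarrow> factors_through C b' b \<Longrightarrow> indep ind M a c b'"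
  using indep_sym indep_mono_left by blast

lemma dom_in_subobj: "arrow_into c M \<Longrightarrow> Dom c \<in> Mod \<Longrightarrow> dom_in C \<B> (subobj C c)"
  using subobj_refl Mod_base unfolding dom_in_def arrow_into_def by blast

lemma indep_base_mono:
  assumes "indep ind M a c b" "factors_through C c d" "factors_through C d b" "Dom d \<in> Mod"
  shows "indep ind M a d b"
proof (rule indepI)
  show d: "arrow_into d M" using factors_through_arrow_into[OF assms(3)] indepD(3)[OF assms(1)] .
  show "ind M (subobj C a) (subobj C d) (subobj C b)"
    using simple_props(9) indepD(5)[OF assms(1)] subobj_Sub[OF d] sub_le_subobj[OF assms(2)]
      sub_le_subobj[OF assms(3)] dom_in_subobj[OF d assms(4)]
    unfolding Base_Monotonicity_def by blast
qed (use indepD[OF assms(1)] in auto)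

lemma indep_trans:
  assumes "indep ind M a c d" "indep ind M a d b" "factors_through C c d"
  shows "indep ind M a c b"
proof (rule indepI)
  show "ind M (subobj C a) (subobj C c) (subobj C b)"
    using simple_props(4) indepD(5)[OF assms(1)] indepD(5)[OF assms(2)] sub_le_subobj[OF assms(3)]
    unfolding Transitivity_def by blast
qed (use indepD[OF assms(1)] indepD[OF assms(2)] in auto)

lemma indep_existence:
  assumes "arrow_into a M" "arrow_into c M" "dom_in C \<B> (subobj C c)" "M \<in> Mod"
  shows "indep ind M a c c"
  using assms simple_props(6) subobj_Sub unfolding Existence_def by (intro indepI) blast+

text \<open>Extension with the identity of \<open>M\<close> as the larger arrow: the new realisation
  is independent from the whole model.\<close>

lemma indep_extension:
  assumes "indep ind M a c b"
  obtains N f a' where "extension M f N" "gtp_eq [a', f \<cdot> b, f \<cdot> c] N [a, b, c] M"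
    "indep ind N a' (f \<cdot> c) f"
proof -
  have M: "M \<in> Mod" using indepD(4)[OF assms] .
  have b: "arrow_into b M" using indepD(3)[OF assms] .
  have I: "arrow_into (Id C M) M" "factors_through C b (Id C M)"
    using M Mod_Obj b factors_throughI[of "Id C M" b] by (auto simp: arrow_into_def)
  obtain N f a' where *: "extension M f N" "gtp_eq [a', f \<cdot> b, f \<cdot> c] N [a, b, c] M"
    "indep ind N a' (f \<cdot> c) (f \<cdot> Id C M)"
    using simple_props(7) assms I unfolding Extension_def by blast
  have "f \<cdot> Id C M = f" using extensionD[OF *(1)] by simp
  then show thesis using that * by simp
qed

text \<open>Over a model, Galois types and Lascar strong types agree, so the independence theorem
  can be fed and read with \<open>gtp_eq\<close>.\<close>

lemma indep_amalgamation:
  assumes "indep ind M a c b" "indep ind M a' c b'" "indep ind M b c b'"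
    and c: "Dom c \<in> Mod" and g: "gtp_eq [a, c] M [a', c] M"
  obtains N f s where "extension M f N"
    "gtp_eq [s, f \<cdot> b, f \<cdot> c] N [f \<cdot> a, f \<cdot> b, f \<cdot> c] N"
    "gtp_eq [s, f \<cdot> b', f \<cdot> c] N [f \<cdot> a', f \<cdot> b', f \<cdot> c] N"
    "indep ind N s (f \<cdot> c) f"
proof -
  have "Lgtp_eq [a] [a'] [c] M" by (rule gtp_eq_Lgtp_eq) (use g c in auto)
  then obtain N f s where *: "extension M f N" "indep ind N s (f \<cdot> c) f"
    "Lgtp_eq [s, f \<cdot> b] [f \<cdot> a, f \<cdot> b] [f \<cdot> c] N"
    "Lgtp_eq [s, f \<cdot> b'] [f \<cdot> a', f \<cdot> b'] [f \<cdot> c] N"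
    using simple_props(11) assms(1-3) unfolding Independence_Theorem_def by blast
  show thesis
    by (rule that[OF *(1) _ _ *(2)]) (use *(3,4)[THEN Lgtp_eq_gtp_eq[OF AP]] in auto)
qed

lemma indep_union:
  fixes r :: "'u rel"
  assumes wo: "Well_order r" "Field r \<noteq> {}" "small \<Omega> (Field r)"
    and D: "diagram C r D T" and col: "colimit C r D T X k"
    and u: "arrow_into u M" "Dom u = X"
    and a: "arrow_into a M" and c: "arrow_into c M" and M: "M \<in> Mod"
    and ind: "\<And>i. i \<in> Field r \<Longrightarrow> indep ind M a c (u \<cdot> k i)"
  shows "indep ind M a c u"
proof (rule indepI[OF a c u(1)])
  have uH: "u \<in> Hom C X M" using u by (simp add: Hom_iff arrow_into_def)
  have "directed natLeq r \<and> small \<Omega> (Field r) \<and> diagram C r D T \<and> M \<in> Mod \<and>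
      cocone C r D T M (\<lambda>i. u \<cdot> k i) \<and> colimit C r D T X k \<and> u \<in> Hom C X M \<and>
      (\<forall>i \<in> Field r. u \<cdot> k i = u \<cdot> k i) \<and>
      (\<forall>i \<in> Field r. ind M (subobj C a) (subobj C c) (subobj C (u \<cdot> k i)))"
    using directed_wo[OF wo(1,2)] wo(3) D M col uH ind
      cocone_comp[OF category_C D colimit_cocone[OF col] uH] indepD(5) by blast
  then show "ind M (subobj C a) (subobj C c) (subobj C u)"
    using simple_props(8) unfolding Union_property_def by blast
qed

end

context AECat
begin

section \<open>Continuous chains\<close>

text \<open>The part of \<open>chain_of_initial_segments\<close> that mentions neither the sequence
  nor the cocone; it passes to segments of the index set and survives a change of the ambient
  model.\<close>

definition continuous_chain :: "'u rel \<Rightarrow> ('u \<Rightarrow> 'o) \<Rightarrow> ('u \<Rightarrow> 'u \<Rightarrow> 'a) \<Rightarrow> bool" where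
  "continuous_chain r Ms T \<longleftrightarrow>
     diagram (full_subcat C Mod) r Ms T \<and>
     (\<forall>l. is_limit r l \<longrightarrow>
        colimit (full_subcat C Mod) (Restr r (underS r l)) Ms T (Ms l) (\<lambda>i. T i l))"

lemma diagram_sub:
  assumes "diagram K r D T" "q \<subseteq> r"
  shows "diagram K q D T"
proof -
  have "Field q \<subseteq> Field r" using assms(2) by (auto simp: Field_def)
  then show ?thesis using assms unfolding diagram_def by blast
qed

text \<open>The segment from \<open>j\<close> to \<open>d\<close> makes \<open>j\<close> the least
  point, whatever it was in \<open>r\<close>. Above \<open>j\<close>, successors and limits of the
  segment are those of \<open>r\<close>, so continuity and the position of the sequence in the chain
  are inherited.\<close>

lemma continuous_chain_segment:
  assumes wo: "Well_order r" and ch: "continuous_chain r Ms T" and jd: "(j, d) \<in> r"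
  defines "q \<equiv> Restr r {i. (j, i) \<in> r \<and> (i, d) \<in> r}"
  shows "continuous_chain q Ms T" "Well_order q" "Field q = {i. (j, i) \<in> r \<and> (i, d) \<in> r}"
    "is_least q j" "\<And>i k. is_succ q i k \<Longrightarrow> is_succ r i k"
proof -
  have jF: "j \<in> Field r" using jd by (auto simp: Field_def)
  show Fq: "Field q = {i. (j, i) \<in> r \<and> (i, d) \<in> r}"
    unfolding q_def by (rule Field_Restr_subset[OF Well_orderD(1)[OF wo]]) (auto simp: Field_def)
  show woq: "Well_order q" unfolding q_def by (rule Well_order_Restr[OF wo])
  have qr: "q \<subseteq> r" by (auto simp: q_def)
  show least: "is_least q j"
    using Fq jd wo_refl[OF wo jF] by (auto simp: is_least_def q_def)
  show "is_succ r i k" if s: "is_succ q i k" for i k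
    unfolding is_succ_def
  proof (intro conjI allI impI)
    have ik: "(i, k) \<in> q" "i \<noteq> k" using s by (auto simp: is_succ_def underS_def)
    then show "i \<in> underS r k" using qr by (auto simp: underS_def)
    fix k' assume k': "i \<in> underS r k'"
    have iF: "(j, i) \<in> r" "(i, d) \<in> r" "(k, d) \<in> r" "k \<in> Field r"
      using ik(1) by (auto simp: q_def Field_def)
    have ik': "(i, k') \<in> r" "i \<noteq> k'" using k' by (auto simp: underS_def)
    have k'F: "k' \<in> Field r" and dF: "d \<in> Field r" using ik'(1) jd by (auto simp: Field_def)
    show "(k, k') \<in> r"
    proof (cases "(k', d) \<in> r")
      case True
      then have "i \<in> underS q k'"
        using ik' iF wo_trans[OF wo iF(1) ik'(1)] by (auto simp: underS_def q_def)
      then show ?thesis using s qr by (auto simp: is_succ_def)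
    next
      case False
      then have "(d, k') \<in> r" using wo_cases[OF wo k'F dF] by (auto simp: underS_def)
      then show ?thesis using wo_trans[OF wo iF(3)] by blast
    qed
  qed
  show "continuous_chain q Ms T" unfolding continuous_chain_def
  proof (intro conjI allI impI)
    have D: "diagram (full_subcat C Mod) r Ms T" using ch by (simp add: continuous_chain_def)
    then show "diagram (full_subcat C Mod) q Ms T" using diagram_sub qr by blast
    fix l assume l: "is_limit q l"
    have lq: "(j, l) \<in> r" "(l, d) \<in> r" using l Fq by (auto simp: is_limit_def)
    have "l \<noteq> j" using l least by (auto simp: is_limit_def)
    then have jl: "j \<in> underS r l" using lq by (auto simp: underS_def)
    \<comment> \<open>An \<open>r\<close>-predecessor of \<open>l\<close> would be at least
      \<open>j\<close>, hence a predecessor inside \<open>q\<close>.\<close>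
    have "is_limit r l" unfolding is_limit_def
    proof (intro conjI notI)
      show "l \<in> Field r" using lq by (auto simp: Field_def)
      show False if "is_least r l" using jl is_least_underS[OF wo that] by blast
      show False if ex: "\<exists>i. is_succ r i l"
      proof -
        obtain i where i: "is_succ r i l" using ex by blast
        have ji: "(j, i) \<in> r" using jl is_succ_underS[OF wo i] by blast
        have il: "(i, l) \<in> r" "i \<noteq> l" using i by (auto simp: is_succ_def underS_def)
        have "is_succ q i l" unfolding is_succ_def
        proof (intro conjI allI impI)
          show "i \<in> underS q l"
            using il ji lq wo_trans[OF wo il(1) lq(2)] by (auto simp: underS_def q_def)
          fix k assume k: "i \<in> underS q k"
          then have "i \<in> underS r k" "k \<in> Field q" using qr by (auto simp: underS_def Field_def)
          then show "(l, k) \<in> q" using i Fq lq by (auto simp: is_succ_def q_def)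
        qed
        then show False using l by (auto simp: is_limit_def)
      qed
    qed
    then have col: "colimit (full_subcat C Mod) (Restr r (underS r l)) Ms T (Ms l) (\<lambda>i. T i l)"
      using ch by (simp add: continuous_chain_def)
    \<comment> \<open>Cutting off the points before \<open>j\<close> does not change the colimit at
      \<open>l\<close>.\<close>
    have "colimit (full_subcat C Mod)
        (Restr (Restr r (underS r l)) {i. (j, i) \<in> Restr r (underS r l)}) Ms T (Ms l) (\<lambda>i. T i l)"
      by (rule colimit_tail[OF category_Mod Well_order_Restr[OF wo] diagram_sub[OF D] col])
        (use jl Field_Restr_underS[OF wo] in auto)
    moreover have "Restr (Restr r (underS r l)) {i. (j, i) \<in> Restr r (underS r l)} =
        Restr q (underS q l)"
      using jl lq wo_trans[OF wo] by (auto simp: q_def underS_def)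
    ultimately show "colimit (full_subcat C Mod) (Restr q (underS q l)) Ms T (Ms l) (\<lambda>i. T i l)"
      by simp
  qed
qed

lemma chain_of_initial_segmentsD:
  assumes "chain_of_initial_segments \<nu> bs N Ms T m"
  shows "N \<in> Mod" "continuous_chain \<nu> Ms T" "cocone C \<nu> Ms T N m"
    "\<And>i j. is_succ \<nu> i j \<Longrightarrow> factors_through C (bs i) (m j)"
    "\<And>i. i \<in> Field \<nu> \<Longrightarrow> arrow_into (bs i) N"
  using assms unfolding chain_of_initial_segments_def continuous_chain_def by simp_all

end

context simple_AECat
begin

section \<open>Local character along chains\<close>

text \<open>Local character in the form of one member \<open>m0\<close> of the club. The bound
  \<Upsilon> depends only on the domain \<open>A\<close>, so it can be fixed before the extension in
  which the arrow will live.\<close>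

definition local_character_at :: "'o \<Rightarrow> 'u rel \<Rightarrow> bool" where
  "local_character_at A \<Upsilon> \<longleftrightarrow> regular_cardinal \<Omega> \<Upsilon> \<and>
     (\<forall>\<kappa> N a M m. regular_cardinal \<Omega> \<kappa> \<longrightarrow> \<Upsilon> \<le>o \<kappa> \<longrightarrow> arrow_into a N \<longrightarrow> Dom a = A \<longrightarrow> extension M m N \<longrightarrow>
       (\<exists>m0. arrow_into m0 M \<and> presentable \<Omega> \<kappa> C (Dom m0) \<and> indep ind N a (m \<cdot> m0) m))"

lemma ex_local_character:
  assumes A: "A \<in> Obj C"
  obtains \<Upsilon> where "local_character_at A \<Upsilon>"
proof -
  obtain \<nu> where \<nu>: "regular_cardinal \<Omega> \<nu>" "presentable \<Omega> \<nu> C A"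
    using ex_presentable[OF inacc A] by blast
  obtain \<Upsilon> where \<Upsilon>: "regular_cardinal \<Omega> \<Upsilon>" and *: "\<forall>\<kappa>. regular_cardinal \<Omega> \<kappa> \<and> \<Upsilon> \<le>o \<kappa> \<longrightarrow>
      (\<forall>N a M m. arrow_into a N \<and> presentable \<Omega> \<nu> C (Dom a) \<and> extension M m N \<longrightarrow>
        (\<exists>F. club \<kappa> M F \<and> (\<forall>S \<in> F. \<forall>m0 \<in> S. indep ind N a (m \<cdot> m0) m)))"
    using simple_props(10)[unfolded Club_Local_Character_def, rule_format, OF \<nu>(1)]
    by (elim exE conjE)
  have "local_character_at A \<Upsilon>"
    unfolding local_character_at_def
  proof (intro conjI allI impI)
    show "regular_cardinal \<Omega> \<Upsilon>" by (fact \<Upsilon>)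
    fix \<kappa> N a M m
    assume \<kappa>: "regular_cardinal \<Omega> \<kappa>" "\<Upsilon> \<le>o \<kappa>" and a: "arrow_into a N" "Dom a = A"
      and m: "extension M m N"
    have "presentable \<Omega> \<nu> C (Dom a)" using a(2) \<nu>(2) by simp
    with * \<kappa> a(1) m obtain F where F: "club \<kappa> M F"
      "\<forall>S \<in> F. \<forall>m0 \<in> S. indep ind N a (m \<cdot> m0) m" by blast
    obtain S where S: "S \<in> F" "S \<in> SubMod \<kappa> M" using F(1) unfolding club_def by blast
    obtain m0 where m0: "m0 \<in> S" "presentable \<Omega> \<kappa> C (Dom m0)" "S \<in> Sub C M"
      using S(2) unfolding SubMod_def by blast
    show "\<exists>m0. arrow_into m0 M \<and> presentable \<Omega> \<kappa> C (Dom m0) \<and> indep ind N a (m \<cdot> m0) m"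
      using Sub_rep(1)[OF m0(3,1)] m0(2) F(2) S(1) m0(1) by blast
  qed
  then show thesis by (rule that)
qed

text \<open>A small submodel over which \<open>a\<close> is independent already embeds into an earlier member of the
  chain, by presentability.\<close>

lemma chain_local_character:
  assumes \<Upsilon>: "local_character_at (Dom a) \<Upsilon>" "\<Upsilon> \<le>o \<kappa>" and \<kappa>: "regular_cardinal \<Omega> \<kappa>"
    and wo: "Well_order r" and sm: "small \<Omega> (Field r)"
    and ch: "continuous_chain r Ms T" and coc: "cocone C r Ms T N m" and N: "N \<in> Mod"
    and \<delta>: "is_limit r \<delta>" and dir: "directed \<kappa> (Restr r (underS r \<delta>))" and a: "arrow_into a N"
  obtains j where "j \<in> underS r \<delta>" "indep ind N a (m j) (m \<delta>)"
proof -
  let ?P = "Restr r (underS r \<delta>)"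
  have FP: "Field ?P = underS r \<delta>" by (rule Field_Restr_underS[OF wo])
  have ne: "Field ?P \<noteq> {}"
    using directedD[OF dir empty_subsetI finite_less_regular[OF \<kappa> finite.emptyI]] by blast
  have smP: "small \<Omega> (Field ?P)" using small_subset[OF sm] FP underS_subset_Field by metis
  have D: "diagram (full_subcat C Mod) r Ms T" using ch by (simp add: continuous_chain_def)
  have DP: "diagram (full_subcat C Mod) ?P Ms T" by (rule diagram_sub[OF D]) blast
  have "colimit (full_subcat C Mod) ?P Ms T (Ms \<delta>) (\<lambda>i. T i \<delta>)"
    using ch \<delta> by (simp add: continuous_chain_def)
  then have col: "colimit C ?P Ms T (Ms \<delta>) (\<lambda>i. T i \<delta>)"
    by (rule colimit_Mod_C[OF Well_order_Restr[OF wo] ne smP DP])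
  have \<delta>F: "\<delta> \<in> Field r" using \<delta> by (simp add: is_limit_def)
  have mE: "extension (Ms i) (m i) N" if "i \<in> Field r" for i
    using coc D that N by (simp add: cocone_def extension_def diagram_Mod)
  note m\<delta> = mE[OF \<delta>F]
  obtain m0 where m0: "arrow_into m0 (Ms \<delta>)" "presentable \<Omega> \<kappa> C (Dom m0)"
    "indep ind N a (m \<delta> \<cdot> m0) (m \<delta>)"
    using \<Upsilon> \<kappa> a m\<delta> unfolding local_character_at_def by blast
  have "m0 \<in> Hom C (Dom m0) (Ms \<delta>)" using m0(1) by (simp add: arrow_into_def Hom_iff)
  then obtain i g where i: "i \<in> Field ?P" "g \<in> Hom C (Dom m0) (Ms i)" "T i \<delta> \<cdot> g = m0"
    using m0(2) dir smP DP col unfolding presentable_def diagram_Mod by blast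
  have iu: "i \<in> underS r \<delta>" using i(1) FP by simp
  then have i\<delta>: "(i, \<delta>) \<in> r" and iF: "i \<in> Field r" by (auto simp: underS_def Field_def)
  have TH: "T i \<delta> \<in> Hom C (Ms i) (Ms \<delta>)" using D i\<delta> by (simp add: diagram_def Hom_full)
  have mT: "m \<delta> \<cdot> T i \<delta> = m i" using coc i\<delta> by (simp add: cocone_def)
  have "factors_through C m0 (T i \<delta>)"
    using factors_throughI[of "T i \<delta>" g] TH i(2,3) by (auto simp: Hom_iff)
  then have 1: "factors_through C (m \<delta> \<cdot> m0) (m i)"
    using factors_through_ext[OF _ _ m\<delta>, of m0 "T i \<delta>"] TH mT by (simp add: arrow_into_def Hom_iff)
  have 2: "factors_through C (m i) (m \<delta>)"
    using factors_throughI[of "m \<delta>" "T i \<delta>"] TH mT extensionD[OF m\<delta>] by (simp add: Hom_iff)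
  \<comment> \<open>Base-Monotonicity raises the base from \<open>m0\<close> to \<open>m i\<close>,
    which lies between \<open>m0\<close> and \<open>m \<delta>\<close>.\<close>
  have "indep ind N a (m i) (m \<delta>)"
    by (rule indep_base_mono[OF m0(3) 1 2]) (use extensionD[OF mE[OF iF]] in simp)
  then show thesis using that iu by blast
qed

section \<open>Independence implies non-dividing\<close>

text \<open>\<open>N1\<close> contains a copy \<open>n\<close> of the model \<open>M\<close> with a
  realisation \<open>x\<close>, while \<open>b\<close> lives in \<open>N\<close> over
  \<open>M\<close>. Once \<open>N\<close>, \<open>N1\<close> and \<open>N2\<close> sit in one model
  with \<open>b\<close> and \<open>b'\<close> identified, the independence theorem gives a common
  realisation \<open>s\<close> of the type of \<open>a'\<close> over \<open>b'\<close> and of the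
  type of \<open>x\<close> over \<open>M\<close>. As \<open>s\<close> and \<open>x\<close> have the
  same type over \<open>M\<close>, \<open>N1\<close> can be embedded by \<open>S\<close> so that
  \<open>x\<close> lands on the image of \<open>s\<close>: the realisation is kept, and the larger
  model \<open>Mk\<close> is added by \<open>n'\<close>.\<close>

lemma consistent_step:
  assumes n: "extension M n N1" and t: "extension M0 t M" and x: "indep ind N1 x (n \<cdot> t) n"
    and gx: "gtp_eq [x, n \<cdot> t] N1 [a', c'] N2" and mi: "extension M mi N"
    and tau: "extension M tau Mk" and mk: "extension Mk mk N" "mk \<cdot> tau = mi"
    and b: "indep ind N b (mi \<cdot> t) mi" "gtp_eq [b, mi \<cdot> t] N [b', c'] N2"
    and a': "indep ind N2 a' c' b'"
  obtains N' n' S where "extension Mk n' N'" "extension N1 S N'" "n' \<cdot> tau = S \<cdot> n"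
    "indep ind N' (S \<cdot> x) (n' \<cdot> (tau \<cdot> t)) n'"
    "\<And>\<beta>. \<beta> \<in> Arr C \<Longrightarrow> Cod \<beta> = Mk \<Longrightarrow> b = mk \<cdot> \<beta> \<Longrightarrow>
      gtp_eq [S \<cdot> x, n' \<cdot> \<beta>, n' \<cdot> (tau \<cdot> t)] N' [a', b', c'] N2"
proof -
  note [simp] = extensionD(3-5)[OF n] extensionD(3-5)[OF t] extensionD(3-5)[OF mi]
    extensionD(3-5)[OF tau] extensionD(3-5)[OF mk(1)]
  have xa: "arrow_into x N1" and ba: "arrow_into b N" and a'a: "arrow_into a' N2"
    using indepD(1) x b(1) a' by auto
  have b'a: "arrow_into b' N2" and c'a: "arrow_into c' N2" using indepD(2,3)[OF a'] by auto
  note [simp] = arrow_intoD[OF xa] arrow_intoD[OF ba] arrow_intoD[OF a'a] arrow_intoD[OF b'a]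
    arrow_intoD[OF c'a]
  obtain N3 u v where uv: "extension N1 u N3" "extension N v N3" "u \<cdot> n = v \<cdot> mi"
    using amalgamate[OF n mi] .
  note [simp] = extensionD(3-5)[OF uv(1)] extensionD(3-5)[OF uv(2)]
  have mita: "arrow_into (mi \<cdot> t) N" by (simp add: arrow_into_def)
  \<comment> \<open>\<open>N2\<close> is joined to the amalgam so that \<open>b\<close> and
    \<open>b'\<close> get the same image, and so do the two copies \<open>mi \<cdot> t\<close> and
    \<open>c'\<close> of the base.\<close>
  have "gtp_eq [v \<cdot> b, v \<cdot> (mi \<cdot> t)] N3 [b', c'] N2"
    using gtp_trans[OF gtp_eq_sym[OF gtp_eq_ext[OF uv(2), of "[b, mi \<cdot> t]"]] b(2)] ba mita by simp
  then obtain N4 w y where wy: "extension N3 w N4" "extension N2 y N4"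
    "w \<cdot> (v \<cdot> b) = y \<cdot> b'" "w \<cdot> (v \<cdot> (mi \<cdot> t)) = y \<cdot> c'"
    by (rule gtp_eqE) auto
  note [simp] = extensionD(3-5)[OF wy(1)] extensionD(3-5)[OF wy(2)]
  define W where "W = w \<cdot> v"
  define U where "U = w \<cdot> u"
  have W: "extension N W N4" and U: "extension N1 U N4"
    unfolding W_def U_def using extension_comp uv wy by blast+
  note [simp] = extensionD(3-5)[OF W] extensionD(3-5)[OF U]
  have Un: "U \<cdot> n = W \<cdot> mi" using uv(3) by (simp add: U_def W_def comp_assoc)
  have Wb: "W \<cdot> b = y \<cdot> b'" using wy(3) by (simp add: W_def comp_assoc)
  have Wc: "W \<cdot> (mi \<cdot> t) = y \<cdot> c'" using wy(4) by (simp add: W_def comp_assoc)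
  have Uc: "U \<cdot> (n \<cdot> t) = y \<cdot> c'"
    using comp_assoc[of t n U] comp_assoc[of t mi W] Un Wc by simp
  have Dc: "Dom (y \<cdot> c') \<in> Mod"
    using arg_cong[OF Wc, of "\<lambda>f. Dom f"] extensionD(1)[OF t] by simp
  \<comment> \<open>The three independences that the independence theorem asks for, over the common
    base \<open>y \<cdot> c'\<close>: \<open>a'\<close> from \<open>b'\<close>, \<open>x\<close>
    from \<open>M\<close>, and \<open>b'\<close> from \<open>M\<close>.\<close>
  have i1: "indep ind N4 (y \<cdot> a') (y \<cdot> c') (y \<cdot> b')" by (rule indep_ext[OF a' wy(2)])
  have i2: "indep ind N4 (U \<cdot> x) (y \<cdot> c') (W \<cdot> mi)" using indep_ext[OF x U] Un Uc by simp
  have i3: "indep ind N4 (y \<cdot> b') (y \<cdot> c') (W \<cdot> mi)" using indep_ext[OF b(1) W] Wb Wc by simp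
  have g: "gtp_eq [y \<cdot> a', y \<cdot> c'] N4 [U \<cdot> x, y \<cdot> c'] N4"
  proof -
    have "gtp_eq [y \<cdot> a', y \<cdot> c'] N4 [a', c'] N2"
      using gtp_eq_sym[OF gtp_eq_ext[OF wy(2), of "[a', c']"]] a'a c'a by simp
    moreover have "gtp_eq [x, n \<cdot> t] N1 [U \<cdot> x, y \<cdot> c'] N4"
      using gtp_eq_ext[OF U, of "[x, n \<cdot> t]"] xa Uc by (simp add: arrow_into_def)
    ultimately show ?thesis using gtp_trans gtp_eq_sym[OF gx] by blast
  qed
  obtain N5 h s where h: "extension N4 h N5"
    and h1: "gtp_eq [s, h \<cdot> (y \<cdot> b'), h \<cdot> (y \<cdot> c')] N5 [h \<cdot> (y \<cdot> a'), h \<cdot> (y \<cdot> b'), h \<cdot> (y \<cdot> c')] N5"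
    and h2: "gtp_eq [s, h \<cdot> (W \<cdot> mi), h \<cdot> (y \<cdot> c')] N5 [h \<cdot> (U \<cdot> x), h \<cdot> (W \<cdot> mi), h \<cdot> (y \<cdot> c')] N5"
    and s: "indep ind N5 s (h \<cdot> (y \<cdot> c')) h"
    using indep_amalgamation[OF i1 i2 i3 Dc g] .
  note [simp] = extensionD(3-5)[OF h]
  have hU: "extension N1 (h \<cdot> U) N5" by (rule extension_comp[OF U h])
  have "gtp_eq [s, h \<cdot> (W \<cdot> mi)] N5 [x, n] N1"
  proof -
    have "gtp_eq [s, h \<cdot> (W \<cdot> mi)] N5 [h \<cdot> (U \<cdot> x), h \<cdot> (W \<cdot> mi)] N5"
      by (rule gtp_eq_subset[OF h2]) auto
    moreover have "gtp_eq [x, n] N1 [h \<cdot> (U \<cdot> x), h \<cdot> (W \<cdot> mi)] N5"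
      using gtp_eq_ext[OF hU, of "[x, n]"] xa Un by (simp add: arrow_into_def comp_assoc)
    ultimately show ?thesis using gtp_trans gtp_eq_sym by blast
  qed
  then obtain N' g' S where g': "extension N5 g' N'" "extension N1 S N'" "g' \<cdot> s = S \<cdot> x"
    "g' \<cdot> (h \<cdot> (W \<cdot> mi)) = S \<cdot> n"
    by (rule gtp_eqE) auto
  note [simp] = extensionD(3-5)[OF g'(1)] extensionD(3-5)[OF g'(2)]
  \<comment> \<open>\<open>Mk\<close> is sent along \<open>mk\<close> into \<open>N\<close> and from
    there onward, so that \<open>n'\<close> agrees with \<open>S \<cdot> n\<close> on
    \<open>M\<close> and any \<beta> representing \<open>b\<close> in \<open>Mk\<close> is sent to
    the image of \<open>b'\<close>.\<close>
  define n' where "n' = (g' \<cdot> h) \<cdot> (W \<cdot> mk)"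
  have n': "extension Mk n' N'"
    unfolding n'_def using extension_comp mk(1) W h g'(1) by blast
  note [simp] = extensionD(3-5)[OF n']
  have n'tau: "n' \<cdot> tau = S \<cdot> n"
  proof -
    have "n' \<cdot> tau = g' \<cdot> (h \<cdot> (W \<cdot> (mk \<cdot> tau)))" by (simp add: n'_def comp_assoc del: mk(2))
    then show ?thesis using mk(2) g'(4) by simp
  qed
  have n'c: "n' \<cdot> (tau \<cdot> t) = g' \<cdot> (h \<cdot> (y \<cdot> c'))"
  proof -
    have "n' \<cdot> (tau \<cdot> t) = (n' \<cdot> tau) \<cdot> t" by (simp add: comp_assoc)
    also have "\<dots> = (g' \<cdot> (h \<cdot> (W \<cdot> mi))) \<cdot> t" using n'tau g'(4) by simp
    also have "\<dots> = g' \<cdot> (h \<cdot> (W \<cdot> (mi \<cdot> t)))" by (simp add: comp_assoc)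
    finally show ?thesis using Wc by simp
  qed
  show thesis
  proof (rule that[OF n' g'(2) n'tau])
    have "indep ind N' (g' \<cdot> s) (g' \<cdot> (h \<cdot> (y \<cdot> c'))) (g' \<cdot> h)" by (rule indep_ext[OF s g'(1)])
    moreover have "factors_through C n' (g' \<cdot> h)"
      unfolding n'_def by (rule factors_throughI) simp_all
    ultimately show "indep ind N' (S \<cdot> x) (n' \<cdot> (tau \<cdot> t)) n'"
      using indep_mono_right n'c g'(3) by simp
    fix \<beta> assume \<beta>: "\<beta> \<in> Arr C" "Cod \<beta> = Mk" "b = mk \<cdot> \<beta>"
    have "n' \<cdot> \<beta> = g' \<cdot> (h \<cdot> (W \<cdot> (mk \<cdot> \<beta>)))" using \<beta>(1,2) by (simp add: n'_def comp_assoc)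
    then have n'b: "n' \<cdot> \<beta> = g' \<cdot> (h \<cdot> (y \<cdot> b'))" using Wb \<beta>(3) by simp
    have "arrow_into s N5" using indepD(1)[OF s] .
    then have "gtp_eq [s, h \<cdot> (y \<cdot> b'), h \<cdot> (y \<cdot> c')] N5 [S \<cdot> x, n' \<cdot> \<beta>, n' \<cdot> (tau \<cdot> t)] N'"
      using gtp_eq_ext[OF g'(1), of "[s, h \<cdot> (y \<cdot> b'), h \<cdot> (y \<cdot> c')]"] n'b n'c g'(3)
      by (simp add: arrow_into_def)
    moreover have "gtp_eq [a', b', c'] N2 [h \<cdot> (y \<cdot> a'), h \<cdot> (y \<cdot> b'), h \<cdot> (y \<cdot> c')] N5"
      using gtp_eq_ext[OF extension_comp[OF wy(2) h], of "[a', b', c']"] a'a b'a c'a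
      by (simp add: comp_assoc)
    ultimately show "gtp_eq [S \<cdot> x, n' \<cdot> \<beta>, n' \<cdot> (tau \<cdot> t)] N' [a', b', c'] N2"
      using gtp_trans gtp_eq_sym h1 by blast
  qed
qed

text \<open>A stage at \<open>i\<close> is a model with an embedding of \<open>Ms i\<close> and an
  arrow independent from it over \<open>Ms z\<close>. Transition arrows carry this arrow to itself,
  so a single realisation is seen in larger and larger models. Its type over the base is kept in the
  stage to feed the next use of the independence theorem; its type together with \<open>bs i\<close>
  is settled once, at the successor of \<open>i\<close>, and transported from there.\<close>

lemma consistent_chain:
  fixes q :: "'u rel"
  assumes wo: "Well_order q" and sm: "small \<Omega> (Field q)" and ch: "continuous_chain q Ms T"
    and coc: "cocone C q Ms T N m" and N: "N \<in> Mod" and z: "is_least q z"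
    and bm: "\<And>i k. is_succ q i k \<Longrightarrow> factors_through C (bs i) (m k)"
    and ind_b: "\<And>i. i \<in> Field q \<Longrightarrow> indep ind N (bs i) (m z) (m i)"
    and gtp_b: "\<And>i. i \<in> Field q \<Longrightarrow> gtp_eq [bs i, m z] N [b', e] N2"
    and e: "extension (Ms z) e N2" and a': "indep ind N2 a' e b'"
    and l: "l \<in> Field q"
  obtains N' g x where "extension N g N'" "arrow_into x N'"
    "\<forall>i \<in> underS q l. gtp_eq [x, g \<cdot> bs i, g \<cdot> m z] N' [a', b', e] N2"
proof -
  have D: "diagram (full_subcat C Mod) q Ms T" using ch by (simp add: continuous_chain_def)
  then have DC: "diagram C q Ms T" and MM: "\<And>i. i \<in> Field q \<Longrightarrow> Ms i \<in> Mod"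
    by (auto simp: diagram_Mod)
  have zF: "z \<in> Field q" and zl: "\<And>i. i \<in> Field q \<Longrightarrow> (z, i) \<in> q" using z by (auto simp: is_least_def)
  have FieldI: "i \<in> Field q" "j \<in> Field q" if "(i, j) \<in> q" for i j
    using that by (auto simp: Field_def)
  have TE: "extension (Ms i) (T i j) (Ms j)" if "(i, j) \<in> q" for i j
    using DC MM FieldI[OF that] that by (simp add: diagram_def extension_def)
  have TT: "T j k \<cdot> T i j = T i k" if "(i, j) \<in> q" "(j, k) \<in> q" for i j k
    using DC that by (simp add: diagram_def)
  have mE: "extension (Ms i) (m i) N" if "i \<in> Field q" for i
    using coc MM N that by (simp add: cocone_def extension_def)
  have mT: "m j \<cdot> T i j = m i" if "(i, j) \<in> q" for i j
    using coc that by (simp add: cocone_def)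
  define St where "St i s \<longleftrightarrow> extension (Ms i) (fst (snd s)) (fst s) \<and>
      indep ind (fst s) (snd (snd s)) (fst (snd s) \<cdot> T z i) (fst (snd s)) \<and>
      gtp_eq [snd (snd s), fst (snd s) \<cdot> T z i] (fst s) [a', e] N2" for i and s :: "'o \<times> 'a \<times> 'a"
  \<comment> \<open>The extension and typing facts are repeated here because the composition laws
    must follow without reference to \<open>St\<close>.\<close>
  define Mor where "Mor i j s s' S \<longleftrightarrow> (i, j) \<in> q \<and> extension (fst s) S (fst s') \<and>
      extension (Ms i) (fst (snd s)) (fst s) \<and> extension (Ms j) (fst (snd s')) (fst s') \<and>
      arrow_into (snd (snd s)) (fst s) \<and>
      fst (snd s') \<cdot> T i j = S \<cdot> fst (snd s) \<and> snd (snd s') = S \<cdot> snd (snd s)"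
    for i j and s s' :: "'o \<times> 'a \<times> 'a" and S
  \<comment> \<open>\<beta> stands for a factorisation of \<open>bs i\<close> through the model at
    \<open>k\<close>; quantifying over it avoids choosing one during the recursion.\<close>
  define R where "R i k s s' S \<longleftrightarrow> (\<forall>\<beta>. \<beta> \<in> Arr C \<longrightarrow> Cod \<beta> = Ms k \<longrightarrow> bs i = m k \<cdot> \<beta> \<longrightarrow>
      gtp_eq [snd (snd s'), fst (snd s') \<cdot> \<beta>, fst (snd s') \<cdot> T z k] (fst s') [a', b', e] N2)"
    for i k and s s' :: "'o \<times> 'a \<times> 'a" and S :: 'a
  obtain X S where sys: "chain_system q St Mor (\<lambda>s. Id C (fst s)) (Comp C) X S"
    and RS: "\<forall>i k. is_succ q i k \<longrightarrow> R i k (X i) (X k) (S i k)"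
  proof (rule transfinite_chain[OF wo, where St = St and Mor = Mor and R = R
        and ide = "\<lambda>s. Id C (fst s)" and cmp = "Comp C" and L = "\<lambda>_ _ _ _ _. True"])
    fix i s assume i: "i \<in> Field q" and s: "St i s"
    have "T i i = Id C (Ms i)" using DC i by (simp add: diagram_def)
    then show "Mor i i s s (Id C (fst s))"
      using s wo_refl[OF wo i] indepD(1)[of "fst s"] extensionD[of "Ms i" "fst (snd s)" "fst s"]
      by (auto simp: St_def Mor_def extension_Id arrow_into_def)
  next
    fix i j k s t u f g assume ij: "(i, j) \<in> q" and jk: "(j, k) \<in> q" and f: "Mor i j s t f"
      and g: "Mor j k t u g"
    note f' = f[unfolded Mor_def] and g' = g[unfolded Mor_def]
    have "fst (snd u) \<cdot> T i k = (fst (snd u) \<cdot> T j k) \<cdot> T i j"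
      using pre_assoc[OF extension_arrow_into[OF TE[OF jk]], of "fst (snd u)" "fst u" "T i j"]
        TT[OF ij jk] g' extensionD[OF TE[OF jk]] extensionD[OF TE[OF ij]] by simp
    also have "\<dots> = (g \<cdot> fst (snd t)) \<cdot> T i j" using g' by simp
    also have "\<dots> = g \<cdot> (f \<cdot> fst (snd s))"
      using pre_assoc[OF extension_arrow_into, of "Ms j" "fst (snd t)" "fst t" g "fst u" "T i j"]
        f' g' extensionD[OF TE[OF ij]] extensionD(4)[of "Ms j" "fst (snd t)" "fst t"] by simp
    also have "\<dots> = (g \<cdot> f) \<cdot> fst (snd s)"
      using ext_assoc[OF extension_arrow_into[of "Ms i"], of "fst (snd s)" "fst s" f "fst t" g "fst u"]
        f' g' by simp
    finally show "Mor i k s u (g \<cdot> f)"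
      using f' g' wo_trans[OF wo ij jk] extension_comp[of "fst s" f "fst t" g "fst u"]
        ext_assoc[of "snd (snd s)" "fst s" f "fst t" g "fst u"]
      unfolding Mor_def by simp
  next
    fix i j k l s t u v f g h assume "Mor i j s t f" "Mor j k t u g" "Mor k l u v h"
    then show "(h \<cdot> g) \<cdot> f = h \<cdot> (g \<cdot> f)"
      unfolding Mor_def by (intro comp_assoc) (auto simp: extension_def Hom_iff)
  next
    fix i j s t f assume "Mor i j s t f"
    then show "Id C (fst t) \<cdot> f = f" "f \<cdot> Id C (fst s) = f"
      unfolding Mor_def by (auto simp: extension_def Hom_iff)
  next
    fix y assume "is_least q y"
    then have y: "y = z" using z wo_antisym[OF wo] by (auto simp: is_least_def)
    have "T z z = Id C (Ms z)" using DC zF by (simp add: diagram_def)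
    then have ez: "e \<cdot> T z z = e" using extensionD[OF e] by simp
    \<comment> \<open>The chain starts with \<open>N2\<close> itself: the first model is the base,
      and \<open>a'\<close> is independent from it over itself by Existence.\<close>
    have "indep ind N2 a' e e"
      using indep_existence[OF indepD(1)[OF a'] extension_arrow_into[OF e]]
        dom_in_subobj[OF extension_arrow_into[OF e]] extensionD[OF e] by simp
    moreover have "gtp_eq [a', e] N2 [a', e] N2"
      by (rule gtp_eqI[OF extension_Id extension_Id])
        (use extensionD(2)[OF e] indepD(1)[OF a'] extension_arrow_into[OF e] in simp_all)
    ultimately have "St y (N2, e, a')" using e ez y by (simp add: St_def)
    then show "\<exists>s. St y s" by blast
  next
    fix i k s assume ik: "is_succ q i k" and s: "St i s"
    note s' = s[unfolded St_def]
    have iq: "(i, k) \<in> q" and F: "i \<in> Field q" "k \<in> Field q" using is_succD(2,4,5)[OF ik] by auto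
    have b1: "indep ind N (bs i) (m i \<cdot> T z i) (m i)"
      using ind_b[OF F(1)] mT[OF zl[OF F(1)]] by simp
    have b2: "gtp_eq [bs i, m i \<cdot> T z i] N [b', e] N2"
      using gtp_b[OF F(1)] mT[OF zl[OF F(1)]] by simp
    obtain N' n' S where st: "extension (Ms k) n' N'" "extension (fst s) S N'"
      "n' \<cdot> T i k = S \<cdot> fst (snd s)"
      "indep ind N' (S \<cdot> snd (snd s)) (n' \<cdot> (T i k \<cdot> T z i)) n'"
      "\<And>\<beta>. \<beta> \<in> Arr C \<Longrightarrow> Cod \<beta> = Ms k \<Longrightarrow> bs i = m k \<cdot> \<beta> \<Longrightarrow>
        gtp_eq [S \<cdot> snd (snd s), n' \<cdot> \<beta>, n' \<cdot> (T i k \<cdot> T z i)] N' [a', b', e] N2"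
      by (rule consistent_step[OF _ TE[OF zl[OF F(1)]] _ _ mE[OF F(1)] TE[OF iq] mE[OF F(2)]
            mT[OF iq] b1 b2 a']) (use s' in blast)+
    have TT': "T i k \<cdot> T z i = T z k" using TT[OF zl[OF F(1)] iq] .
    have xa: "arrow_into (snd (snd s)) (fst s)" using s' indepD(1) by blast
    have "n' \<cdot> T z k = S \<cdot> (fst (snd s) \<cdot> T z i)"
    proof -
      have "n' \<cdot> T z k = (n' \<cdot> T i k) \<cdot> T z i"
        using pre_assoc[OF extension_arrow_into[OF TE[OF iq]] st(1), of "T z i"] TT'
          extensionD[OF TE[OF iq]] extensionD[OF TE[OF zl[OF F(1)]]] by simp
      also have "\<dots> = S \<cdot> (fst (snd s) \<cdot> T z i)"
        using pre_assoc[OF extension_arrow_into st(2), of "Ms i" "fst (snd s)" "T z i"] st(3) s'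
          extensionD[OF TE[OF zl[OF F(1)]]] extensionD(4)[of "Ms i" "fst (snd s)" "fst s"] by simp
      finally show ?thesis .
    qed
    moreover have "gtp_eq [snd (snd s), fst (snd s) \<cdot> T z i] (fst s)
        [S \<cdot> snd (snd s), S \<cdot> (fst (snd s) \<cdot> T z i)] N'"
      using gtp_eq_ext[OF st(2), of "[snd (snd s), fst (snd s) \<cdot> T z i]"] xa
        gtp_eqD(3)[of "[snd (snd s), fst (snd s) \<cdot> T z i]"] s' by auto
    ultimately have "gtp_eq [S \<cdot> snd (snd s), n' \<cdot> T z k] N' [a', e] N2"
      using gtp_trans gtp_eq_sym s' by metis
    then have "St k (N', n', S \<cdot> snd (snd s))" using st(1,4) TT' by (simp add: St_def)
    moreover have "Mor i k s (N', n', S \<cdot> snd (snd s)) S"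
      using st(1-3) s' iq xa by (simp add: Mor_def)
    moreover have "R i k s (N', n', S \<cdot> snd (snd s)) S"
      using st(5) TT' by (simp add: R_def)
    ultimately show "\<exists>t f. St k t \<and> Mor i k s t f \<and> R i k s t f" by blast
  next
    fix l X S assume l: "is_limit q l"
      and sys: "chain_system (Restr q (underS q l)) St Mor (\<lambda>s. Id C (fst s)) (Comp C) X S"
    let ?r = "Restr q (underS q l)"
    have Fr: "Field ?r = underS q l" using Field_Restr_underS[OF wo] .
    have wor: "Well_order ?r" using Well_order_Restr[OF wo] .
    have zr: "z \<in> underS q l" using is_least_limit_underS[OF wo z l] .
    then have ner: "Field ?r \<noteq> {}" using Fr by blast
    have smr: "small \<Omega> (Field ?r)" using small_subset[OF sm] Fr underS_subset_Field by metis
    have lF: "l \<in> Field q" using l by (simp add: is_limit_def)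
    have uF: "i \<in> Field q" "(i, l) \<in> q" if "i \<in> underS q l" for i
      using that by (auto simp: underS_def Field_def)
    have ur: "(i, j) \<in> ?r" if "(i, j) \<in> q" "j \<in> underS q l" for i j
      using that underS_trans[OF wo] by blast
    have StX: "St i (X i)" if "i \<in> underS q l" for i
      using sys that Fr by (simp add: chain_system_def)
    have MorX: "Mor i j (X i) (X j) (S i j)" if "(i, j) \<in> ?r" for i j
      using sys that by (simp add: chain_system_def)
    have DX: "diagram (full_subcat C Mod) ?r (\<lambda>i. fst (X i)) S"
    proof -
      have M: "fst (X i) \<in> Mod" if "i \<in> underS q l" for i
        using StX[OF that] extensionD(2) unfolding St_def by blast
      have 1: "\<forall>i\<in>Field ?r. fst (X i) \<in> Obj C \<and> S i i = Id C (fst (X i))"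
        using sys M Fr Mod_Obj by (simp add: chain_system_def)
      have 2: "\<forall>i j. (i, j) \<in> ?r \<longrightarrow> S i j \<in> Hom C (fst (X i)) (fst (X j))"
        using MorX unfolding Mor_def extension_def by blast
      have 3: "\<forall>i j k. (i, j) \<in> ?r \<longrightarrow> (j, k) \<in> ?r \<longrightarrow> S j k \<cdot> S i j = S i k"
        using sys unfolding chain_system_def by blast
      show ?thesis unfolding diagram_Mod
        using 1 2 3 M Fr by (simp add: diagram_def)
    qed
    obtain Nl \<kappa> where colN: "colimit (full_subcat C Mod) ?r (\<lambda>i. fst (X i)) S Nl \<kappa>"
      "colimit C ?r (\<lambda>i. fst (X i)) S Nl \<kappa>" "Nl \<in> Mod"
      by (rule ex_chain_colimit[OF wor ner smr DX])
    have \<kappa>E: "extension (fst (X i)) (\<kappa> i) Nl" if "i \<in> underS q l" for i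
      using colimit_cocone[OF colN(1)] that Fr by (simp add: cocone_def extension_def Hom_full)
    have \<kappa>S: "\<kappa> j \<cdot> S i j = \<kappa> i" if "(i, j) \<in> ?r" for i j
      using colimit_cocone[OF colN(2)] that by (simp add: cocone_def)
    have colM: "colimit (full_subcat C Mod) ?r Ms T (Ms l) (\<lambda>i. T i l)"
      using ch l by (simp add: continuous_chain_def)
    have Dr: "diagram (full_subcat C Mod) ?r Ms T" by (rule diagram_sub[OF D]) blast
    have colMC: "colimit C ?r Ms T (Ms l) (\<lambda>i. T i l)"
      by (rule colimit_Mod_C[OF wor ner smr Dr colM])
    let ?n = "\<lambda>i. fst (snd (X i))" and ?x = "\<lambda>i. snd (snd (X i))"
    have nE: "extension (Ms i) (?n i) (fst (X i))" if "i \<in> underS q l" for i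
      using StX[OF that] by (simp add: St_def)
    \<comment> \<open>By continuity \<open>Ms l\<close> is the colimit of the earlier models, so
      their embeddings into \<open>Nl\<close> combine to one arrow \<open>nl\<close>.\<close>
    have "cocone C ?r Ms T Nl (\<lambda>i. \<kappa> i \<cdot> ?n i)"
      unfolding cocone_def
    proof (intro conjI ballI allI impI)
      show "Nl \<in> Obj C" using colN(3) Mod_Obj by blast
      show "\<kappa> i \<cdot> ?n i \<in> Hom C (Ms i) Nl" if "i \<in> Field ?r" for i
        using extension_comp[OF nE \<kappa>E] that Fr by (simp add: extension_def)
      fix i j assume ij: "(i, j) \<in> ?r"
      have u: "i \<in> underS q l" "j \<in> underS q l" and ijq: "(i, j) \<in> q" using ij by auto
      have M: "?n j \<cdot> T i j = S i j \<cdot> ?n i" "extension (fst (X i)) (S i j) (fst (X j))"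
        using MorX[OF ij] by (auto simp: Mor_def)
      have "(\<kappa> j \<cdot> ?n j) \<cdot> T i j = \<kappa> j \<cdot> (?n j \<cdot> T i j)"
        using ext_assoc[OF extension_arrow_into[OF TE[OF ijq]] nE[OF u(2)] \<kappa>E[OF u(2)]] .
      also have "\<dots> = (\<kappa> j \<cdot> S i j) \<cdot> ?n i"
        using ext_assoc[OF extension_arrow_into[OF nE[OF u(1)]] M(2) \<kappa>E[OF u(2)]] M(1) by simp
      also have "\<dots> = \<kappa> i \<cdot> ?n i" using \<kappa>S[OF ij] by simp
      finally show "(\<kappa> j \<cdot> ?n j) \<cdot> T i j = \<kappa> i \<cdot> ?n i" .
    qed
    then obtain nl where nl: "nl \<in> Hom C (Ms l) Nl"
      "\<And>i. i \<in> Field ?r \<Longrightarrow> nl \<cdot> T i l = \<kappa> i \<cdot> ?n i"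
      using colimit_factor[OF colMC] by blast
    have nlE: "extension (Ms l) nl Nl" using nl(1) MM[OF lF] colN(3) by (simp add: extension_def)
    define xl where "xl = \<kappa> z \<cdot> ?x z"
    have xa: "arrow_into (?x i) (fst (X i))" if "i \<in> underS q l" for i
      using StX[OF that] indepD(1) by (auto simp: St_def)
    have xl: "xl = \<kappa> i \<cdot> ?x i" if i: "i \<in> underS q l" for i
    proof -
      have zi: "(z, i) \<in> ?r" using ur[OF zl[OF uF(1)[OF i]] i] .
      have M: "?x i = S z i \<cdot> ?x z" "extension (fst (X z)) (S z i) (fst (X i))"
        using MorX[OF zi] by (auto simp: Mor_def)
      have "\<kappa> i \<cdot> ?x i = (\<kappa> i \<cdot> S z i) \<cdot> ?x z"
        using ext_assoc[OF xa[OF zr] M(2) \<kappa>E[OF i]] M(1) by simp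
      then show ?thesis using \<kappa>S[OF zi] by (simp add: xl_def)
    qed
    have nlT: "nl \<cdot> T z l = \<kappa> i \<cdot> (?n i \<cdot> T z i)" if i: "i \<in> underS q l" for i
    proof -
      have "nl \<cdot> T z l = nl \<cdot> (T i l \<cdot> T z i)" using TT[OF zl[OF uF(1)[OF i]] uF(2)[OF i]] by simp
      also have "\<dots> = (nl \<cdot> T i l) \<cdot> T z i"
        using ext_assoc[OF extension_arrow_into[OF TE[OF zl[OF uF(1)[OF i]]]] TE[OF uF(2)[OF i]] nlE]
        by simp
      also have "\<dots> = \<kappa> i \<cdot> (?n i \<cdot> T z i)"
        using nl(2) i Fr ext_assoc[OF extension_arrow_into[OF TE[OF zl[OF uF(1)[OF i]]]] nE[OF i] \<kappa>E[OF i]]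
        by simp
      finally show ?thesis .
    qed
    have xla: "arrow_into xl Nl" using arrow_into_comp(1)[OF xa[OF zr] \<kappa>E[OF zr]] by (simp add: xl_def)
    \<comment> \<open>The one arrow \<open>xl\<close> is independent from every earlier model, hence
      from \<open>Ms l\<close> by Union.\<close>
    have indl: "indep ind Nl xl (nl \<cdot> T z l) nl"
    proof (rule indep_union[OF wor ner smr _ colMC])
      show "diagram C ?r Ms T" using Dr by (simp add: diagram_Mod)
      show "arrow_into nl Nl" "Dom nl = Ms l" using extension_arrow_into[OF nlE] extensionD[OF nlE] by auto
      show "arrow_into xl Nl" by (fact xla)
      show "arrow_into (nl \<cdot> T z l) Nl"
        using extension_arrow_into[OF extension_comp[OF TE[OF zl[OF lF]] nlE]] .
      show "Nl \<in> Mod" by (fact colN(3))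
      fix i assume "i \<in> Field ?r"
      then have i: "i \<in> underS q l" using Fr by simp
      have "indep ind (fst (X i)) (?x i) (?n i \<cdot> T z i) (?n i)" using StX[OF i] by (simp add: St_def)
      from indep_ext[OF this \<kappa>E[OF i]] show "indep ind Nl xl (nl \<cdot> T z l) (nl \<cdot> T i l)"
        using xl[OF i] nlT[OF i] nl(2) i Fr by simp
    qed
    \<comment> \<open>This type concerns only the base, so it is read off at the stage
      \<open>z\<close>.\<close>
    have gl: "gtp_eq [xl, nl \<cdot> T z l] Nl [a', e] N2"
    proof -
      have g: "gtp_eq [?x z, ?n z \<cdot> T z z] (fst (X z)) [a', e] N2" using StX[OF zr] by (simp add: St_def)
      have "gtp_eq [?x z, ?n z \<cdot> T z z] (fst (X z)) [xl, nl \<cdot> T z l] Nl"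
        using gtp_eq_ext[OF \<kappa>E[OF zr], of "[?x z, ?n z \<cdot> T z z]"] gtp_eqD(3)[OF g] nlT[OF zr]
        by (auto simp: xl_def)
      then show ?thesis using gtp_trans[OF gtp_eq_sym g] by blast
    qed
    have "St l (Nl, nl, xl)" using nlE indl gl by (simp add: St_def)
    moreover have "Mor i l (X i) (Nl, nl, xl) (\<kappa> i)" if "i \<in> underS q l" for i
      using \<kappa>E[OF that] nE[OF that] nlE xa[OF that] nl(2) that Fr xl[OF that] uF(2)[OF that]
      by (simp add: Mor_def)
    ultimately show "\<exists>s \<kappa>. St l s \<and> (\<forall>i\<in>underS q l. Mor i l (X i) s (\<kappa> i)) \<and>
        (\<forall>i j. (i, j) \<in> q \<longrightarrow> j \<in> underS q l \<longrightarrow> \<kappa> j \<cdot> S i j = \<kappa> i) \<and> True"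
      using \<kappa>S ur by blast
  qed (rule TrueI, blast)
  let ?N = "fst (X l)" and ?n = "\<lambda>i. fst (snd (X i))" and ?x = "\<lambda>i. snd (snd (X i))"
  have Stl: "St i (X i)" if "i \<in> Field q" for i using sys that by (simp add: chain_system_def)
  have nE: "extension (Ms i) (?n i) (fst (X i))" if "i \<in> Field q" for i
    using Stl[OF that] by (simp add: St_def)
  \<comment> \<open>The last stage contains only \<open>Ms l\<close>; amalgamating it with
    \<open>N\<close> over \<open>Ms l\<close> brings the realisation into an extension of
    \<open>N\<close>, where the sequence lives.\<close>
  obtain N' g u where am: "extension N g N'" "extension ?N u N'" "g \<cdot> m l = u \<cdot> ?n l"
    using amalgamate[OF mE[OF l] nE[OF l]] .
  show thesis
  proof (rule that[OF am(1), of "u \<cdot> ?x l", OF _ ballI])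
    have "arrow_into (?x l) ?N" using Stl[OF l] indepD(1) by (auto simp: St_def)
    then show "arrow_into (u \<cdot> ?x l) N'" using arrow_into_comp(1) am(2) by blast
    fix i assume i: "i \<in> underS q l"
    \<comment> \<open>\<open>bs i\<close> lies in the model at the successor \<open>k\<close> of
      \<open>i\<close>, and \<open>k\<close> is still at most \<open>l\<close>.\<close>
    obtain k where k: "is_succ q i k" "(k, l) \<in> q" using ex_is_succ[OF wo i] .
    have kF: "k \<in> Field q" using FieldI(1)[OF k(2)] .
    obtain \<beta> where \<beta>: "\<beta> \<in> Arr C" "Cod \<beta> = Dom (m k)" "bs i = m k \<cdot> \<beta>"
      using factors_throughE[OF bm[OF k(1)]] by metis
    have \<beta>2: "Cod \<beta> = Ms k" using \<beta>(2) extensionD[OF mE[OF kF]] by simp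
    have g: "gtp_eq [?x k, ?n k \<cdot> \<beta>, ?n k \<cdot> T z k] (fst (X k)) [a', b', e] N2"
      using RS[rule_format, OF k(1)] \<beta>(1,3) \<beta>2 by (simp add: R_def)
    have M: "extension (fst (X k)) (S k l) ?N" "?n l \<cdot> T k l = S k l \<cdot> ?n k" "?x l = S k l \<cdot> ?x k"
      using sys k(2) by (auto simp: chain_system_def Mor_def)
    have uS: "extension (fst (X k)) (u \<cdot> S k l) N'" by (rule extension_comp[OF M(1) am(2)])
    note H = extensionD(3-5)[OF nE[OF kF]] extensionD(3-5)[OF nE[OF l]] extensionD(3-5)[OF M(1)]
      extensionD(3-5)[OF am(1)] extensionD(3-5)[OF am(2)] extensionD(3-5)[OF mE[OF kF]]
      extensionD(3-5)[OF mE[OF l]] extensionD(3-5)[OF TE[OF k(2)]] \<beta>(1) \<beta>2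
    have gm: "g \<cdot> m k = (u \<cdot> S k l) \<cdot> ?n k"
    proof -
      have "g \<cdot> m k = (g \<cdot> m l) \<cdot> T k l" using mT[OF k(2)] H by (simp add: comp_assoc)
      also have "\<dots> = u \<cdot> (?n l \<cdot> T k l)" using am(3) H by (simp add: comp_assoc)
      also have "\<dots> = (u \<cdot> S k l) \<cdot> ?n k" using M(2) H by (simp add: comp_assoc)
      finally show ?thesis .
    qed
    have "g \<cdot> bs i = (g \<cdot> m k) \<cdot> \<beta>" using \<beta>(3) H by (simp add: comp_assoc)
    also have "\<dots> = (u \<cdot> S k l) \<cdot> (?n k \<cdot> \<beta>)" using gm H by (simp add: comp_assoc)
    finally have 1: "g \<cdot> bs i = (u \<cdot> S k l) \<cdot> (?n k \<cdot> \<beta>)" .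
    note H2 = extensionD(3-5)[OF TE[OF zl[OF kF]]]
    have "g \<cdot> m z = (g \<cdot> m k) \<cdot> T z k" using mT[OF zl[OF kF]] H H2 by (simp add: comp_assoc)
    also have "\<dots> = (u \<cdot> S k l) \<cdot> (?n k \<cdot> T z k)" using gm H H2 by (simp add: comp_assoc)
    finally have 2: "g \<cdot> m z = (u \<cdot> S k l) \<cdot> (?n k \<cdot> T z k)" .
    have xk: "arrow_into (?x k) (fst (X k))" using gtp_eqD(3)[OF g] by simp
    have 3: "u \<cdot> ?x l = (u \<cdot> S k l) \<cdot> ?x k"
      using M(3) ext_assoc[OF xk M(1) am(2)] by simp
    have "gtp_eq [?x k, ?n k \<cdot> \<beta>, ?n k \<cdot> T z k] (fst (X k)) [u \<cdot> ?x l, g \<cdot> bs i, g \<cdot> m z] N'"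
      using gtp_eq_ext[OF uS, of "[?x k, ?n k \<cdot> \<beta>, ?n k \<cdot> T z k]"] gtp_eqD(3)[OF g] 1 2 3
      by simp
    then show "gtp_eq [u \<cdot> ?x l, g \<cdot> bs i, g \<cdot> m z] N' [a', b', e] N2"
      using gtp_trans[OF gtp_eq_sym g] by blast
  qed
qed

proposition indep_not_isi_divides:
  assumes ab: "indep ind M a c b"
  shows "\<not> isi_divides a b c M"
proof
  assume "isi_divides a b c M"
  then obtain \<mu> where \<mu>: "regular_cardinal \<Omega> \<mu>" and
    div: "\<forall>\<nu>. regular_cardinal \<Omega> \<nu> \<and> \<mu> \<le>o \<nu> \<longrightarrow>
         (\<exists>N f bs \<kappa>. extension M f N \<and> isi_sequence \<nu> bs (f \<cdot> c) N \<and>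
           (\<forall>i \<in> Field \<nu>. gtp_eq [bs i, f \<cdot> c] N [b, c] M) \<and>
           regular_cardinal \<Omega> \<kappa> \<and> \<kappa> <o \<nu> \<and>
           (\<forall>I \<subseteq> Field \<nu>. |I| =o \<kappa> \<longrightarrow> \<not> consistent a b c M I bs f N))"
    unfolding isi_divides_def by (elim exE conjE)
  have aM: "arrow_into a M" and cM: "arrow_into c M" and bM: "arrow_into b M"
    using indepD[OF ab] by auto
  have "Dom b \<in> Obj C" using arrow_intoD(1)[OF bM] Arr_Obj(1) by blast
  then obtain \<Upsilon> where lc: "local_character_at (Dom b) \<Upsilon>" by (rule ex_local_character)
  then have \<Upsilon>: "regular_cardinal \<Omega> \<Upsilon>" by (simp add: local_character_at_def)
  \<comment> \<open>Above \<mu>, so that dividing supplies a sequence, and above \<Upsilon>, to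
    leave room for the point \<delta> at which local character is applied.\<close>
  obtain \<nu> where \<nu>: "regular_cardinal \<Omega> \<nu>" "\<Upsilon> <o \<nu>" "\<mu> <o \<nu>"
    using regular_cardinal_above[OF inacc \<Upsilon> \<mu>] .
  note wo = regular_cardinalD(2)[OF \<nu>(1)]
  obtain N f bs \<kappa>' where f: "extension M f N" and isi: "isi_sequence \<nu> bs (f \<cdot> c) N"
    and bs: "\<forall>i \<in> Field \<nu>. gtp_eq [bs i, f \<cdot> c] N [b, c] M"
    and \<kappa>': "regular_cardinal \<Omega> \<kappa>'" "\<kappa>' <o \<nu>"
    and incons: "\<forall>I \<subseteq> Field \<nu>. |I| =o \<kappa>' \<longrightarrow> \<not> consistent a b c M I bs f N"
    using div[rule_format, OF conjI, OF \<nu>(1) ordLess_imp_ordLeq[OF \<nu>(3)]] by (elim exE conjE)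
  obtain Ms T m where seg: "chain_of_initial_segments \<nu> bs N Ms T m"
    and cm: "\<And>z. is_least \<nu> z \<Longrightarrow> factors_through C (f \<cdot> c) (m z)"
    and gm: "\<And>i j. (i, j) \<in> \<nu> \<Longrightarrow> gtp_eq [bs i, m i] N [bs j, m i] N"
    using isi unfolding isi_sequence_def by blast
  note seg' = chain_of_initial_segmentsD[OF seg]
  have D: "diagram C \<nu> Ms T" and MM: "\<And>i. i \<in> Field \<nu> \<Longrightarrow> Ms i \<in> Mod"
    using seg'(2) by (auto simp: continuous_chain_def diagram_Mod)
  have mE: "extension (Ms i) (m i) N" if "i \<in> Field \<nu>" for i
    using seg'(1,3) MM that by (simp add: cocone_def extension_def)
  have mT: "m j \<cdot> T i j = m i" if "(i, j) \<in> \<nu>" for i j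
    using seg'(3) that by (simp add: cocone_def)
  have TH: "T i j \<in> Arr C" "Dom (T i j) = Ms i" "Cod (T i j) = Ms j" if "(i, j) \<in> \<nu>" for i j
    using D that by (auto simp: diagram_def Hom_iff)
  have mm: "factors_through C (m i) (m j)" if ij: "(i, j) \<in> \<nu>" for i j
  proof -
    have "j \<in> Field \<nu>" using ij by (auto simp: Field_def)
    then show ?thesis
      using factors_throughI[of "m j" "T i j"] TH[OF ij] mT[OF ij] extensionD[OF mE] by simp
  qed
  \<comment> \<open>At least \<Upsilon> for local character below \<delta>, and at least
    \<open>\<kappa>'\<close> so that enough indices remain above \<open>j\<close>.\<close>
  obtain \<kappa> where \<kappa>: "regular_cardinal \<Omega> \<kappa>" "\<Upsilon> \<le>o \<kappa>" "\<kappa>' \<le>o \<kappa>" "\<kappa> = \<Upsilon> \<or> \<kappa> = \<kappa>'"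
    using regular_cardinal_max[OF \<Upsilon> \<kappa>'(1)] .
  have \<kappa>\<nu>: "\<kappa> <o \<nu>" using \<kappa>(4) \<nu>(2) \<kappa>'(2) by blast
  obtain I0 where I0: "I0 \<subseteq> Field \<nu>" "|I0| =o \<kappa>"
    using ex_subset_of_cardinal[OF \<kappa>(1) \<nu>(1) \<kappa>\<nu>] .
  obtain \<delta> where \<delta>: "is_limit \<nu> \<delta>" "directed \<kappa> (Restr \<nu> (underS \<nu> \<delta>))"
    and tail: "\<forall>j \<in> underS \<nu> \<delta>. \<kappa> \<le>o |{i \<in> I0 \<inter> underS \<nu> \<delta>. (j, i) \<in> \<nu>}|"
    using ex_directed_initial_segment[OF \<kappa>(1) \<nu>(1) \<kappa>\<nu> I0] .
  have \<delta>F: "\<delta> \<in> Field \<nu>" using \<delta>(1) by (simp add: is_limit_def)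
  have "Dom (bs \<delta>) = Dom b" using gtp_eqD(5)[OF bs[rule_format, OF \<delta>F]] by simp
  then have lc': "local_character_at (Dom (bs \<delta>)) \<Upsilon>" using lc by simp
  obtain j where j: "j \<in> underS \<nu> \<delta>" "indep ind N (bs \<delta>) (m j) (m \<delta>)"
    using chain_local_character[OF lc' \<kappa>(2,1) wo regular_cardinal_small[OF \<nu>(1)] seg'(2,3,1) \<delta>
        seg'(5)[OF \<delta>F]] .
  have j\<delta>: "(j, \<delta>) \<in> \<nu>" using j(1) by (simp add: underS_def)
  then have jF: "j \<in> Field \<nu>" by (auto simp: Field_def)
  define q where "q = Restr \<nu> {i. (j, i) \<in> \<nu> \<and> (i, \<delta>) \<in> \<nu>}"
  note q = continuous_chain_segment[OF wo seg'(2) j\<delta>, folded q_def]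
  have FqF: "Field q \<subseteq> Field \<nu>" unfolding q(3) by (auto simp: Field_def)
  have q\<nu>: "q \<subseteq> \<nu>" by (auto simp: q_def)
  \<comment> \<open>\<open>bs \<delta>\<close> and \<open>bs i\<close> have the same type over
    \<open>m i\<close>, through which \<open>m j\<close> factors; so the independence found at
    \<delta> holds at every index from \<open>j\<close> to \<delta>.\<close>
  have indq: "indep ind N (bs i) (m j) (m i)" if i: "i \<in> Field q" for i
  proof -
    have ji: "(j, i) \<in> \<nu>" "(i, \<delta>) \<in> \<nu>" using i q(3) by auto
    have iF: "i \<in> Field \<nu>" using i FqF by blast
    have 1: "indep ind N (bs \<delta>) (m j) (m i)" using indep_mono_right[OF j(2) mm[OF ji(2)]] .
    have "gtp_eq [m i, bs \<delta>] N [m i, bs i] N"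
      using gtp_eq_permute3(3)[OF gtp_eq_sym[OF gm[OF ji(2)]]] .
    from gtp_eq_comp[OF this, of "T j i"]
    have "gtp_eq [m j, m i, bs \<delta>] N [m j, m i, bs i] N"
      using TH[OF ji(1)] extensionD[OF mE[OF iF]] mT[OF ji(1)] by simp
    from gtp_eq_permute3(2)[OF this] show ?thesis using indep_gtp[OF 1] by blast
  qed
  have jM: "arrow_into (m j) N" using extension_arrow_into[OF mE[OF jF]] .
  have bj: "arrow_into (bs j) N" using seg'(5)[OF jF] .
  \<comment> \<open>\<open>M\<close> and \<open>N\<close> are placed in one model where
    \<open>b\<close> becomes \<open>bs j\<close>. Extension then gives a realisation independent
    from all of \<open>N1\<close>, in particular from the model \<open>m j\<close>.\<close>
  obtain N1 r1 p where N1: "extension N r1 N1" "extension M p N1" "r1 \<cdot> bs j = p \<cdot> b"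
    "r1 \<cdot> (f \<cdot> c) = p \<cdot> c"
    using bs[rule_format, OF jF] by (rule gtp_eqE) auto
  obtain N2 r a' where r: "extension N1 r N2"
    "gtp_eq [a', r \<cdot> (p \<cdot> b), r \<cdot> (p \<cdot> c)] N2 [p \<cdot> a, p \<cdot> b, p \<cdot> c] N1" "indep ind N2 a' (r \<cdot> (p \<cdot> c)) r"
    using indep_extension[OF indep_ext[OF ab N1(2)]] .
  define e where "e = r \<cdot> r1"
  have e: "extension N e N2" unfolding e_def by (rule extension_comp[OF N1(1) r(1)])
  have fc: "arrow_into (f \<cdot> c) N" using arrow_into_comp(1)[OF cM f] .
  have eb: "e \<cdot> bs j = r \<cdot> (p \<cdot> b)" using ext_assoc[OF bj N1(1) r(1)] N1(3) by (simp add: e_def)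
  have ec: "e \<cdot> (f \<cdot> c) = r \<cdot> (p \<cdot> c)" using ext_assoc[OF fc N1(1) r(1)] N1(4) by (simp add: e_def)
  have cj: "factors_through C (f \<cdot> c) (m j)"
  proof -
    obtain z where z: "z \<in> Field \<nu>" "\<And>i. i \<in> Field \<nu> \<Longrightarrow> (z, i) \<in> \<nu>"
      using wo_least_exists[OF wo subset_refl] jF by blast
    then have "is_least \<nu> z" by (simp add: is_least_def)
    from factors_through_trans[OF cm[OF this] mm[OF z(2)[OF jF]]] show ?thesis .
  qed
  have er: "factors_through C (e \<cdot> x) r" if x: "arrow_into x N" for x
  proof -
    have "e \<cdot> x = r \<cdot> (r1 \<cdot> x)" using ext_assoc[OF x N1(1) r(1)] by (simp add: e_def)
    then show ?thesis
      using factors_throughI[of r "r1 \<cdot> x"] arrow_into_comp(1)[OF x N1(1)] extensionD[OF r(1)]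
      by (simp add: arrow_into_def)
  qed
  have emE: "extension (Ms j) (e \<cdot> m j) N2" by (rule extension_comp[OF mE[OF jF] e])
  \<comment> \<open>The independence theorem will be used over a model: Base-Monotonicity raises
    \<open>c\<close> to \<open>m j\<close>, which lies below \<open>r\<close>.\<close>
  have "indep ind N2 a' (e \<cdot> m j) r"
    by (rule indep_base_mono[OF r(3)])
      (use factors_through_ext[OF cj jM e] ec er[OF jM] extensionD[OF emE] in auto)
  then have a': "indep ind N2 a' (e \<cdot> m j) (e \<cdot> bs j)" using indep_mono_right er[OF bj] by blast
  have gtpq: "gtp_eq [bs i, m j] N [e \<cdot> bs j, e \<cdot> m j] N2" if i: "i \<in> Field q" for i
  proof -
    have "(j, i) \<in> \<nu>" using i q(3) by auto
    from gtp_eq_sym[OF gm[OF this]] show ?thesis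
      using gtp_trans[OF _ gtp_eq_ext[OF e, of "[bs j, m j]"]] bj jM by simp
  qed
  have smq: "small \<Omega> (Field q)" by (rule small_subset[OF regular_cardinal_small[OF \<nu>(1)] FqF])
  have cocq: "cocone C q Ms T N m" using seg'(3) FqF q\<nu> unfolding cocone_def by blast
  have \<delta>q: "\<delta> \<in> Field q" using q(3) j\<delta> wo_refl[OF wo \<delta>F] by blast
  obtain N' g x where g: "extension N g N'" "arrow_into x N'"
    "\<forall>i \<in> underS q \<delta>. gtp_eq [x, g \<cdot> bs i, g \<cdot> m j] N' [a', e \<cdot> bs j, e \<cdot> m j] N2"
    using consistent_chain[OF q(2) smq q(1) cocq seg'(1) q(4) seg'(4)[OF q(5)] indq gtpq emE a' \<delta>q] .
  obtain \<gamma> where \<gamma>: "\<gamma> \<in> Arr C" "Cod \<gamma> = Dom (m j)" "f \<cdot> c = m j \<cdot> \<gamma>"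
    using factors_throughE[OF cj] by metis
  have final: "gtp_eq [x, g \<cdot> bs i, g \<cdot> (f \<cdot> c)] N' [a, b, c] M" if i: "i \<in> underS q \<delta>" for i
  proof -
    \<comment> \<open>\<open>f \<cdot> c\<close> factors through \<open>m j\<close> by \<gamma>, so
      the type over \<open>m j\<close> determines the type over \<open>f \<cdot> c\<close>;
      afterwards \<open>m j\<close> is dropped.\<close>
    have "gtp_eq [(g \<cdot> m j) \<cdot> \<gamma>, g \<cdot> m j, x, g \<cdot> bs i] N' [(e \<cdot> m j) \<cdot> \<gamma>, e \<cdot> m j, a', e \<cdot> bs j] N2"
      using gtp_eq_comp[OF gtp_eq_permute3(1)[OF g(3)[rule_format, OF i]] \<gamma>(1)] \<gamma>(2)
        arrow_into_comp(2)[OF jM g(1)] by simp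
    then have "gtp_eq [g \<cdot> (f \<cdot> c), g \<cdot> m j, x, g \<cdot> bs i] N' [e \<cdot> (f \<cdot> c), e \<cdot> m j, a', e \<cdot> bs j] N2"
      using pre_assoc[OF jM g(1) \<gamma>(1,2)] pre_assoc[OF jM e \<gamma>(1,2)] \<gamma>(3) by simp
    then have "gtp_eq [x, g \<cdot> bs i, g \<cdot> (f \<cdot> c)] N' [a', e \<cdot> bs j, e \<cdot> (f \<cdot> c)] N2"
      by (rule gtp_eq_subset) auto
    then have "gtp_eq [x, g \<cdot> bs i, g \<cdot> (f \<cdot> c)] N' [p \<cdot> a, p \<cdot> b, p \<cdot> c] N1"
      using gtp_trans r(2) eb ec by simp
    moreover have "gtp_eq [a, b, c] M [p \<cdot> a, p \<cdot> b, p \<cdot> c] N1"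
      using gtp_eq_ext[OF N1(2), of "[a, b, c]"] aM bM cM by simp
    ultimately show ?thesis using gtp_trans gtp_eq_sym by blast
  qed
  \<comment> \<open>The tail from \<open>j\<close> has at least \<kappa> indices, hence a subset of
    size \<open>\<kappa>'\<close>, and \<open>x\<close> realises the type at all of them at
    once.\<close>
  obtain I where I: "I \<subseteq> {i \<in> I0 \<inter> underS \<nu> \<delta>. (j, i) \<in> \<nu>}" "|I| =o \<kappa>'"
    using ex_subset_of_card[OF regular_cardinalD(1)[OF \<kappa>'(1)] ordLeq_transitive[OF \<kappa>(3) tail[rule_format, OF j(1)]]] .
  have "I \<subseteq> Field \<nu>" using I(1) I0(1) by blast
  moreover have "I \<subseteq> underS q \<delta>"
    using I(1) j\<delta> wo_refl[OF wo \<delta>F] by (auto simp: q_def underS_def)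
  then have "consistent a b c M I bs f N"
    unfolding consistent_def using g(1,2) final by blast
  ultimately show False using incons I(2) by blast
qed

end

section \<open>Independent isi-sequences\<close>

text \<open>A stage is a pair of models \<open>sn : sM \<rightarrow> sN\<close> with an arrow \<open>sb\<close> into \<open>sN\<close> to be made independent
  from \<open>sM\<close> over \<open>sc\<close>. Taking \<open>sN\<close> as the \<open>sM\<close> of the successor stage turns the successive \<open>sb\<close> into an
  isi-sequence.\<close>

record ('o, 'a) stage =
  sM :: 'o
  sN :: 'o
  sn :: 'a
  sb :: 'a
  sc :: 'a

context simple_AECat
begin

text \<open>Extension yields a copy \<open>b'\<close> of \<open>b\<close> over \<open>M\<close> that
  is independent from all of \<open>N\<close>. Rather than passing to \<open>b'\<close>,
  \<open>N\<close> is embedded a second time, by \<open>S\<close>, so that \<open>b\<close> lands on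
  the image of \<open>b'\<close>. The embeddings \<open>n'\<close> and \<open>S\<close> agree on
  \<open>M\<close>: \<open>n'\<close> makes \<open>N\<close> the next model, and \<open>S\<close>
  carries \<open>b\<close> along.\<close>

lemma stage_step:
  assumes n: "extension M n N" and c: "arrow_into c M" and b: "indep ind N b (n \<cdot> c) n"
  obtains N' n' S where "extension N n' N'" "extension N S N'" "n' \<cdot> n = S \<cdot> n"
    "indep ind N' (S \<cdot> b) (n' \<cdot> (n \<cdot> c)) n'"
proof -
  obtain N1 f b' where f: "extension N f N1" "gtp_eq [b', f \<cdot> n, f \<cdot> (n \<cdot> c)] N1 [b, n, n \<cdot> c] N"
    "indep ind N1 b' (f \<cdot> (n \<cdot> c)) f"
    using indep_extension[OF b] .
  obtain N' g S where g: "extension N1 g N'" "extension N S N'" "g \<cdot> b' = S \<cdot> b" "g \<cdot> (f \<cdot> n) = S \<cdot> n"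
    using f(2) by (rule gtp_eqE) auto
  have nc: "arrow_into (n \<cdot> c) N" using arrow_into_comp(1)[OF c n] .
  show thesis
  proof (rule that[OF extension_comp[OF f(1) g(1)] g(2)])
    show "(g \<cdot> f) \<cdot> n = S \<cdot> n" using ext_assoc[OF extension_arrow_into[OF n] f(1) g(1)] g(4) by simp
    show "indep ind N' (S \<cdot> b) ((g \<cdot> f) \<cdot> (n \<cdot> c)) (g \<cdot> f)"
      using indep_ext[OF f(3) g(1)] g(3) ext_assoc[OF nc f(1) g(1)] by simp
  qed
qed

text \<open>Stages are linked by two arrows. Those between the \<open>sN\<close> carry
  \<open>sb\<close> to \<open>sb\<close>, which shows that \<open>sb\<close> at \<open>i\<close> and
  at \<open>j\<close> have the same type over \<open>sM\<close> at \<open>i\<close>, also across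
  limits. Those between the \<open>sM\<close> form the chain of initial segments; since
  \<open>sN\<close> at \<open>i\<close> is the \<open>sM\<close> of the successor stage, they place
  every \<open>sb\<close> in one model and so turn a transported arrow into a sequence.\<close>

lemma ex_independent_isi_sequence:
  assumes \<nu>: "regular_cardinal \<Omega> \<nu>" and M: "M \<in> Mod" and b: "arrow_into b M" and c: "arrow_into c M"
    and cB: "dom_in C \<B> (subobj C c)"
  obtains N f bs Ms T m where "extension M f N" "chain_of_initial_segments \<nu> bs N Ms T m"
    "\<forall>z. is_least \<nu> z \<longrightarrow> factors_through C (f \<cdot> c) (m z)"
    "\<forall>i j. (i, j) \<in> \<nu> \<longrightarrow> gtp_eq [bs i, m i] N [bs j, m i] N"
    "\<forall>i \<in> Field \<nu>. gtp_eq [bs i, f \<cdot> c] N [b, c] M"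
    "\<forall>i \<in> Field \<nu>. indep ind N (bs i) (f \<cdot> c) (m i)"
proof -
  note wo = regular_cardinalD(2)[OF \<nu>]
  have sm: "small \<Omega> (Field \<nu>)" by (rule regular_cardinal_small[OF \<nu>])
  \<comment> \<open>The clause for the least index remembers the initial data, so that the final
    model is an extension of \<open>M\<close> in which \<open>c\<close> is the given one.\<close>
  define St where "St i s \<longleftrightarrow> extension (sM s) (sn s) (sN s) \<and> arrow_into (sc s) (sM s) \<and>
      indep ind (sN s) (sb s) (sn s \<cdot> sc s) (sn s) \<and>
      gtp_eq [sb s, sn s \<cdot> sc s] (sN s) [b, c] M \<and>
      (is_least \<nu> i \<longrightarrow> sM s = M \<and> sc s = c)" for i and s :: "('o, 'a) stage"
  define Mor where "Mor i j s s' \<phi> \<longleftrightarrow> extension (sM s) (fst \<phi>) (sM s') \<and>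
      extension (sN s) (snd \<phi>) (sN s') \<and> extension (sM s) (sn s) (sN s) \<and>
      extension (sM s') (sn s') (sN s') \<and> arrow_into (sb s) (sN s) \<and> arrow_into (sc s) (sM s) \<and>
      sn s' \<cdot> fst \<phi> = snd \<phi> \<cdot> sn s \<and> sb s' = snd \<phi> \<cdot> sb s \<and> sc s' = fst \<phi> \<cdot> sc s"
    for i j :: 'u and s s' :: "('o, 'a) stage" and \<phi> :: "'a \<times> 'a"
  define ide where "ide s = (Id C (sM s), Id C (sN s))" for s :: "('o, 'a) stage"
  define cmp where "cmp \<psi> \<phi> = (fst \<psi> \<cdot> fst \<phi>, snd \<psi> \<cdot> snd \<phi>)" for \<psi> \<phi> :: "'a \<times> 'a"
  define R where "R i k s s' \<phi> \<longleftrightarrow> sM s' = sN s \<and> fst \<phi> = sn s"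
    for i k :: 'u and s s' :: "('o, 'a) stage" and \<phi> :: "'a \<times> 'a"
  define L where "L l X T s \<kappa> \<longleftrightarrow> colimit (full_subcat C Mod) (Restr \<nu> (underS \<nu> l)) (\<lambda>i. sM (X i))
      (\<lambda>i j. fst (T i j)) (sM s) (\<lambda>i. fst (\<kappa> i))"
    for l and X :: "'u \<Rightarrow> ('o, 'a) stage" and T :: "'u \<Rightarrow> 'u \<Rightarrow> 'a \<times> 'a" and s :: "('o, 'a) stage"
      and \<kappa> :: "'u \<Rightarrow> 'a \<times> 'a"
  have sys_diagram: "diagram (full_subcat C Mod) r (\<lambda>i. sM (X i)) (\<lambda>i j. fst (T i j))"
    "diagram (full_subcat C Mod) r (\<lambda>i. sN (X i)) (\<lambda>i j. snd (T i j))"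
    if sys: "chain_system r St Mor ide cmp X T" for r X T
  proof -
    have S: "extension (sM (X i)) (sn (X i)) (sN (X i))" "T i i = ide (X i)" if "i \<in> Field r" for i
      using sys that unfolding chain_system_def St_def by blast+
    have Mr: "Mor i j (X i) (X j) (T i j)" if "(i, j) \<in> r" for i j
      using sys that unfolding chain_system_def by blast
    have cm: "cmp (T j k) (T i j) = T i k" if "(i, j) \<in> r" "(j, k) \<in> r" for i j k
      using sys that unfolding chain_system_def by blast
    have fs: "fst (T j k) \<cdot> fst (T i j) = fst (T i k)" "snd (T j k) \<cdot> snd (T i j) = snd (T i k)"
      if "(i, j) \<in> r" "(j, k) \<in> r" for i j k
      using cm[OF that] by (auto simp: cmp_def prod_eq_iff)
    show "diagram (full_subcat C Mod) r (\<lambda>i. sM (X i)) (\<lambda>i j. fst (T i j))"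
      "diagram (full_subcat C Mod) r (\<lambda>i. sN (X i)) (\<lambda>i j. snd (T i j))"
      using S Mr fs extensionD(1,2)[OF S(1)] Mod_Obj
      unfolding diagram_Mod by (auto simp: diagram_def ide_def Mor_def extension_def)
  qed
  obtain X T where sys: "chain_system \<nu> St Mor ide cmp X T"
    and RT: "\<forall>i k. is_succ \<nu> i k \<longrightarrow> R i k (X i) (X k) (T i k)"
    and LT: "\<forall>l. is_limit \<nu> l \<longrightarrow> L l X T (X l) (\<lambda>i. T i l)"
  proof (rule transfinite_chain[OF wo, where St = St and Mor = Mor and R = R and ide = ide
        and cmp = cmp and L = L])
    fix i s assume "St i s"
    then have s: "extension (sM s) (sn s) (sN s)" "arrow_into (sc s) (sM s)" "arrow_into (sb s) (sN s)"
      using indepD(1) by (auto simp: St_def)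
    then show "Mor i i s s (ide s)"
      using extension_Id extensionD[OF s(1)] by (auto simp: Mor_def ide_def arrow_into_def)
  next
    fix i j k s t u f g assume f: "Mor i j s t f" and g: "Mor j k t u g"
    note f = f[unfolded Mor_def] and g = g[unfolded Mor_def]
    have 1: "extension (sM s) (fst g \<cdot> fst f) (sM u)" "extension (sN s) (snd g \<cdot> snd f) (sN u)"
      using extension_comp[of "sM s" "fst f" "sM t" "fst g" "sM u"]
        extension_comp[of "sN s" "snd f" "sN t" "snd g" "sN u"] f g by blast+
    have "sn u \<cdot> (fst g \<cdot> fst f) = (sn u \<cdot> fst g) \<cdot> fst f"
      using ext_assoc[OF extension_arrow_into[of "sM s"], of "fst f" "sM t" "fst g" "sM u" "sn u" "sN u"]
        f g by simp
    also have "\<dots> = snd g \<cdot> (sn t \<cdot> fst f)"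
      using ext_assoc[OF extension_arrow_into[of "sM s"], of "fst f" "sM t" "sn t" "sN t" "snd g" "sN u"]
        f g by simp
    also have "\<dots> = (snd g \<cdot> snd f) \<cdot> sn s"
      using ext_assoc[OF extension_arrow_into[of "sM s"], of "sn s" "sN s" "snd f" "sN t" "snd g" "sN u"]
        f g by simp
    finally show "Mor i k s u (cmp g f)"
      using 1 f g ext_assoc[of "sb s" "sN s" "snd f" "sN t" "snd g" "sN u"]
        ext_assoc[of "sc s" "sM s" "fst f" "sM t" "fst g" "sM u"]
      unfolding Mor_def cmp_def by simp
  next
    fix i j k l s t u v f g h assume "Mor i j s t f" "Mor j k t u g" "Mor k l u v h"
    then show "cmp (cmp h g) f = cmp h (cmp g f)"
      unfolding Mor_def cmp_def by (auto simp: extension_def Hom_iff intro!: comp_assoc)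
  next
    fix i j s t f assume "Mor i j s t f"
    then show "cmp (ide t) f = f" "cmp f (ide s) = f"
      unfolding Mor_def cmp_def ide_def by (auto simp: extension_def Hom_iff prod_eq_iff)
  next
    fix l X T X' T' s \<kappa> \<kappa>'
    assume "L l X T s \<kappa>" and eq: "\<And>i. i \<in> underS \<nu> l \<Longrightarrow> X i = X' i"
      "\<And>i j. (i, j) \<in> \<nu> \<Longrightarrow> j \<in> underS \<nu> l \<Longrightarrow> T i j = T' i j"
      "\<And>i. i \<in> underS \<nu> l \<Longrightarrow> \<kappa> i = \<kappa>' i"
    then show "L l X' T' s \<kappa>'"
      unfolding L_def by (elim colimit_cong) (auto simp: Field_Restr_underS[OF wo])
  next
    fix z assume z: "is_least \<nu> z"
    \<comment> \<open>Existence over \<open>c\<close>, then extension to all of \<open>M\<close>: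
      this is where \<open>c\<close> has to belong to the base.\<close>
    obtain N f b' where f: "extension M f N" "gtp_eq [b', f \<cdot> c, f \<cdot> c] N [b, c, c] M"
      "indep ind N b' (f \<cdot> c) f"
      using indep_extension[OF indep_existence[OF b c cB M]] .
    have "gtp_eq [b', f \<cdot> c] N [b, c] M" by (rule gtp_eq_subset[OF f(2)]) auto
    then have "St z \<lparr>sM = M, sN = N, sn = f, sb = b', sc = c\<rparr>" using f c by (simp add: St_def)
    then show "\<exists>s. St z s" by blast
  next
    fix i k s assume ik: "is_succ \<nu> i k" and "St i s"
    then have s: "extension (sM s) (sn s) (sN s)" "arrow_into (sc s) (sM s)"
      "indep ind (sN s) (sb s) (sn s \<cdot> sc s) (sn s)" "gtp_eq [sb s, sn s \<cdot> sc s] (sN s) [b, c] M"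
      by (auto simp: St_def)
    obtain N' n' S where st: "extension (sN s) n' N'" "extension (sN s) S N'" "n' \<cdot> sn s = S \<cdot> sn s"
      "indep ind N' (S \<cdot> sb s) (n' \<cdot> (sn s \<cdot> sc s)) n'"
      using stage_step[OF s(1-3)] .
    let ?t = "\<lparr>sM = sN s, sN = N', sn = n', sb = S \<cdot> sb s, sc = sn s \<cdot> sc s\<rparr>"
    have ba: "arrow_into (sb s) (sN s)" using indepD(1)[OF s(3)] .
    have ca: "arrow_into (sn s \<cdot> sc s) (sN s)" using arrow_into_comp(1)[OF s(2,1)] .
    have nc: "n' \<cdot> (sn s \<cdot> sc s) = S \<cdot> (sn s \<cdot> sc s)"
      using ext_assoc[OF s(2,1) st(1)] ext_assoc[OF s(2,1) st(2)] st(3) by simp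
    have "\<not> is_least \<nu> k" using is_least_underS[OF wo] is_succD(1)[OF ik] by blast
    moreover have "gtp_eq [S \<cdot> sb s, n' \<cdot> (sn s \<cdot> sc s)] N' [b, c] M"
    proof -
      have "gtp_eq [sb s, sn s \<cdot> sc s] (sN s) [S \<cdot> sb s, n' \<cdot> (sn s \<cdot> sc s)] N'"
        using gtp_eq_ext[OF st(2), of "[sb s, sn s \<cdot> sc s]"] ba ca nc by simp
      then show ?thesis using gtp_trans[OF gtp_eq_sym s(4)] by blast
    qed
    ultimately have "St k ?t" using st(1,4) ca by (simp add: St_def)
    moreover have "Mor i k s ?t (sn s, S)" using s st ba by (simp add: Mor_def)
    moreover have "R i k s ?t (sn s, S)" by (simp add: R_def)
    ultimately show "\<exists>t f. St k t \<and> Mor i k s t f \<and> R i k s t f" by blast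
  next
    fix l X T assume l: "is_limit \<nu> l"
      and sys: "chain_system (Restr \<nu> (underS \<nu> l)) St Mor ide cmp X T"
    let ?r = "Restr \<nu> (underS \<nu> l)"
    have Fr: "Field ?r = underS \<nu> l" using Field_Restr_underS[OF wo] .
    have wor: "Well_order ?r" using Well_order_Restr[OF wo] .
    have lF: "l \<in> Field \<nu>" and lz: "\<not> is_least \<nu> l" using l by (auto simp: is_limit_def)
    obtain z where z: "z \<in> Field \<nu>" "\<And>i. i \<in> Field \<nu> \<Longrightarrow> (z, i) \<in> \<nu>"
      using wo_least_exists[OF wo subset_refl] lF by blast
    then have "is_least \<nu> z" by (simp add: is_least_def)
    then have zr: "z \<in> underS \<nu> l" using is_least_limit_underS[OF wo _ l] by blast
    then have ner: "Field ?r \<noteq> {}" using Fr by blast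
    have smr: "small \<Omega> (Field ?r)" using small_subset[OF sm] Fr underS_subset_Field by metis
    have zi: "(z, i) \<in> ?r" if "i \<in> underS \<nu> l" for i
      using z(2)[of i] that zr underS_subset_Field[of \<nu> l] by blast
    have St: "extension (sM (X i)) (sn (X i)) (sN (X i))" "arrow_into (sc (X i)) (sM (X i))"
      "indep ind (sN (X i)) (sb (X i)) (sn (X i) \<cdot> sc (X i)) (sn (X i))"
      "gtp_eq [sb (X i), sn (X i) \<cdot> sc (X i)] (sN (X i)) [b, c] M" "arrow_into (sb (X i)) (sN (X i))"
      if "i \<in> underS \<nu> l" for i
    proof -
      have "St i (X i)" using sys that Fr by (simp add: chain_system_def)
      then show "extension (sM (X i)) (sn (X i)) (sN (X i))" "arrow_into (sc (X i)) (sM (X i))"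
        "indep ind (sN (X i)) (sb (X i)) (sn (X i) \<cdot> sc (X i)) (sn (X i))"
        "gtp_eq [sb (X i), sn (X i) \<cdot> sc (X i)] (sN (X i)) [b, c] M" "arrow_into (sb (X i)) (sN (X i))"
        using indepD(1) by (auto simp: St_def)
    qed
    have Mo: "extension (sM (X i)) (fst (T i j)) (sM (X j))" "extension (sN (X i)) (snd (T i j)) (sN (X j))"
      "sn (X j) \<cdot> fst (T i j) = snd (T i j) \<cdot> sn (X i)" "sb (X j) = snd (T i j) \<cdot> sb (X i)"
      "sc (X j) = fst (T i j) \<cdot> sc (X i)" if "(i, j) \<in> ?r" for i j
    proof -
      have "Mor i j (X i) (X j) (T i j)" using sys that unfolding chain_system_def by blast
      then show "extension (sM (X i)) (fst (T i j)) (sM (X j))"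
        "extension (sN (X i)) (snd (T i j)) (sN (X j))"
        "sn (X j) \<cdot> fst (T i j) = snd (T i j) \<cdot> sn (X i)" "sb (X j) = snd (T i j) \<cdot> sb (X i)"
        "sc (X j) = fst (T i j) \<cdot> sc (X i)"
        by (auto simp: Mor_def)
    qed
    note DM = sys_diagram(1)[OF sys] and DN = sys_diagram(2)[OF sys]
    \<comment> \<open>Both chains need a colimit: that of the \<open>sM\<close> is the next initial
      segment, and that of the \<open>sN\<close> holds the transported \<open>sb\<close>.\<close>
    obtain Ml \<kappa> where colM: "colimit (full_subcat C Mod) ?r (\<lambda>i. sM (X i)) (\<lambda>i j. fst (T i j)) Ml \<kappa>"
      "colimit C ?r (\<lambda>i. sM (X i)) (\<lambda>i j. fst (T i j)) Ml \<kappa>" "Ml \<in> Mod"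
      by (rule ex_chain_colimit[OF wor ner smr DM])
    obtain Nl \<rho> where colN: "colimit (full_subcat C Mod) ?r (\<lambda>i. sN (X i)) (\<lambda>i j. snd (T i j)) Nl \<rho>"
      "colimit C ?r (\<lambda>i. sN (X i)) (\<lambda>i j. snd (T i j)) Nl \<rho>" "Nl \<in> Mod"
      by (rule ex_chain_colimit[OF wor ner smr DN])
    have \<kappa>E: "extension (sM (X i)) (\<kappa> i) Ml" if "i \<in> underS \<nu> l" for i
      using colimit_cocone[OF colM(1)] that Fr by (simp add: cocone_def extension_def Hom_full)
    have \<rho>E: "extension (sN (X i)) (\<rho> i) Nl" if "i \<in> underS \<nu> l" for i
      using colimit_cocone[OF colN(1)] that Fr by (simp add: cocone_def extension_def Hom_full)
    have \<kappa>T: "\<kappa> j \<cdot> fst (T i j) = \<kappa> i" if "(i, j) \<in> ?r" for i j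
      using colimit_cocone[OF colM(2)] that by (simp add: cocone_def)
    have \<rho>T: "\<rho> j \<cdot> snd (T i j) = \<rho> i" if "(i, j) \<in> ?r" for i j
      using colimit_cocone[OF colN(2)] that by (simp add: cocone_def)
    have "cocone C ?r (\<lambda>i. sM (X i)) (\<lambda>i j. fst (T i j)) Nl (\<lambda>i. \<rho> i \<cdot> sn (X i))"
      unfolding cocone_def
    proof (intro conjI ballI allI impI)
      show "Nl \<in> Obj C" using colN(3) Mod_Obj by blast
      show "\<rho> i \<cdot> sn (X i) \<in> Hom C (sM (X i)) Nl" if "i \<in> Field ?r" for i
        using extension_comp[OF St(1) \<rho>E] that Fr by (simp add: extension_def)
      fix i j assume ij: "(i, j) \<in> ?r"
      then have u: "i \<in> underS \<nu> l" "j \<in> underS \<nu> l" by auto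
      have "(\<rho> j \<cdot> sn (X j)) \<cdot> fst (T i j) = \<rho> j \<cdot> (sn (X j) \<cdot> fst (T i j))"
        using ext_assoc[OF extension_arrow_into[OF Mo(1)[OF ij]] St(1)[OF u(2)] \<rho>E[OF u(2)]] .
      also have "\<dots> = (\<rho> j \<cdot> snd (T i j)) \<cdot> sn (X i)"
        using ext_assoc[OF extension_arrow_into[OF St(1)[OF u(1)]] Mo(2)[OF ij] \<rho>E[OF u(2)]] Mo(3)[OF ij]
        by simp
      finally show "(\<rho> j \<cdot> sn (X j)) \<cdot> fst (T i j) = \<rho> i \<cdot> sn (X i)" using \<rho>T[OF ij] by simp
    qed
    then obtain nl where nl: "nl \<in> Hom C Ml Nl"
      "\<And>i. i \<in> Field ?r \<Longrightarrow> nl \<cdot> \<kappa> i = \<rho> i \<cdot> sn (X i)"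
      using colimit_factor[OF colM(2)] by blast
    have nlE: "extension Ml nl Nl" using nl(1) colM(3) colN(3) by (simp add: extension_def)
    define bl where "bl = \<rho> z \<cdot> sb (X z)"
    define cl where "cl = \<kappa> z \<cdot> sc (X z)"
    have bl: "bl = \<rho> i \<cdot> sb (X i)" if i: "i \<in> underS \<nu> l" for i
      using ext_assoc[OF St(5)[OF zr] Mo(2)[OF zi[OF i]] \<rho>E[OF i]] Mo(4)[OF zi[OF i]] \<rho>T[OF zi[OF i]]
      by (simp add: bl_def)
    have cl: "cl = \<kappa> i \<cdot> sc (X i)" if i: "i \<in> underS \<nu> l" for i
      using ext_assoc[OF St(2)[OF zr] Mo(1)[OF zi[OF i]] \<kappa>E[OF i]] Mo(5)[OF zi[OF i]] \<kappa>T[OF zi[OF i]]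
      by (simp add: cl_def)
    have nc: "nl \<cdot> cl = \<rho> i \<cdot> (sn (X i) \<cdot> sc (X i))" if i: "i \<in> underS \<nu> l" for i
    proof -
      have "nl \<cdot> cl = (nl \<cdot> \<kappa> i) \<cdot> sc (X i)"
        using ext_assoc[OF St(2)[OF i] \<kappa>E[OF i] nlE] cl[OF i] by simp
      also have "\<dots> = \<rho> i \<cdot> (sn (X i) \<cdot> sc (X i))"
        using nl(2) i Fr ext_assoc[OF St(2)[OF i] St(1)[OF i] \<rho>E[OF i]] by simp
      finally show ?thesis .
    qed
    have bla: "arrow_into bl Nl" unfolding bl_def by (rule arrow_into_comp(1)[OF St(5)[OF zr] \<rho>E[OF zr]])
    have cla: "arrow_into cl Ml" unfolding cl_def by (rule arrow_into_comp(1)[OF St(2)[OF zr] \<kappa>E[OF zr]])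
    have indl: "indep ind Nl bl (nl \<cdot> cl) nl"
    proof (rule indep_union[OF wor ner smr _ colM(2)])
      show "diagram C ?r (\<lambda>i. sM (X i)) (\<lambda>i j. fst (T i j))" using DM by (simp add: diagram_Mod)
      show "arrow_into nl Nl" "Dom nl = Ml" using extension_arrow_into[OF nlE] extensionD[OF nlE] by auto
      show "arrow_into bl Nl" by (fact bla)
      show "arrow_into (nl \<cdot> cl) Nl" using arrow_into_comp(1)[OF cla nlE] .
      show "Nl \<in> Mod" by (fact colN(3))
      fix i assume "i \<in> Field ?r"
      then have i: "i \<in> underS \<nu> l" using Fr by simp
      from indep_ext[OF St(3)[OF i] \<rho>E[OF i]] show "indep ind Nl bl (nl \<cdot> cl) (nl \<cdot> \<kappa> i)"
        using bl[OF i] nc[OF i] nl(2) i Fr by simp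
    qed
    have gl: "gtp_eq [bl, nl \<cdot> cl] Nl [b, c] M"
    proof -
      have "gtp_eq [sb (X z), sn (X z) \<cdot> sc (X z)] (sN (X z)) [bl, nl \<cdot> cl] Nl"
        using gtp_eq_ext[OF \<rho>E[OF zr], of "[sb (X z), sn (X z) \<cdot> sc (X z)]"] nc[OF zr] bl[OF zr]
          gtp_eqD(3)[OF St(4)[OF zr]] by simp
      then show ?thesis using gtp_trans[OF gtp_eq_sym St(4)[OF zr]] by blast
    qed
    let ?s = "\<lparr>sM = Ml, sN = Nl, sn = nl, sb = bl, sc = cl\<rparr>"
    have "St l ?s" using nlE cla indl gl lz by (simp add: St_def)
    moreover have "Mor i l (X i) ?s (\<kappa> i, \<rho> i)" if "i \<in> underS \<nu> l" for i
      using \<kappa>E[OF that] \<rho>E[OF that] St[OF that] nlE nl(2) that Fr bl[OF that] cl[OF that]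
      by (simp add: Mor_def)
    moreover have "cmp (\<kappa> j, \<rho> j) (T i j) = (\<kappa> i, \<rho> i)" if "(i, j) \<in> \<nu>" "j \<in> underS \<nu> l" for i j
      using \<kappa>T[of i j] \<rho>T[of i j] that underS_trans[OF wo that] by (simp add: cmp_def)
    moreover have "L l X T ?s (\<lambda>i. (\<kappa> i, \<rho> i))" using colM(1) by (simp add: L_def)
    ultimately show "\<exists>s \<kappa>. St l s \<and> (\<forall>i\<in>underS \<nu> l. Mor i l (X i) s (\<kappa> i)) \<and>
        (\<forall>i j. (i, j) \<in> \<nu> \<longrightarrow> j \<in> underS \<nu> l \<longrightarrow> cmp (\<kappa> j) (T i j) = \<kappa> i) \<and> L l X T s \<kappa>"
      by (intro exI[of _ ?s] exI[of _ "\<lambda>i. (\<kappa> i, \<rho> i)"]) simp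
  qed (rule that)
  have St: "extension (sM (X i)) (sn (X i)) (sN (X i))" "arrow_into (sc (X i)) (sM (X i))"
    "indep ind (sN (X i)) (sb (X i)) (sn (X i) \<cdot> sc (X i)) (sn (X i))"
    "gtp_eq [sb (X i), sn (X i) \<cdot> sc (X i)] (sN (X i)) [b, c] M" "arrow_into (sb (X i)) (sN (X i))"
    "is_least \<nu> i \<Longrightarrow> sM (X i) = M \<and> sc (X i) = c"
    if "i \<in> Field \<nu>" for i
  proof -
    have "St i (X i)" using sys that by (simp add: chain_system_def)
    then show "extension (sM (X i)) (sn (X i)) (sN (X i))" "arrow_into (sc (X i)) (sM (X i))"
      "indep ind (sN (X i)) (sb (X i)) (sn (X i) \<cdot> sc (X i)) (sn (X i))"
      "gtp_eq [sb (X i), sn (X i) \<cdot> sc (X i)] (sN (X i)) [b, c] M" "arrow_into (sb (X i)) (sN (X i))"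
      "is_least \<nu> i \<Longrightarrow> sM (X i) = M \<and> sc (X i) = c"
      using indepD(1) by (auto simp: St_def)
  qed
  have Mo: "extension (sM (X i)) (fst (T i j)) (sM (X j))" "extension (sN (X i)) (snd (T i j)) (sN (X j))"
    "sn (X j) \<cdot> fst (T i j) = snd (T i j) \<cdot> sn (X i)" "sb (X j) = snd (T i j) \<cdot> sb (X i)"
    "sc (X j) = fst (T i j) \<cdot> sc (X i)" if "(i, j) \<in> \<nu>" for i j
  proof -
    have "Mor i j (X i) (X j) (T i j)" using sys that by (simp add: chain_system_def)
    then show "extension (sM (X i)) (fst (T i j)) (sM (X j))"
      "extension (sN (X i)) (snd (T i j)) (sN (X j))"
      "sn (X j) \<cdot> fst (T i j) = snd (T i j) \<cdot> sn (X i)" "sb (X j) = snd (T i j) \<cdot> sb (X i)"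
      "sc (X j) = fst (T i j) \<cdot> sc (X i)"
      by (auto simp: Mor_def)
  qed
  note D = sys_diagram(1)[OF sys]
  have ne: "Field \<nu> \<noteq> {}" using regular_cardinalD(3)[OF \<nu>] by auto
  \<comment> \<open>The colimit of the \<open>sM\<close> already contains every \<open>sb\<close>,
    because each \<open>sN\<close> occurs among them as a successor.\<close>
  obtain N m where col: "colimit (full_subcat C Mod) \<nu> (\<lambda>i. sM (X i)) (\<lambda>i j. fst (T i j)) N m"
    "colimit C \<nu> (\<lambda>i. sM (X i)) (\<lambda>i j. fst (T i j)) N m" "N \<in> Mod"
    by (rule ex_chain_colimit[OF wo ne sm D])
  have mE: "extension (sM (X i)) (m i) N" if "i \<in> Field \<nu>" for i
    using colimit_cocone[OF col(1)] that by (simp add: cocone_def extension_def Hom_full)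
  have mT: "m j \<cdot> fst (T i j) = m i" if "(i, j) \<in> \<nu>" for i j
    using colimit_cocone[OF col(2)] that by (simp add: cocone_def)
  obtain z where z: "z \<in> Field \<nu>" "\<And>i. i \<in> Field \<nu> \<Longrightarrow> (z, i) \<in> \<nu>"
    using wo_least_exists[OF wo subset_refl ne] by blast
  then have zl: "is_least \<nu> z" by (simp add: is_least_def)
  note Xz = St(6)[OF z(1) zl]
  have "\<exists>k. is_succ \<nu> i k" if i: "i \<in> Field \<nu>" for i
  proof -
    obtain k where "k \<in> Field \<nu>" "i \<noteq> k" "(i, k) \<in> \<nu>"
      using infinite_Card_order_limit[OF regular_cardinalD(1,3)[OF \<nu>] i] by blast
    then have "i \<in> underS \<nu> k" by (simp add: underS_def)
    then show ?thesis using ex_is_succ[OF wo] by blast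
  qed
  then obtain sc' where sc': "\<And>i. i \<in> Field \<nu> \<Longrightarrow> is_succ \<nu> i (sc' i)" by metis
  have succ_unique: "k = sc' i" if "is_succ \<nu> i k" for i k
    using sc'[OF is_succD(4)[OF that]] that wo_antisym[OF wo] unfolding is_succ_def by blast
  define bs where "bs i = m (sc' i) \<cdot> sb (X i)" for i
  have eE: "extension (sN (X i)) (m (sc' i)) N" and em: "m (sc' i) \<cdot> sn (X i) = m i"
    if i: "i \<in> Field \<nu>" for i
  proof -
    have "sM (X (sc' i)) = sN (X i)" "fst (T i (sc' i)) = sn (X i)"
      using RT[rule_format, OF sc'[OF i]] by (auto simp: R_def)
    then show "extension (sN (X i)) (m (sc' i)) N" "m (sc' i) \<cdot> sn (X i) = m i"
      using mE[OF is_succD(5)[OF sc'[OF i]]] mT[OF is_succD(2)[OF sc'[OF i]]] by auto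
  qed
  \<comment> \<open>Each \<open>sc\<close> is the transported \<open>c\<close>, so all of them
    become the same arrow in \<open>N\<close>.\<close>
  have mc: "m (sc' i) \<cdot> (sn (X i) \<cdot> sc (X i)) = m z \<cdot> c" if i: "i \<in> Field \<nu>" for i
  proof -
    have "m (sc' i) \<cdot> (sn (X i) \<cdot> sc (X i)) = m i \<cdot> sc (X i)"
      using ext_assoc[OF St(2)[OF i] St(1)[OF i] eE[OF i]] em[OF i] by simp
    also have "\<dots> = (m i \<cdot> fst (T z i)) \<cdot> sc (X z)"
      using ext_assoc[OF St(2)[OF z(1)] Mo(1)[OF z(2)[OF i]] mE[OF i]] Mo(5)[OF z(2)[OF i]] by simp
    also have "\<dots> = m z \<cdot> c" using mT[OF z(2)[OF i]] Xz by simp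
    finally show ?thesis .
  qed
  have bsa: "arrow_into (bs i) N" "Dom (bs i) = Dom b" if i: "i \<in> Field \<nu>" for i
    using arrow_into_comp[OF St(5)[OF i] eE[OF i]] gtp_eqD(5)[OF St(4)[OF i]] by (auto simp: bs_def)
  have g1: "gtp_eq [bs i, m i] N [sb (X i), sn (X i)] (sN (X i))" if i: "i \<in> Field \<nu>" for i
    using gtp_eq_sym[OF gtp_eq_ext[OF eE[OF i], of "[sb (X i), sn (X i)]"]] em[OF i] St(5)[OF i]
      extension_arrow_into[OF St(1)[OF i]] by (simp add: bs_def)
  \<comment> \<open>Both pairs are compared inside \<open>sN (X j)\<close>: the transition from
    \<open>i\<close> sends \<open>sb\<close> to \<open>sb\<close> and respects the embeddings of
    \<open>sM (X i)\<close>.\<close>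
  have gij: "gtp_eq [bs i, m i] N [bs j, m i] N" if ij: "(i, j) \<in> \<nu>" for i j
  proof -
    have F: "i \<in> Field \<nu>" "j \<in> Field \<nu>" using ij by (auto simp: Field_def)
    have "gtp_eq [sb (X i), sn (X i)] (sN (X i)) [sb (X j), sn (X j) \<cdot> fst (T i j)] (sN (X j))"
      using gtp_eq_ext[OF Mo(2)[OF ij], of "[sb (X i), sn (X i)]"] Mo(3,4)[OF ij] St(5)[OF F(1)]
        extension_arrow_into[OF St(1)[OF F(1)]] by simp
    moreover have "gtp_eq [sb (X j), sn (X j) \<cdot> fst (T i j)] (sN (X j)) [bs j, m i] N"
    proof -
      have "m (sc' j) \<cdot> (sn (X j) \<cdot> fst (T i j)) = m i"
        using ext_assoc[OF extension_arrow_into[OF Mo(1)[OF ij]] St(1)[OF F(2)] eE[OF F(2)]]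
          em[OF F(2)] mT[OF ij] by simp
      then show ?thesis
        using gtp_eq_ext[OF eE[OF F(2)], of "[sb (X j), sn (X j) \<cdot> fst (T i j)]"] St(5)[OF F(2)]
          extension_arrow_into[OF extension_comp[OF Mo(1)[OF ij] St(1)[OF F(2)]]] by (simp add: bs_def)
    qed
    ultimately show ?thesis using gtp_trans[OF gtp_trans[OF g1[OF F(1)]]] by blast
  qed
  show thesis
  proof (rule that)
    show "extension M (m z) N" using mE[OF z(1)] Xz by simp
    show "chain_of_initial_segments \<nu> bs N (\<lambda>i. sM (X i)) (\<lambda>i j. fst (T i j)) m"
      unfolding chain_of_initial_segments_def
    proof (intro conjI ballI allI impI)
      show "N \<in> Mod" by (fact col(3))
      show "arrow_into (bs i) N" if "i \<in> Field \<nu>" for i using bsa(1) that .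
      show "Dom (bs i) = Dom (bs j)" if "i \<in> Field \<nu>" "j \<in> Field \<nu>" for i j using bsa(2) that by simp
      show "diagram (full_subcat C Mod) \<nu> (\<lambda>i. sM (X i)) (\<lambda>i j. fst (T i j))" by (fact D)
      show "colimit (full_subcat C Mod) (Restr \<nu> (underS \<nu> l)) (\<lambda>i. sM (X i)) (\<lambda>i j. fst (T i j))
          (sM (X l)) (\<lambda>i. fst (T i l))" if "is_limit \<nu> l" for l
        using LT[rule_format, OF that] by (simp add: L_def)
      show "cocone C \<nu> (\<lambda>i. sM (X i)) (\<lambda>i j. fst (T i j)) N m" by (rule colimit_cocone[OF col(2)])
      show "factors_through C (bs i) (m k)" if ik: "is_succ \<nu> i k" for i k
      proof -
        note i = is_succD(4)[OF ik]
        show ?thesis unfolding bs_def succ_unique[OF ik]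
          by (rule factors_throughI)
            (use extensionD[OF eE[OF i]] St(5)[OF i] in \<open>auto simp: arrow_into_def\<close>)
      qed
    qed
    show "\<forall>y. is_least \<nu> y \<longrightarrow> factors_through C (m z \<cdot> c) (m y)"
    proof (intro allI impI)
      fix y assume y: "is_least \<nu> y"
      have "y = z" using y zl wo_antisym[OF wo] by (auto simp: is_least_def)
      then show "factors_through C (m z \<cdot> c) (m y)"
        using factors_throughI[of "m z" c] c extensionD[OF mE[OF z(1)]] Xz by (simp add: arrow_into_def)
    qed
    show "\<forall>i j. (i, j) \<in> \<nu> \<longrightarrow> gtp_eq [bs i, m i] N [bs j, m i] N" using gij by blast
    show "\<forall>i\<in>Field \<nu>. gtp_eq [bs i, m z \<cdot> c] N [b, c] M"
    proof
      fix i assume i: "i \<in> Field \<nu>"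
      have "gtp_eq [sb (X i), sn (X i) \<cdot> sc (X i)] (sN (X i)) [bs i, m z \<cdot> c] N"
        using gtp_eq_ext[OF eE[OF i], of "[sb (X i), sn (X i) \<cdot> sc (X i)]"] mc[OF i]
          gtp_eqD(3)[OF St(4)[OF i]] by (simp add: bs_def)
      then show "gtp_eq [bs i, m z \<cdot> c] N [b, c] M" using gtp_trans[OF gtp_eq_sym St(4)[OF i]] by blast
    qed
    show "\<forall>i\<in>Field \<nu>. indep ind N (bs i) (m z \<cdot> c) (m i)"
    proof
      fix i assume i: "i \<in> Field \<nu>"
      show "indep ind N (bs i) (m z \<cdot> c) (m i)"
        using indep_ext[OF St(3)[OF i] eE[OF i]] em[OF i] mc[OF i] by (simp add: bs_def)
    qed
  qed
qed

end

section \<open>The characterization\<close>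

context simple_AECat
begin

proposition not_isi_divides_indep:
  assumes M: "M \<in> Mod" and a: "arrow_into a M" and b: "arrow_into b M" and c: "arrow_into c M"
    and cB: "dom_in C \<B> (subobj C c)" and nd: "\<not> isi_divides a b c M"
  shows "indep ind M a c b"
proof -
  have "Dom a \<in> Obj C" using arrow_intoD(1)[OF a] Arr_Obj(1) by blast
  then obtain \<Upsilon> where lc: "local_character_at (Dom a) \<Upsilon>" by (rule ex_local_character)
  then have \<Upsilon>: "regular_cardinal \<Omega> \<Upsilon>" by (simp add: local_character_at_def)
  \<comment> \<open>Strictly above \<Upsilon>, so that \<Upsilon> is an admissible \<kappa> at the
    length \<nu> where dividing fails.\<close>
  obtain \<mu> where \<mu>: "regular_cardinal \<Omega> \<mu>" "\<Upsilon> <o \<mu>"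
    using regular_cardinal_above[OF inacc \<Upsilon> \<Upsilon>] .
  obtain \<nu> where \<nu>: "regular_cardinal \<Omega> \<nu>" "\<mu> \<le>o \<nu>"
    and nd': "\<not> (\<exists>N f bs \<kappa>. extension M f N \<and> isi_sequence \<nu> bs (f \<cdot> c) N \<and>
           (\<forall>i \<in> Field \<nu>. gtp_eq [bs i, f \<cdot> c] N [b, c] M) \<and>
           regular_cardinal \<Omega> \<kappa> \<and> \<kappa> <o \<nu> \<and>
           (\<forall>I \<subseteq> Field \<nu>. |I| =o \<kappa> \<longrightarrow> \<not> consistent a b c M I bs f N))"
    using nd \<mu>(1) unfolding isi_divides_def by metis
  have \<Upsilon>\<nu>: "\<Upsilon> <o \<nu>" using ordLess_ordLeq_trans[OF \<mu>(2) \<nu>(2)] .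
  note wo = regular_cardinalD(2)[OF \<nu>(1)]
  obtain N f bs Ms T m where f: "extension M f N" and seg: "chain_of_initial_segments \<nu> bs N Ms T m"
    and cm: "\<forall>z. is_least \<nu> z \<longrightarrow> factors_through C (f \<cdot> c) (m z)"
    and gm: "\<forall>i j. (i, j) \<in> \<nu> \<longrightarrow> gtp_eq [bs i, m i] N [bs j, m i] N"
    and gb: "\<forall>i \<in> Field \<nu>. gtp_eq [bs i, f \<cdot> c] N [b, c] M"
    and ib: "\<forall>i \<in> Field \<nu>. indep ind N (bs i) (f \<cdot> c) (m i)"
    using ex_independent_isi_sequence[OF \<nu>(1) M b c cB] .
  have "isi_sequence \<nu> bs (f \<cdot> c) N" unfolding isi_sequence_def using seg cm gm by blast
  then obtain I where I: "I \<subseteq> Field \<nu>" "|I| =o \<Upsilon>" "consistent a b c M I bs f N"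
    using nd' f gb \<Upsilon> \<Upsilon>\<nu> by metis
  obtain N' g a' where g: "extension N g N'" "arrow_into a' N'"
    and ga: "\<forall>i\<in>I. gtp_eq [a', g \<cdot> bs i, g \<cdot> (f \<cdot> c)] N' [a, b, c] M"
    using I(3) unfolding consistent_def by blast
  obtain \<delta> where \<delta>: "is_limit \<nu> \<delta>" "directed \<Upsilon> (Restr \<nu> (underS \<nu> \<delta>))"
    and tail: "\<forall>j \<in> underS \<nu> \<delta>. \<Upsilon> \<le>o |{i \<in> I \<inter> underS \<nu> \<delta>. (j, i) \<in> \<nu>}|"
    using ex_directed_initial_segment[OF \<Upsilon> \<nu>(1) \<Upsilon>\<nu> I(1,2)] .
  have tail': "\<exists>i. i \<in> I \<and> i \<in> underS \<nu> \<delta> \<and> (j, i) \<in> \<nu>" if j: "j \<in> underS \<nu> \<delta>" for j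
  proof (rule ccontr)
    assume "\<not> ?thesis"
    then have "{i \<in> I \<inter> underS \<nu> \<delta>. (j, i) \<in> \<nu>} = {}" by blast
    then have "finite {i \<in> I \<inter> underS \<nu> \<delta>. (j, i) \<in> \<nu>}" by (simp only: finite.emptyI)
    then have "|{i \<in> I \<inter> underS \<nu> \<delta>. (j, i) \<in> \<nu>}| <o \<Upsilon>" by (rule finite_less_regular[OF \<Upsilon>])
    then show False using tail[rule_format, OF j] not_ordLess_ordLeq by blast
  qed
  note seg' = chain_of_initial_segmentsD[OF seg]
  have D: "diagram C \<nu> Ms T" and MM: "\<And>i. i \<in> Field \<nu> \<Longrightarrow> Ms i \<in> Mod"
    using seg'(2) by (auto simp: continuous_chain_def diagram_Mod)
  have mE: "extension (Ms i) (m i) N" if "i \<in> Field \<nu>" for i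
    using seg'(1,3) MM that by (simp add: cocone_def extension_def)
  have mm: "factors_through C (m i) (m j)" if ij: "(i, j) \<in> \<nu>" for i j
  proof -
    have "j \<in> Field \<nu>" using ij by (auto simp: Field_def)
    moreover have "T i j \<in> Hom C (Ms i) (Ms j)" using D ij by (simp add: diagram_def)
    moreover have "m j \<cdot> T i j = m i" using seg'(3) ij by (simp add: cocone_def)
    ultimately show ?thesis
      using factors_throughI[of "m j" "T i j"] extensionD[OF mE] by (simp add: Hom_iff)
  qed
  have ma: "arrow_into (m i) N" if "i \<in> Field \<nu>" for i using extension_arrow_into[OF mE[OF that]] .
  have gH: "g \<in> Hom C N N'" using g(1) by (simp add: extension_def)
  \<comment> \<open>Local character is applied to \<open>a'\<close>, so the chain must be viewed
    inside \<open>N'\<close>.\<close>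
  have coc: "cocone C \<nu> Ms T N' (\<lambda>i. g \<cdot> m i)" by (rule cocone_comp[OF category_C D seg'(3) gH])
  have \<delta>F: "\<delta> \<in> Field \<nu>" using \<delta>(1) by (simp add: is_limit_def)
  obtain z where z: "z \<in> Field \<nu>" "\<And>i. i \<in> Field \<nu> \<Longrightarrow> (z, i) \<in> \<nu>"
    using wo_least_exists[OF wo subset_refl] \<delta>F by blast
  then have zl: "is_least \<nu> z" by (simp add: is_least_def)
  obtain i0 where "i0 \<in> I" using tail' is_least_limit_underS[OF wo zl \<delta>(1)] by blast
  then have "Dom a' = Dom a" using gtp_eqD(5)[OF ga[rule_format]] by auto
  then have lc': "local_character_at (Dom a') \<Upsilon>" using lc by simp
  have \<Upsilon>\<Upsilon>: "\<Upsilon> \<le>o \<Upsilon>" using ordLeq_reflexive[OF regular_cardinalD(2)[OF \<Upsilon>]] .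
  obtain j where j: "j \<in> underS \<nu> \<delta>" "indep ind N' a' (g \<cdot> m j) (g \<cdot> m \<delta>)"
    using chain_local_character[OF lc' \<Upsilon>\<Upsilon> \<Upsilon> wo regular_cardinal_small[OF \<nu>(1)] seg'(2) coc
        extensionD(2)[OF g(1)] \<delta> g(2)] .
  obtain i where i: "i \<in> I" "i \<in> underS \<nu> \<delta>" "(j, i) \<in> \<nu>" using tail'[OF j(1)] by blast
  have iF: "i \<in> Field \<nu>" and i\<delta>: "(i, \<delta>) \<in> \<nu>" using i by (auto simp: underS_def Field_def)
  \<comment> \<open>The successor of \<open>i\<close> is still at most \<delta>, so
    \<open>bs i\<close> lies in the model at \<delta>.\<close>
  obtain k where k: "is_succ \<nu> i k" "(k, \<delta>) \<in> \<nu>" using ex_is_succ[OF wo i(2)] .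
  have b\<delta>: "factors_through C (bs i) (m \<delta>)"
    using factors_through_trans[OF seg'(4)[OF k(1)] mm[OF k(2)]] .
  have Di: "Dom (g \<cdot> m i) \<in> Mod" using extensionD[OF extension_comp[OF mE[OF iF] g(1)]] by simp
  \<comment> \<open>The index \<open>j\<close> from local character need not belong to
    \<open>I\<close>; Base-Monotonicity moves the base up to \<open>m i\<close> for some later
    \<open>i\<close> in \<open>I\<close>, where the type of \<open>a'\<close> with
    \<open>bs i\<close> is known.\<close>
  have "indep ind N' a' (g \<cdot> m i) (g \<cdot> m \<delta>)"
    by (rule indep_base_mono[OF j(2) factors_through_ext[OF mm[OF i(3)] ma[OF iF] g(1)]
          factors_through_ext[OF mm[OF i\<delta>] ma[OF \<delta>F] g(1)] Di])
  from indep_mono_right[OF this factors_through_ext[OF b\<delta> ma[OF \<delta>F] g(1)]]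
  have 1: "indep ind N' (g \<cdot> bs i) (g \<cdot> m i) a'" by (rule indep_sym)
  \<comment> \<open>Transitivity changes the base with the left side fixed, so \<open>bs i\<close>
    is put on the left: it is independent from \<open>m i\<close> over \<open>c\<close> by
    construction, and from \<open>a'\<close> over \<open>m i\<close> by local character.\<close>
  have 2: "indep ind N' (g \<cdot> bs i) (g \<cdot> (f \<cdot> c)) (g \<cdot> m i)"
    using indep_ext[OF _ g(1)] ib iF by blast
  have "factors_through C (f \<cdot> c) (m i)"
    using factors_through_trans[OF cm[rule_format, OF zl] mm[OF z(2)[OF iF]]] .
  from factors_through_ext[OF this ma[OF iF] g(1)]
  have "indep ind N' (g \<cdot> bs i) (g \<cdot> (f \<cdot> c)) a'" by (rule indep_trans[OF 2 1])
  from indep_gtp[OF indep_sym[OF this] ga[rule_format, OF i(1)]] show ?thesis .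
qed

proposition indep_not_isi_forks:
  assumes ab: "indep ind M a c b"
  shows "\<not> isi_forks a b c M"
proof
  assume "isi_forks a b c M"
  then obtain N f and J :: "'u set" and as ds where f: "extension M f N"
    and div: "\<forall>j \<in> J. arrow_into (as j) N \<and> arrow_into (ds j) N \<and>
           isi_divides (as j) (ds j) (f \<cdot> c) N"
    and fork: "\<forall>N' g a'. extension N g N' \<and> arrow_into a' N' \<and>
           gtp_eq [a', g \<cdot> (f \<cdot> b), g \<cdot> (f \<cdot> c)] N' [f \<cdot> a, f \<cdot> b, f \<cdot> c] N \<longrightarrow>
           (\<exists>j \<in> J. gtp_eq [a', g \<cdot> ds j, g \<cdot> (f \<cdot> c)] N' [as j, ds j, f \<cdot> c] N)"
    unfolding isi_forks_def by (elim exE conjE)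
  \<comment> \<open>It is not known in advance which \<open>ds j\<close> will be met, so the
    realisation is made independent from all of \<open>N\<close> before the covering family is
    consulted.\<close>
  obtain N' g a' where g: "extension N g N'"
    "gtp_eq [a', g \<cdot> (f \<cdot> b), g \<cdot> (f \<cdot> c)] N' [f \<cdot> a, f \<cdot> b, f \<cdot> c] N" "indep ind N' a' (g \<cdot> (f \<cdot> c)) g"
    using indep_extension[OF indep_ext[OF ab f]] .
  obtain j where j: "j \<in> J" "gtp_eq [a', g \<cdot> ds j, g \<cdot> (f \<cdot> c)] N' [as j, ds j, f \<cdot> c] N"
    using fork g(1,2) indepD(1)[OF g(3)] by blast
  have "arrow_into (ds j) N" using div j(1) by blast
  then have "factors_through C (g \<cdot> ds j) g"
    using factors_throughI extensionD[OF g(1)] by (simp add: arrow_into_def)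
  from indep_gtp[OF indep_mono_right[OF g(3) this] j(2)]
  have "\<not> isi_divides (as j) (ds j) (f \<cdot> c) N" by (rule indep_not_isi_divides)
  then show False using div j(1) by blast
qed

text \<open>The dividing type itself serves as a covering family with one member, in the trivial
  extension of \<open>M\<close>.\<close>

lemma isi_divides_isi_forks:
  assumes M: "M \<in> Mod" and a: "arrow_into a M" and b: "arrow_into b M" and c: "arrow_into c M"
    and div: "isi_divides a b c M"
  shows "isi_forks a b c M"
proof -
  have I: "Id C M \<cdot> a = a" "Id C M \<cdot> b = b" "Id C M \<cdot> c = c"
    using a b c by (auto simp: arrow_into_def)
  obtain \<kappa> where \<kappa>: "regular_cardinal \<Omega> \<kappa>" using accessible_C by (auto simp: accessible_def)
  \<comment> \<open>Index sets are subsets of \<open>'u\<close>, so the single index is an arbitrary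
    element of that type.\<close>
  have "small \<Omega> {undefined :: 'u}"
    unfolding small_def
    by (rule ordLess_transitive[OF finite_less_regular[OF \<kappa>] regular_cardinalD(5)[OF \<kappa>]]) simp
  then show ?thesis
    unfolding isi_forks_def
    by (intro exI[of _ M] exI[of _ "Id C M"] exI[of _ "{undefined :: 'u}"] exI[of _ "\<lambda>_. a"]
        exI[of _ "\<lambda>_. b"] conjI) (use a b div M extension_Id in \<open>auto simp: I\<close>)
qed

end

theorem theorem1p2:
  fixes \<Omega> :: "'u rel" and \<C> :: "('o, 'a) cat" and Mod :: "'o set"
    and \<B> :: "'o set" and ind :: "'o \<Rightarrow> 'a set \<Rightarrow> 'a set \<Rightarrow> 'a set \<Rightarrow> bool"
  assumes "inaccessible \<Omega>"
    and "AECat \<Omega> \<C> Mod"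
    and "AECat.amalgamation \<C> Mod"
    and "AECat.simple_independence_relation \<Omega> \<C> Mod \<B> ind"
  shows "\<forall>M \<in> Mod. \<forall>A \<in> Sub \<C> M. \<forall>B \<in> Sub \<C> M. \<forall>C \<in> Sub \<C> M. dom_in \<C> \<B> C \<longrightarrow>
           (ind M A C B \<longleftrightarrow> AECat.isi_d_independent \<Omega> \<C> Mod M A C B) \<and>
           (AECat.isi_d_independent \<Omega> \<C> Mod M A C B \<longleftrightarrow>
             AECat.isi_f_independent \<Omega> \<C> Mod M A C B)"
proof (intro ballI impI)
  interpret simple_AECat \<Omega> \<C> Mod \<B> ind
    using assms by (intro simple_AECat.intro simple_AECat_axioms.intro)
  fix M A B K
  assume M: "M \<in> Mod" and A: "A \<in> Sub \<C> M" and B: "B \<in> Sub \<C> M" and K: "K \<in> Sub \<C> M"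
    and KB: "dom_in \<C> \<B> K"
  have to_indep: "indep ind M a c b" if "ind M A K B" "a \<in> A" "b \<in> B" "c \<in> K" for a b c
    using that Sub_rep[OF A] Sub_rep[OF B] Sub_rep[OF K] by (intro indepI) auto
  have 1: "isi_d_independent M A K B" "isi_f_independent M A K B" if "ind M A K B"
    using to_indep[OF that] indep_not_isi_divides indep_not_isi_forks
    unfolding isi_d_independent_def isi_f_independent_def by blast+
  have 2: "ind M A K B" if d: "isi_d_independent M A K B"
  proof -
    \<comment> \<open>Subobjects are nonempty, and one triple of representatives is enough to
      recover \<open>ind\<close>.\<close>
    obtain a b c where abc: "a \<in> A" "b \<in> B" "c \<in> K"
      using A B K subobj_refl unfolding Sub_def by blast
    have "indep ind M a c b"
      by (rule not_isi_divides_indep[OF M])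
        (use abc Sub_rep[OF A] Sub_rep[OF B] Sub_rep[OF K] KB d in
          \<open>auto simp: isi_d_independent_def\<close>)
    from indepD(5)[OF this] show ?thesis
      using Sub_rep(2)[OF A abc(1)] Sub_rep(2)[OF B abc(2)] Sub_rep(2)[OF K abc(3)] by simp
  qed
  have 3: "isi_d_independent M A K B" if "isi_f_independent M A K B"
    using that isi_divides_isi_forks[OF M] Sub_rep(1)[OF A] Sub_rep(1)[OF B] Sub_rep(1)[OF K]
    unfolding isi_d_independent_def isi_f_independent_def by blast
  show "(ind M A K B \<longleftrightarrow> isi_d_independent M A K B) \<and>
      (isi_d_independent M A K B \<longleftrightarrow> isi_f_independent M A K B)"
    using 1 2 3 by blast
qed

end
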